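(* Let $\overline r=(r_i)_{i\in I}$ be an arbitrary (not necessarily finite) sequence of positive integers and let $\mathbf{F}=\{\mathcal{F}_1,\dots,\mathcal{F}_m\}$ be a finite family of irreducible finite linearly ordered $\overline r$-hypergraphs. Then $\mathrm{Forb}_{\mathbf{Hgr}(\overline r)}(\mathbf{F})$ has the canonical Ramsey property.
   Context: A linearly ordered $\overline r$-hypergraph is $(H,(E_i)_{i\in I},<)$ with $<$ a linear order on the vertex set $H$ and $E_i\subseteq\binom{H}{r_i}$. $\mathbf{Hgr}(\overline r)$ is the category of finite linearly ordered $\overline r$-hypergraphs (including the empty one) with embeddings as morphisms: injective maps $f$ with $x<y\iff f(x)<f(y)$ and $e\in E_i\iff f(e)\in E_i$. Such a hypergraph is irreducible if for all distinct vertices $a,b$ there are $i\in I$ and $e\in E_i$ with $a,b\in e$. For a category $\mathbf{C}$ and a class $\mathbf{F}$ of objects, $\mathrm{Forb}_{\mathbf{C}}(\mathbf{F})$ is the full subcategory of objects $A$ with $\hom_{\mathbf{C}}(F,A)=\varnothing$ for all $F\in\mathbf{F}$. For objects $A,B,C$ of a category, $C\xrightarrow{can}(B)^A$ means: for every $\chi:\hom(A,C)\to\omega$ there exist $w\in\hom(B,C)$, an object $Q$ and $q\in\hom(Q,A)$ such that for all $f,g\in\hom(A,B)$, $\chi(w\cdot f)=\chi(w\cdot g)$ iff $f\cdot q=g\cdot q$. A category has the canonical Ramsey property if for all objects $A,B$ with $\hom(A,B)\neq\varnothing$ there is an object $C$ with $C\xrightarrow{can}(B)^A$. *)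

theory Defs
  imports Main "HOL-Library.FuncSet" "HOL-Library.Ramsey"
begin

text \<open>
  \<open>Comp C A B D g f\<close> is the composite \<open>g \<cdot> f\<close> of \<open>f \<in> Hom C A B\<close> with \<open>g \<in> Hom C B D\<close>.
\<close>

record ('o, 'm) cat =
  Obj :: "'o set"
  Hom :: "'o \<Rightarrow> 'o \<Rightarrow> 'm set"
  Comp :: "'o \<Rightarrow> 'o \<Rightarrow> 'o \<Rightarrow> 'm \<Rightarrow> 'm \<Rightarrow> 'm"

locale category =
  fixes C :: "('o, 'm) cat"
  assumes comp_in: "\<lbrakk>A \<in> Obj C; B \<in> Obj C; D \<in> Obj C; f \<in> Hom C A B; g \<in> Hom C B D\<rbrakk>
      \<Longrightarrow> Comp C A B D g f \<in> Hom C A D"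
    and comp_assoc: "\<lbrakk>A \<in> Obj C; B \<in> Obj C; D \<in> Obj C; E \<in> Obj C;
        f \<in> Hom C A B; g \<in> Hom C B D; h \<in> Hom C D E\<rbrakk>
      \<Longrightarrow> Comp C A D E h (Comp C A B D g f) = Comp C A B E (Comp C B D E h g) f"
    and ident: "A \<in> Obj C \<Longrightarrow> \<exists>u\<in>Hom C A A.
        (\<forall>B\<in>Obj C. \<forall>f\<in>Hom C A B. Comp C A A B f u = f) \<and>
        (\<forall>B\<in>Obj C. \<forall>f\<in>Hom C B A. Comp C B A A u f = f)"

definition Forb :: "('o, 'm) cat \<Rightarrow> 'o set \<Rightarrow> ('o, 'm) cat" where
  "Forb C F = C\<lparr>Obj := {A \<in> Obj C. \<forall>X\<in>F. Hom C X A = {}}\<rparr>"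

text \<open>
  Only the values of \<open>\<chi>\<close> on \<open>Hom C A D\<close> matter, so total functions on the type of morphisms
  stand for the colourings of \<open>Hom C A D\<close>.
\<close>

definition can_arrow :: "('o, 'm) cat \<Rightarrow> 'o \<Rightarrow> 'o \<Rightarrow> 'o \<Rightarrow> bool" where
  "can_arrow C D B A \<longleftrightarrow>
    (\<forall>\<chi> :: 'm \<Rightarrow> nat. \<exists>w\<in>Hom C B D. \<exists>Q\<in>Obj C. \<exists>q\<in>Hom C Q A.
      \<forall>f\<in>Hom C A B. \<forall>g\<in>Hom C A B.
        \<chi> (Comp C A B D w f) = \<chi> (Comp C A B D w g) \<longleftrightarrow>
        Comp C Q A B f q = Comp C Q A B g q)"

definition canonical_ramsey_property :: "('o, 'm) cat \<Rightarrow> bool" where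
  "canonical_ramsey_property C \<longleftrightarrow>
    (\<forall>A\<in>Obj C. \<forall>B\<in>Obj C. Hom C A B \<noteq> {} \<longrightarrow> (\<exists>D\<in>Obj C. can_arrow C D B A))"

record ('v, 'i) hypergraph =
  verts :: "'v set"
  edges :: "'i \<Rightarrow> 'v set set"
  less_rel :: "'v rel"

text \<open>
  The set of edges at an index outside \<open>I\<close> carries no information and is required to be empty.
\<close>

definition finite_ordered_hypergraph ::
    "'i set \<Rightarrow> ('i \<Rightarrow> nat) \<Rightarrow> ('v, 'i) hypergraph \<Rightarrow> bool" where
  "finite_ordered_hypergraph I r H \<longleftrightarrow>
     finite (verts H) \<and>
     (\<forall>i\<in>I. edges H i \<subseteq> nsets (verts H) (r i)) \<and>
     (\<forall>i. i \<notin> I \<longrightarrow> edges H i = {}) \<and>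
     less_rel H \<subseteq> verts H \<times> verts H \<and>
     strict_linear_order_on (verts H) (less_rel H)"

definition irreducible_hypergraph :: "'i set \<Rightarrow> ('v, 'i) hypergraph \<Rightarrow> bool" where
  "irreducible_hypergraph I H \<longleftrightarrow>
     (\<forall>a\<in>verts H. \<forall>b\<in>verts H. a \<noteq> b \<longrightarrow> (\<exists>i\<in>I. \<exists>e\<in>edges H i. a \<in> e \<and> b \<in> e))"

text \<open>
  Embeddings are extensional functions, so that two of them are equal iff they agree on the
  vertices of their domain.
\<close>

definition embeddings ::
    "'i set \<Rightarrow> ('v, 'i) hypergraph \<Rightarrow> ('w, 'i) hypergraph \<Rightarrow> ('v \<Rightarrow> 'w) set" where
  "embeddings I A B =
     {f \<in> verts A \<rightarrow>\<^sub>E verts B.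
        inj_on f (verts A) \<and>
        (\<forall>x\<in>verts A. \<forall>y\<in>verts A. (x, y) \<in> less_rel A \<longleftrightarrow> (f x, f y) \<in> less_rel B) \<and>
        (\<forall>i\<in>I. \<forall>e. e \<subseteq> verts A \<longrightarrow> (e \<in> edges A i \<longleftrightarrow> f ` e \<in> edges B i))}"

text \<open>
  The vertices are taken from a type \<open>'v\<close>. If \<open>'v\<close> is infinite, then every finite linearly
  ordered hypergraph is isomorphic to an object of this category.
\<close>

definition Hgr ::
    "'i set \<Rightarrow> ('i \<Rightarrow> nat) \<Rightarrow> (('v, 'i) hypergraph, 'v \<Rightarrow> 'v) cat" where
  "Hgr I r =
     \<lparr>Obj = {H. finite_ordered_hypergraph I r H},
      Hom = embeddings I,
      Comp = (\<lambda>A B D g f. compose (verts A) g f)\<rparr>"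

lemma compose_in_embeddings:
  assumes "f \<in> embeddings I A B" "g \<in> embeddings I B D"
  shows "compose (verts A) g f \<in> embeddings I A D"
proof -
  have f: "f \<in> verts A \<rightarrow> verts B" and g: "g \<in> verts B \<rightarrow> verts D"
    using assms by (auto simp: embeddings_def)
  have img: "compose (verts A) g f ` e = g ` f ` e" if "e \<subseteq> verts A" for e
    using that by (force simp: compose_def)
  have sub: "f ` e \<subseteq> verts B" if "e \<subseteq> verts A" for e
    using that f by blast
  have inj: "inj_on (compose (verts A) g f) (verts A)"
    using assms f by (auto simp: embeddings_def inj_on_def compose_def Pi_iff)
  have "compose (verts A) g f \<in> verts A \<rightarrow>\<^sub>E verts D"
    using f g by (auto simp: compose_def)
  then show ?thesis
    using assms f img sub inj by (auto simp: embeddings_def compose_eq Pi_iff)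
qed

lemma id_in_embeddings: "restrict id (verts A) \<in> embeddings I A A"
proof -
  have "restrict id (verts A) ` e = e" if "e \<subseteq> verts A" for e
    using that by force
  then show ?thesis by (auto simp: embeddings_def inj_on_def)
qed

lemma category_Hgr:
  fixes I :: "'a set" and r :: "'a \<Rightarrow> nat"
  shows "category (Hgr I r :: (('b, 'a) hypergraph, 'b \<Rightarrow> 'b) cat)"
proof
  fix A :: "('b, 'a) hypergraph"
  have 1: "compose (verts A) f (restrict id (verts A)) = f" if "f \<in> embeddings I A B"
    for f and B :: "('b, 'a) hypergraph"
    using that by (auto simp: embeddings_def compose_def fun_eq_iff PiE_def extensional_def)
  have 2: "compose (verts B) (restrict id (verts A)) f = f" if "f \<in> embeddings I B A"
    for f and B :: "('b, 'a) hypergraph"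
    using that by (fastforce simp: embeddings_def compose_def fun_eq_iff PiE_def extensional_def)
  show "\<exists>u\<in>Hom (Hgr I r) A A.
        (\<forall>B\<in>Obj (Hgr I r). \<forall>f\<in>Hom (Hgr I r) A B. Comp (Hgr I r) A A B f u = f) \<and>
        (\<forall>B\<in>Obj (Hgr I r). \<forall>f\<in>Hom (Hgr I r) B A. Comp (Hgr I r) B A A u f = f)"
    using 1 2 id_in_embeddings[of A I]
    by (intro bexI[of _ "restrict id (verts A)"]) (auto simp: Hgr_def)
next
  fix A B D E :: "('b, 'a) hypergraph" and f g h
  assume "f \<in> Hom (Hgr I r) A B"
  then show "Comp (Hgr I r) A D E h (Comp (Hgr I r) A B D g f) =
      Comp (Hgr I r) A B E (Comp (Hgr I r) B D E h g) f"
    by (auto simp: Hgr_def embeddings_def compose_def fun_eq_iff Pi_iff)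
qed (auto simp: Hgr_def intro: compose_in_embeddings)

lemma category_Forb:
  assumes "category C"
  shows "category (Forb C F)"
proof -
  interpret category C by fact
  show ?thesis
  proof
    fix A assume "A \<in> Obj (Forb C F)"
    then have "A \<in> Obj C" by (simp add: Forb_def)
    from ident[OF this] show "\<exists>u\<in>Hom (Forb C F) A A.
        (\<forall>B\<in>Obj (Forb C F). \<forall>f\<in>Hom (Forb C F) A B. Comp (Forb C F) A A B f u = f) \<and>
        (\<forall>B\<in>Obj (Forb C F). \<forall>f\<in>Hom (Forb C F) B A. Comp (Forb C F) B A A u f = f)"
      unfolding Forb_def by simp blast
  qed (auto simp: Forb_def intro: comp_in comp_assoc)
qed

end

theory Submission
  imports Defs
begin

text \<open>
  The Ramsey property for finitely many colours comes from two partite constructions in the style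
  of Nesetril and Roedl, both driven by the Hales--Jewett theorem. The first one, over a linear
  order supplied by Ramsey's theorem, ignores the forbidden hypergraphs and yields \<open>C\<^sub>0\<close> with
  \<open>C\<^sub>0 \<rightarrow> (B)\<^sup>A\<close>. The second one has \<open>C\<^sub>0\<close> as base; there the projection to \<open>C\<^sub>0\<close> embeds every
  irreducible set and sends it into a copy of \<open>A\<close> or of \<open>B\<close>, so nothing forbidden arises.

  For the canonical version, colour the copies of \<open>B\<close> by the partition of \<open>hom(A, B)\<close> that \<open>\<chi>\<close>
  induces, and the copies of \<open>A\<close> with one vertex \<open>x\<close> freely duplicated by whether \<open>\<chi>\<close> distinguishes
  its two copies of \<open>A\<close>. On a homogeneous copy of a large structure let \<open>Q\<close> be the set of those \<open>x\<close>
  that are distinguished. If \<open>f\<close> and \<open>g\<close> agree on \<open>Q\<close>, a path of free moves of vertices outside \<open>Q\<close>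
  leads from \<open>f\<close> to \<open>g\<close>, so they have the same colour. Conversely, if they have the same colour, then
  duplicating a vertex of \<open>B\<close> changes the colour of \<open>f\<close> iff it changes that of \<open>g\<close>; thus
  \<open>f ` Q = g ` Q\<close>, and \<open>f\<close> and \<open>g\<close> agree on \<open>Q\<close> because both are increasing.
\<close>

section \<open>The Hales--Jewett theorem\<close>

text \<open>A single partite construction over a linear order is not enough: such a base has no
  edges, so the projection cannot control which irreducible sets arise. Over
  \<open>C\<^sub>0\<close> every edge projects to an edge. The price is that words must carry enough
  edges for an irreducible set of words to reflect the edges of \<open>C\<^sub>0\<close>; the
  product edges are the choice that does this.

  In the canonical part the set \<open>Q\<close> depends on the colouring and is known only after
  homogenization. Therefore every structure that the argument might need is prepared beforehand:
  \<open>B\<close>, its duplication at each vertex, and a connecting structure for each pair of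
  copies and each set \<open>Q\<close> on which they agree. These are finitely many, and one
  disjoint union contains them all. The delicate point is that the intermediate copies on a path
  from \<open>f\<close> to \<open>g\<close> must live inside the class. The connecting structure is
  thus glued from charts, each a copy of \<open>A\<close> or of \<open>B\<close>, in such a way that
  an irreducible set never spreads over several charts.\<close>

definition inst :: "'a option list \<Rightarrow> 'a \<Rightarrow> 'a list" where
  "inst \<tau> a = map (case_option a (\<lambda>b. b)) \<tau>"

definition lines :: "'a set \<Rightarrow> nat \<Rightarrow> 'a option list set" where
  "lines A N = {\<tau>. length \<tau> = N \<and> None \<in> set \<tau> \<and> set \<tau> \<subseteq> insert None (Some ` A)}"

lemma inst_append: "inst (\<tau> @ \<sigma>) a = inst \<tau> a @ inst \<sigma> a"
  by (simp add: inst_def)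

lemma inst_map_Some [simp]: "inst (map Some w) a = w"
  by (simp add: inst_def comp_def)

lemma length_inst [simp]: "length (inst \<tau> a) = length \<tau>"
  by (simp add: inst_def)

lemma set_inst:
  assumes "\<tau> \<in> lines A N" "a \<in> A"
  shows "set (inst \<tau> a) \<subseteq> A"
  using assms by (auto simp: inst_def lines_def split: option.split)

lemma finite_lines: "finite A \<Longrightarrow> finite (lines A N)"
  by (rule finite_subset[OF _ finite_lists_length_eq[of "insert None (Some ` A)" N]])
    (auto simp: lines_def)

lemma lines_append_left:
  assumes "\<tau> \<in> lines A M" "length w = N" "set w \<subseteq> A"
  shows "map Some w @ \<tau> \<in> lines A (N + M)"
  using assms by (auto simp: lines_def)

lemma lines_append_right:
  assumes "\<tau> \<in> lines A M" "length w = N" "set w \<subseteq> A"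
  shows "\<tau> @ map Some w \<in> lines A (M + N)"
  using assms by (auto simp: lines_def)

lemma lines_append:
  assumes "\<tau> \<in> lines A M" "\<sigma> \<in> lines A N"
  shows "\<tau> @ \<sigma> \<in> lines A (M + N)"
  using assms by (auto simp: lines_def)

lemma lines_mono: "A \<subseteq> B \<Longrightarrow> lines A N \<subseteq> lines B N"
  by (auto simp: lines_def)

lemma single_None_in_lines: "[None] \<in> lines A (Suc 0)"
  by (simp add: lines_def)

definition mono_line :: "'a set \<Rightarrow> nat \<Rightarrow> ('a list \<Rightarrow> 'c) \<Rightarrow> bool" where
  "mono_line A N \<chi> \<longleftrightarrow> (\<exists>\<tau>\<in>lines A N. \<forall>a\<in>A. \<forall>b\<in>A. \<chi> (inst \<tau> a) = \<chi> (inst \<tau> b))"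

text \<open>Colour focusing applies the theorem with functions as colours, so the colours have to be
  numbered first.\<close>

lemma mono_line_finite_colours:
  fixes S :: "'c set"
  assumes HJ: "\<And>k::nat. \<exists>N. \<forall>\<chi>::'a list \<Rightarrow> nat. (\<forall>w. \<chi> w < k) \<longrightarrow> mono_line A N \<chi>"
    and S: "finite S"
  shows "\<exists>N. \<forall>\<chi>::'a list \<Rightarrow> 'c. (\<forall>w. \<chi> w \<in> S) \<longrightarrow> mono_line A N \<chi>"
proof -
  obtain h where h: "bij_betw h S {0..<card S}"
    using ex_bij_betw_finite_nat[OF S] by blast
  from HJ[of "card S"] obtain N
    where N: "\<forall>\<chi>::'a list \<Rightarrow> nat. (\<forall>w. \<chi> w < card S) \<longrightarrow> mono_line A N \<chi>" ..
  show ?thesis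
  proof (intro exI allI impI)
    fix \<chi> :: "'a list \<Rightarrow> 'c" assume \<chi>: "\<forall>w. \<chi> w \<in> S"
    then have "\<forall>w. h (\<chi> w) < card S"
      using h by (auto simp: bij_betw_def)
    then have "mono_line A N (\<lambda>w. h (\<chi> w))"
      using N[rule_format, of "\<lambda>w. h (\<chi> w)"] by simp
    moreover have "h (\<chi> u) = h (\<chi> v) \<longleftrightarrow> \<chi> u = \<chi> v" for u v
      using h \<chi> by (auto simp: bij_betw_def inj_on_def)
    ultimately show "mono_line A N \<chi>"
      by (simp add: mono_line_def)
  qed
qed

text \<open>Colour focusing: the lines end in the same word \<open>f\<close>, and are recorded by the set \<open>S\<close> of
  their colours, so that different lines have different colours.\<close>

definition focused :: "'a set \<Rightarrow> 'a \<Rightarrow> nat \<Rightarrow> ('a list \<Rightarrow> 'c) \<Rightarrow> 'c set \<Rightarrow> 'a list \<Rightarrow> bool" where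
  "focused A z N \<chi> S f \<longleftrightarrow> finite S \<and> length f = N \<and> set f \<subseteq> insert z A \<and>
    (\<forall>c\<in>S. \<exists>\<tau>\<in>lines (insert z A) N. inst \<tau> z = f \<and> (\<forall>a\<in>A. \<chi> (inst \<tau> a) = c))"

text \<open>Induction on the number \<open>s\<close> of focused lines. A new block of letters is
  appended, on which the smaller alphabet \<open>A\<close> already yields a line \<open>L\<close>;
  moving along \<open>L\<close> gives one more line, and the old lines are extended by
  \<open>L\<close>.\<close>

lemma colour_focusing:
  fixes A :: "'a set"
  assumes HJ: "\<And>k::nat. \<exists>N. \<forall>\<chi>::'a list \<Rightarrow> nat. (\<forall>w. \<chi> w < k) \<longrightarrow> mono_line A N \<chi>"
    and A: "finite A" "A \<noteq> {}"
  shows "\<exists>N. \<forall>\<chi>::'a list \<Rightarrow> nat. (\<forall>w. \<chi> w < k) \<longrightarrow> mono_line (insert z A) N \<chi> \<or>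
    (\<exists>S f. card S = s \<and> focused A z N \<chi> S f)"
proof (induction s)
  case 0
  have "focused A z 0 \<chi> {} []" for \<chi> :: "'a list \<Rightarrow> nat"
    by (simp add: focused_def)
  then show ?case by (intro exI[of _ 0] allI impI disjI2 exI[of _ "{}"] exI[of _ "[]"]) simp
next
  case (Suc s)
  let ?Z = "insert z A"
  from Suc.IH obtain N where N: "\<forall>\<chi>::'a list \<Rightarrow> nat. (\<forall>w. \<chi> w < k) \<longrightarrow> mono_line ?Z N \<chi> \<or>
    (\<exists>S f. card S = s \<and> focused A z N \<chi> S f)" ..
  define W where "W = {w. set w \<subseteq> ?Z \<and> length w = N}"
  have "finite W"
    unfolding W_def using A by (intro finite_lists_length_eq) auto
  then have "finite (W \<rightarrow>\<^sub>E {..<k})"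
    by (intro finite_PiE) auto
  \<comment> \<open>The colour of a block of \<open>M\<close> letters is the whole function that it
    induces on the words of length \<open>N\<close>. A monochromatic line then works for all
    prefixes at once.\<close>
  from mono_line_finite_colours[OF HJ this]
  obtain M where M: "\<forall>\<chi>. (\<forall>w. \<chi> w \<in> W \<rightarrow>\<^sub>E {..<k}) \<longrightarrow> mono_line A M \<chi>" ..
  obtain a0 where a0: "a0 \<in> A" using A by blast
  show ?case
  proof (intro exI[of _ "N + M"] allI impI)
    fix \<chi> :: "'a list \<Rightarrow> nat" assume \<chi>: "\<forall>w. \<chi> w < k"
    define \<chi>1 where "\<chi>1 u = restrict (\<lambda>w. \<chi> (w @ u)) W" for u
    have "mono_line A M \<chi>1"
      by (rule M[rule_format]) (use \<chi> in \<open>auto simp: \<chi>1_def\<close>)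
    then obtain L where L: "L \<in> lines A M" "\<And>a. a \<in> A \<Longrightarrow> \<chi>1 (inst L a) = \<chi>1 (inst L a0)"
      using a0 unfolding mono_line_def by blast
    define u0 where "u0 = inst L a0"
    have u0: "length u0 = M" "set u0 \<subseteq> ?Z"
      using set_inst[OF L(1) a0] L(1) by (auto simp: u0_def lines_def)
    have shift: "\<chi> (w @ inst L a) = \<chi> (w @ u0)" if "w \<in> W" "a \<in> A" for w a
      using fun_cong[OF L(2)[OF that(2)], of w] that(1) by (simp add: \<chi>1_def u0_def)
    \<comment> \<open>Freezing the last block at \<open>u0\<close> leaves a colouring of words of
      length \<open>N\<close>, to which the induction hypothesis applies.\<close>
    define \<chi>' where "\<chi>' w = \<chi> (w @ u0)" for w
    have lift: "mono_line ?Z (N + M) \<chi>" if ml: "mono_line ?Z N \<chi>'"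
    proof -
      obtain \<tau> where \<tau>: "\<tau> \<in> lines ?Z N"
        "\<And>a b. a \<in> ?Z \<Longrightarrow> b \<in> ?Z \<Longrightarrow> \<chi>' (inst \<tau> a) = \<chi>' (inst \<tau> b)"
        using ml unfolding mono_line_def by blast
      have "\<chi> (inst (\<tau> @ map Some u0) a) = \<chi> (inst (\<tau> @ map Some u0) b)"
        if "a \<in> ?Z" "b \<in> ?Z" for a b
        using \<tau>(2)[OF that] by (simp only: inst_append inst_map_Some \<chi>'_def)
      then show ?thesis
        using lines_append_right[OF \<tau>(1) u0] unfolding mono_line_def by blast
    qed
    have \<chi>'k: "\<forall>w. \<chi>' w < k" using \<chi> by (simp add: \<chi>'_def)
    show "mono_line ?Z (N + M) \<chi> \<or> (\<exists>S f. card S = Suc s \<and> focused A z (N + M) \<chi> S f)"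
    proof (cases "mono_line ?Z N \<chi>'")
      case True
      then show ?thesis using lift by blast
    next
      case notmono: False
      then obtain S f where S: "card S = s" "focused A z N \<chi>' S f"
        using N[rule_format, of \<chi>'] \<chi>'k by blast
      have f: "finite S" "length f = N" "set f \<subseteq> ?Z"
        using S(2) by (auto simp: focused_def)
      have foc: "\<exists>\<tau>. \<tau> \<in> lines ?Z N \<and> inst \<tau> z = f \<and> (\<forall>a\<in>A. \<chi>' (inst \<tau> a) = c)"
        if "c \<in> S" for c
        using S(2) that unfolding focused_def by blast
      \<comment> \<open>A focused line with the colour of its endpoint would be monochromatic on all
        of \<open>?Z\<close>.\<close>
      have new: "\<chi>' f \<notin> S"
      proof
        assume "\<chi>' f \<in> S"
        from foc[OF this] obtain \<tau> where \<tau>: "\<tau> \<in> lines ?Z N" "inst \<tau> z = f"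
          "\<forall>a\<in>A. \<chi>' (inst \<tau> a) = \<chi>' f"
          by blast
        have "mono_line ?Z N \<chi>'"
          unfolding mono_line_def by (rule bexI[OF _ \<tau>(1)]) (use \<tau>(2,3) in auto)
        then show False using notmono by blast
      qed
      have LZ: "L \<in> lines ?Z M"
        using L(1) lines_mono[of A ?Z M] by blast
      \<comment> \<open>The new colour belongs to the line that fixes \<open>f\<close> and varies
        along \<open>L\<close> only; an old colour is kept by letting its line and \<open>L\<close>
        vary together, since letters of \<open>A\<close> in \<open>L\<close> do not affect the
        colour.\<close>
      have "\<exists>\<tau>\<in>lines ?Z (N + M). inst \<tau> z = f @ inst L z \<and> (\<forall>a\<in>A. \<chi> (inst \<tau> a) = c)"
        if c: "c \<in> insert (\<chi>' f) S" for c
      proof (cases "c = \<chi>' f")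
        case True
        have "f \<in> W" using f by (simp add: W_def)
        then show ?thesis
          by (intro bexI[OF _ lines_append_left[OF LZ f(2,3)]])
            (simp add: inst_append \<chi>'_def True shift)
      next
        case False
        then obtain \<tau> where \<tau>: "\<tau> \<in> lines ?Z N" "inst \<tau> z = f" "\<forall>a\<in>A. \<chi>' (inst \<tau> a) = c"
          using foc c by blast
        have "inst \<tau> a \<in> W" if "a \<in> A" for a
          using set_inst[OF \<tau>(1), of a] \<tau>(1) that by (simp add: W_def lines_def)
        then show ?thesis
          using \<tau>(2,3) by (intro bexI[OF _ lines_append[OF \<tau>(1) LZ]])
            (simp add: inst_append \<chi>'_def shift)
      qed
      moreover have "set (inst L z) \<subseteq> ?Z" "length (inst L z) = M"
        using set_inst[OF LZ, of z] LZ by (auto simp: lines_def)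
      ultimately have "focused A z (N + M) \<chi> (insert (\<chi>' f) S) (f @ inst L z)"
        using f unfolding focused_def by simp
      moreover have "card (insert (\<chi>' f) S) = Suc s"
        using S(1) f(1) new by simp
      ultimately show ?thesis by blast
    qed
  qed
qed

text \<open>Induction on the alphabet. With \<open>k\<close> colours there cannot be
  \<open>k + 1\<close> focused lines of different colours, so colour focusing leaves only the
  monochromatic line.\<close>

theorem hales_jewett:
  fixes A :: "'a set"
  assumes "finite A"
  shows "\<exists>N. \<forall>\<chi>::'a list \<Rightarrow> nat. (\<forall>w. \<chi> w < k) \<longrightarrow> mono_line A N \<chi>"
  using assms
proof (induction A arbitrary: k rule: finite_induct)
  case empty
  show ?case
    by (intro exI[of _ 1]) (auto simp: mono_line_def intro: single_None_in_lines)
next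
  case (insert z A)
  show ?case
  proof (cases "A = {}")
    case True
    then show ?thesis
      by (intro exI[of _ 1]) (auto simp: mono_line_def intro: single_None_in_lines)
  next
    case False
    from colour_focusing[OF insert.IH insert.hyps(1) False, of k z "Suc k"]
    obtain N where N: "\<forall>\<chi>::'a list \<Rightarrow> nat. (\<forall>w. \<chi> w < k) \<longrightarrow> mono_line (insert z A) N \<chi> \<or>
      (\<exists>S f. card S = Suc k \<and> focused A z N \<chi> S f)" ..
    show ?thesis
    proof (intro exI allI impI)
      fix \<chi> :: "'a list \<Rightarrow> nat" assume \<chi>: "\<forall>w. \<chi> w < k"
      have False if S: "card S = Suc k" "focused A z N \<chi> S f" for S f
      proof -
        have "c < k" if c: "c \<in> S" for c
        proof -
          obtain \<tau> where "\<forall>a\<in>A. \<chi> (inst \<tau> a) = c"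
            using S(2) c unfolding focused_def by blast
          then show ?thesis using False \<chi> by fastforce
        qed
        then have "S \<subseteq> {..<k}" by blast
        then have "card S \<le> k" using card_mono[of "{..<k}" S] by simp
        then show False using S(1) by simp
      qed
      then show "mono_line (insert z A) N \<chi>"
        using N[rule_format, of \<chi>] \<chi> by blast
    qed
  qed
qed

section \<open>The partite construction\<close>

definition emb :: "'a set \<Rightarrow> ('i \<Rightarrow> 'a set set) \<Rightarrow> 'b set \<Rightarrow> ('i \<Rightarrow> 'b set set) \<Rightarrow> ('a \<Rightarrow> 'b) \<Rightarrow> bool"
  where "emb V E V' E' f \<longleftrightarrow> f \<in> V \<rightarrow> V' \<and> inj_on f V \<and>
    (\<forall>i e. e \<subseteq> V \<longrightarrow> (f ` e \<in> E' i \<longleftrightarrow> e \<in> E i))"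

definition irr :: "('i \<Rightarrow> 'a set set) \<Rightarrow> 'a set \<Rightarrow> bool" where
  "irr E W \<longleftrightarrow> (\<forall>a\<in>W. \<forall>b\<in>W. a \<noteq> b \<longrightarrow> (\<exists>i. \<exists>e\<in>E i. e \<subseteq> W \<and> a \<in> e \<and> b \<in> e))"

text \<open>Copies are sorted by the position \<theta> to which they project. One partite step makes
  the copies over a single \<theta> homogeneous; colours over different positions are compared only
  in the base.\<close>

definition copies :: "'c set \<Rightarrow> ('i \<Rightarrow> 'c set set) \<Rightarrow> 'a set \<Rightarrow> ('i \<Rightarrow> 'a set set) \<Rightarrow>
    ('a \<Rightarrow> 'p) \<Rightarrow> ('c \<Rightarrow> 'p) \<Rightarrow> ('c \<Rightarrow> 'a) set" where
  "copies A EA V E \<pi> \<theta> = {\<alpha> \<in> extensional A. emb A EA V E \<alpha> \<and> (\<forall>x\<in>A. \<pi> (\<alpha> x) = \<theta> x)}"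

lemma emb_edge: "emb V E V' E' f \<Longrightarrow> e \<subseteq> V \<Longrightarrow> f ` e \<in> E' i \<longleftrightarrow> e \<in> E i"
  by (simp add: emb_def)

lemma emb_in: "emb V E V' E' f \<Longrightarrow> x \<in> V \<Longrightarrow> f x \<in> V'"
  by (auto simp: emb_def)

lemma emb_inj: "emb V E V' E' f \<Longrightarrow> inj_on f V"
  by (simp add: emb_def)

lemma emb_cong:
  assumes "\<And>x. x \<in> V \<Longrightarrow> f x = g x"
  shows "emb V E V' E' f = emb V E V' E' g"
proof -
  have "f ` e = g ` e" if "e \<subseteq> V" for e using assms that by force
  moreover have "inj_on f V = inj_on g V" using assms by (rule inj_on_cong)
  ultimately show ?thesis using assms by (auto simp: emb_def Pi_iff)
qed

lemma emb_comp:
  assumes "emb V E V' E' f" "emb V' E' V'' E'' g"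
  shows "emb V E V'' E'' (g \<circ> f)"
proof -
  have "f ` e \<subseteq> V'" if "e \<subseteq> V" for e
    using assms(1) that by (auto simp: emb_def)
  moreover have "inj_on (g \<circ> f) V"
    using assms by (auto simp: emb_def intro!: comp_inj_on intro: inj_on_subset)
  moreover have "(g \<circ> f) ` e = g ` f ` e" for e
    by (simp add: image_comp)
  ultimately show ?thesis
    using assms unfolding emb_def by (simp add: Pi_iff)
qed

lemma emb_compose:
  assumes "emb V E V' E' f" "emb V' E' V'' E'' g"
  shows "emb V E V'' E'' (compose V g f)"
  using emb_comp[OF assms] emb_cong[of V "compose V g f" "g \<circ> f" E V'' E'']
  by (simp add: compose_def)

lemma finite_copies:
  assumes "finite A" "finite V"
  shows "finite (copies A EA V E \<pi> \<theta>)"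
  by (rule finite_subset[OF _ finite_PiE[OF assms(1), of "\<lambda>_. V"]])
    (auto simp: copies_def emb_def PiE_def assms)

lemma irr_image:
  assumes "emb V E V' E' f" "W \<subseteq> V"
  shows "irr E' (f ` W) \<longleftrightarrow> irr E W"
proof
  assume *: "irr E' (f ` W)"
  show "irr E W"
    unfolding irr_def
  proof (intro ballI impI)
    fix a b assume ab: "a \<in> W" "b \<in> W" "a \<noteq> b"
    then have "f a \<noteq> f b"
      using inj_onD[OF emb_inj[OF assms(1)], of a b] assms(2) by blast
    then obtain i e where e: "e \<in> E' i" "e \<subseteq> f ` W" "f a \<in> e" "f b \<in> e"
      using * ab unfolding irr_def by blast
    then obtain d where d: "d \<subseteq> W" "e = f ` d" by (auto simp: subset_image_iff)
    have "d \<in> E i" using emb_edge[OF assms(1), of d i] d e assms(2) by auto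
    moreover have "a \<in> d" "b \<in> d"
      using d e(3,4) ab inj_on_image_mem_iff[OF emb_inj[OF assms(1)]] assms(2) by blast+
    ultimately show "\<exists>i. \<exists>e\<in>E i. e \<subseteq> W \<and> a \<in> e \<and> b \<in> e" using d by blast
  qed
next
  assume *: "irr E W"
  show "irr E' (f ` W)"
    unfolding irr_def
  proof (intro ballI impI)
    fix a b assume ab: "a \<in> f ` W" "b \<in> f ` W" "a \<noteq> b"
    then obtain a' b' where ab': "a = f a'" "b = f b'" "a' \<in> W" "b' \<in> W" "a' \<noteq> b'" by blast
    then obtain i e where e: "e \<in> E i" "e \<subseteq> W" "a' \<in> e" "b' \<in> e"
      using * unfolding irr_def by blast
    then have "f ` e \<in> E' i"
      using emb_edge[OF assms(1), of e i] assms(2) by auto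
    moreover have "f ` e \<subseteq> f ` W" "a \<in> f ` e" "b \<in> f ` e"
      using ab' e by auto
    ultimately show "\<exists>i. \<exists>e\<in>E' i. e \<subseteq> f ` W \<and> a \<in> e \<and> b \<in> e" by blast
  qed
qed

lemma emb_relabel:
  assumes "inj_on \<rho> V" "\<And>i. E i \<subseteq> Pow V"
  shows "emb V E (\<rho> ` V) (\<lambda>i. image \<rho> ` E i) \<rho>"
    and "emb (\<rho> ` V) (\<lambda>i. image \<rho> ` E i) V E (inv_into V \<rho>)"
proof -
  have *: "\<rho> ` e \<in> image \<rho> ` E i \<longleftrightarrow> e \<in> E i" if "e \<subseteq> V" for e i
  proof
    assume "\<rho> ` e \<in> image \<rho> ` E i"
    then obtain d where d: "d \<in> E i" "\<rho> ` e = \<rho> ` d" by blast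
    then have "d \<subseteq> V" using assms(2) by blast
    then show "e \<in> E i"
      using inj_on_image_eq_iff[OF assms(1) that, of d] d by simp
  qed simp
  then show "emb V E (\<rho> ` V) (\<lambda>i. image \<rho> ` E i) \<rho>"
    using assms by (simp add: emb_def)
  have "inv_into V \<rho> ` e \<in> E i \<longleftrightarrow> e \<in> image \<rho> ` E i" if eV: "e \<subseteq> \<rho> ` V" for e i
  proof -
    obtain d where d: "d \<subseteq> V" "e = \<rho> ` d" using eV by (auto simp: subset_image_iff)
    then have "inv_into V \<rho> ` e = d" using assms(1) by (simp add: inv_into_image_cancel)
    then show ?thesis using * d by simp
  qed
  then show "emb (\<rho> ` V) (\<lambda>i. image \<rho> ` E i) V E (inv_into V \<rho>)"
    by (auto simp: emb_def inv_into_into inj_on_inv_into)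
qed

text \<open>The predicate \<open>ok\<close> lists the admissible sizes of edges of each kind.
  Positivity makes edges nonempty, so that in a disjoint union an edge determines its
  component.\<close>

locale struct_class =
  fixes ok :: "'i \<Rightarrow> nat \<Rightarrow> bool"
  assumes ok_pos: "ok i n \<Longrightarrow> 0 < n"
begin

definition sys :: "'a set \<Rightarrow> ('i \<Rightarrow> 'a set set) \<Rightarrow> bool" where
  "sys V E \<longleftrightarrow> finite V \<and> (\<forall>i. \<forall>e\<in>E i. e \<subseteq> V \<and> ok i (card e))"

lemma sysD: "sys V E \<Longrightarrow> e \<in> E i \<Longrightarrow> e \<subseteq> V"
  by (auto simp: sys_def)

lemma sys_nonempty: "sys V E \<Longrightarrow> e \<in> E i \<Longrightarrow> e \<noteq> {}"
  using ok_pos by (fastforce simp: sys_def)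

lemma sys_relabel:
  assumes "sys V E" "inj_on \<rho> V"
  shows "sys (\<rho> ` V) (\<lambda>i. image \<rho> ` E i)"
proof -
  have "card (\<rho> ` e) = card e" if "e \<subseteq> V" for e
    using card_image inj_on_subset[OF assms(2) that] by blast
  then show ?thesis using assms(1) by (simp add: sys_def image_mono)
qed

end

text \<open>One step of the partite construction. The part \<open>D\<close> of the system over \<open>\<theta> ` A\<close> is replaced by
  its power \<open>words\<close>, whose points \<open>x \<mapsto> [\<alpha>\<^sub>1 x, \<dots>, \<alpha>\<^sub>N x]\<close> are copies of \<open>A\<close>; every combinatorial
  line \<open>\<tau>\<close> spans a copy \<open>lam \<tau>\<close> of the whole system, and different copies meet in \<open>words\<close> only.
  \<open>X\<close> provides additional edges between words.\<close>

locale glue = struct_class ok for ok :: "'i \<Rightarrow> nat \<Rightarrow> bool" +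
  fixes V :: "'a set" and E and \<pi> :: "'a \<Rightarrow> 'p"
    and A :: "'c set" and EA :: "'i \<Rightarrow> 'c set set" and \<theta> :: "'c \<Rightarrow> 'p" and N :: nat
    and X :: "'i \<Rightarrow> 'a list set set"
  assumes sysV: "sys V E" and finA: "finite A" and inj_theta: "inj_on \<theta> A"
begin

abbreviation "cop \<equiv> copies A EA V E \<pi> \<theta>"

definition D :: "'a set" where "D = {v \<in> V. \<pi> v \<in> \<theta> ` A}"

definition words :: "'a list set" where
  "words = {us. length us = N \<and> set us \<subseteq> D \<and> (\<exists>y. \<forall>u\<in>set us. \<pi> u = y)}"

text \<open>At a variable position the point itself is kept; at a constant position \<alpha> it is
  replaced by the point of the copy \<alpha> in the same part, which is unique because \<theta> is
  injective.\<close>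

definition coord :: "('c \<Rightarrow> 'a) option \<Rightarrow> 'a \<Rightarrow> 'a" where
  "coord m v = (case m of None \<Rightarrow> v | Some \<alpha> \<Rightarrow> \<alpha> (inv_into A \<theta> (\<pi> v)))"

definition lam :: "('c \<Rightarrow> 'a) option list \<Rightarrow> 'a \<Rightarrow> ('c \<Rightarrow> 'a) option list \<times> 'a + 'a list" where
  "lam \<tau> v = (if v \<in> D then Inr (map (\<lambda>m. coord m v) \<tau>) else Inl (\<tau>, v))"

definition GV :: "(('c \<Rightarrow> 'a) option list \<times> 'a + 'a list) set" where
  "GV = Inl ` (lines cop N \<times> (V - D)) \<union> Inr ` words"

definition GE :: "'i \<Rightarrow> (('c \<Rightarrow> 'a) option list \<times> 'a + 'a list) set set" where
  "GE i = {lam \<tau> ` e |\<tau> e. \<tau> \<in> lines cop N \<and> e \<in> E i} \<union> image Inr ` X i"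

definition G\<pi> :: "('c \<Rightarrow> 'a) option list \<times> 'a + 'a list \<Rightarrow> 'p" where
  "G\<pi> u = (case u of Inl (\<tau>, v) \<Rightarrow> \<pi> v | Inr us \<Rightarrow> \<pi> (hd us))"

lemma DV: "D \<subseteq> V" by (auto simp: D_def)

lemma coord_None [simp]: "coord None v = v"
  by (simp add: coord_def)

lemma coord_Some:
  assumes "\<alpha> \<in> cop" "v \<in> D"
  shows "coord (Some \<alpha>) v \<in> D" "\<pi> (coord (Some \<alpha>) v) = \<pi> v"
proof -
  let ?x = "inv_into A \<theta> (\<pi> v)"
  have x: "?x \<in> A" "\<theta> ?x = \<pi> v"
    using assms by (auto simp: D_def inv_into_into f_inv_into_f)
  then show "\<pi> (coord (Some \<alpha>) v) = \<pi> v"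
    using assms by (simp add: copies_def coord_def)
  then show "coord (Some \<alpha>) v \<in> D"
    using assms x by (auto simp: D_def copies_def coord_def emb_def)
qed

lemma coord_in:
  assumes "\<tau> \<in> lines cop N" "m \<in> set \<tau>" "v \<in> D"
  shows "coord m v \<in> D" "\<pi> (coord m v) = \<pi> v"
  using assms coord_Some by (auto simp: lines_def subset_iff)

lemma word_in:
  assumes "\<tau> \<in> lines cop N" "v \<in> D"
  shows "map (\<lambda>m. coord m v) \<tau> \<in> words"
  using assms coord_in[OF assms(1) _ assms(2)] by (auto simp: words_def lines_def)

lemma hd_word:
  assumes "\<tau> \<in> lines cop N" "v \<in> D"
  shows "\<pi> (hd (map (\<lambda>m. coord m v) \<tau>)) = \<pi> v"
proof -
  have "\<tau> \<noteq> []" using assms by (auto simp: lines_def)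
  then show ?thesis using coord_in(2)[OF assms(1) hd_in_set assms(2)] by (simp add: hd_map)
qed

lemma G\<pi>_lam: "\<tau> \<in> lines cop N \<Longrightarrow> G\<pi> (lam \<tau> v) = \<pi> v"
  using hd_word by (auto simp: G\<pi>_def lam_def)

lemma lam_in: "\<tau> \<in> lines cop N \<Longrightarrow> v \<in> V \<Longrightarrow> lam \<tau> v \<in> GV"
  using word_in by (auto simp: GV_def lam_def)

lemma None_index:
  assumes "\<tau> \<in> lines cop N"
  obtains j where "j < N" "\<tau> ! j = None"
  using assms unfolding lines_def by (auto simp: in_set_conv_nth)

lemma lam_inj: "\<tau> \<in> lines cop N \<Longrightarrow> inj_on (lam \<tau>) V"
proof (rule inj_onI)
  fix u v assume \<tau>: "\<tau> \<in> lines cop N" and eq: "lam \<tau> u = lam \<tau> v"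
  obtain m where "m \<in> set \<tau>" "m = None" using \<tau> by (auto simp: lines_def)
  then show "u = v"
    using eq by (auto simp: lam_def split: if_splits)
qed

definition pr :: "nat \<Rightarrow> ('c \<Rightarrow> 'a) option list \<times> 'a + 'a list \<Rightarrow> 'a" where
  "pr j u = (case u of Inl (\<tau>, v) \<Rightarrow> v | Inr us \<Rightarrow> us ! j)"

lemma pr_lam:
  assumes "\<tau> \<in> lines cop N" "j < N" "v \<in> D"
  shows "pr j (lam \<tau> v) = coord (\<tau> ! j) v"
  using assms by (auto simp: pr_def lam_def lines_def)

lemma pr_lam_image:
  assumes "\<tau> \<in> lines cop N" "j < N" "e \<subseteq> D"
  shows "pr j ` lam \<tau> ` e = coord (\<tau> ! j) ` e"
  unfolding image_image using assms by (intro image_cong) (auto simp: pr_lam)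

lemma copy_edge:
  assumes "\<alpha> \<in> cop" "s \<subseteq> A"
  shows "\<alpha> ` s \<in> E i \<longleftrightarrow> s \<in> EA i"
  using assms by (auto simp: copies_def emb_edge)

lemma coord_Some_image:
  "coord (Some \<alpha>) ` e = \<alpha> ` inv_into A \<theta> ` \<pi> ` e"
  by (auto simp: coord_def)

lemma nth_line:
  assumes "\<tau> \<in> lines cop N" "j < N"
  shows "\<tau> ! j = None \<or> (\<exists>\<alpha>\<in>cop. \<tau> ! j = Some \<alpha>)"
proof -
  have "\<tau> ! j \<in> set \<tau>" using assms by (auto simp: lines_def)
  then show ?thesis using assms(1) by (auto simp: lines_def)
qed

text \<open>A point outside \<open>D\<close> determines its line, so only sets of words can be
  shared by two lines. For those, reading off a variable position of \<tau> expresses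
  \<open>e\<close> through \<open>e'\<close>, and a variable position of \<sigma> expresses
  \<open>e'\<close> through \<open>e\<close>. Either the two coincide, or both are images of the
  same subset of \<open>A\<close> under copies, which are edges simultaneously.\<close>

lemma lam_reflects:
  assumes \<tau>: "\<tau> \<in> lines cop N" and \<sigma>: "\<sigma> \<in> lines cop N"
    and e: "e \<subseteq> V" "e' \<in> E i" and eq: "lam \<tau> ` e = lam \<sigma> ` e'"
  shows "e \<in> E i"
proof (cases "e \<subseteq> D \<and> e' \<subseteq> D")
  case True
  obtain j where j: "j < N" "\<tau> ! j = None" using None_index[OF \<tau>] .
  obtain k where k: "k < N" "\<sigma> ! k = None" using None_index[OF \<sigma>] .
  have pj: "e = coord (\<sigma> ! j) ` e'"
    using pr_lam_image[OF \<tau> j(1), of e] pr_lam_image[OF \<sigma> j(1), of e'] True eq j by simp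
  have pk: "e' = coord (\<tau> ! k) ` e"
    using pr_lam_image[OF \<tau> k(1), of e] pr_lam_image[OF \<sigma> k(1), of e'] True eq k by simp
  show ?thesis
  proof (cases "\<sigma> ! j = None \<or> \<tau> ! k = None")
    case True
    then show ?thesis using pj pk e by auto
  next
    case False
    then obtain \<alpha> \<beta> where \<alpha>: "\<alpha> \<in> cop" "\<tau> ! k = Some \<alpha>" and \<beta>: "\<beta> \<in> cop" "\<sigma> ! j = Some \<beta>"
      using nth_line[OF \<tau> k(1)] nth_line[OF \<sigma> j(1)] by auto
    have "G\<pi> ` lam \<tau> ` e = \<pi> ` e" "G\<pi> ` lam \<sigma> ` e' = \<pi> ` e'"
      using G\<pi>_lam[OF \<tau>] G\<pi>_lam[OF \<sigma>] by (auto simp: image_image)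
    then have same: "\<pi> ` e = \<pi> ` e'" using eq by simp
    define s where "s = inv_into A \<theta> ` \<pi> ` e"
    have s: "s \<subseteq> A" using True by (auto simp: s_def D_def inv_into_into)
    have "e' = \<alpha> ` s"
      using pk unfolding \<alpha>(2) coord_Some_image s_def .
    moreover have "e = \<beta> ` s"
      using pj unfolding \<beta>(2) coord_Some_image same[symmetric] s_def .
    ultimately show ?thesis using copy_edge[OF \<alpha>(1) s] copy_edge[OF \<beta>(1) s] e(2) by simp
  qed
next
  case False
  have eV: "e' \<subseteq> V" using e sysD[OF sysV] by blast
  have "\<tau> = \<sigma>"
  proof (cases "e \<subseteq> D")
    case True
    then obtain v where "v \<in> e'" "v \<notin> D" using False by blast
    then have "Inl (\<sigma>, v) \<in> lam \<tau> ` e"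
      unfolding eq by (intro image_eqI[of _ _ v]) (auto simp: lam_def)
    then show ?thesis by (auto simp: lam_def split: if_splits)
  next
    case False
    then obtain v where "v \<in> e" "v \<notin> D" by blast
    then have "Inl (\<tau>, v) \<in> lam \<sigma> ` e'"
      unfolding eq[symmetric] by (intro image_eqI[of _ _ v]) (auto simp: lam_def)
    then show ?thesis by (auto simp: lam_def split: if_splits)
  qed
  then show ?thesis
    using inj_on_image_eq_iff[OF lam_inj[OF \<tau>] e(1) eV] eq e by simp
qed

text \<open>The second condition says that the additional edges create no new edge inside the copy
  spanned by a line.\<close>

definition X_ok :: bool where
  "X_ok \<longleftrightarrow> (\<forall>i. \<forall>x\<in>X i. x \<subseteq> words \<and> ok i (card x)) \<and>
     (\<forall>\<tau>\<in>lines cop N. \<forall>i e. e \<subseteq> D \<longrightarrow> (\<lambda>v. map (\<lambda>m. coord m v) \<tau>) ` e \<in> X i \<longrightarrow> e \<in> E i)"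

lemma lam_image_Inr:
  assumes "lam \<tau> ` e = Inr ` x"
  shows "e \<subseteq> D" "x = (\<lambda>v. map (\<lambda>m. coord m v) \<tau>) ` e"
proof -
  show D: "e \<subseteq> D"
  proof
    fix v assume "v \<in> e"
    then have "lam \<tau> v \<in> Inr ` x" using assms by blast
    then show "v \<in> D" by (auto simp: lam_def split: if_splits)
  qed
  have "x = projr ` lam \<tau> ` e" unfolding assms by (simp add: image_image)
  also have "\<dots> = (\<lambda>v. map (\<lambda>m. coord m v) \<tau>) ` e"
    unfolding image_image using D by (intro image_cong) (auto simp: lam_def)
  finally show "x = (\<lambda>v. map (\<lambda>m. coord m v) \<tau>) ` e" .
qed

lemma emb_lam:
  assumes "X_ok" "\<tau> \<in> lines cop N"
  shows "emb V E GV GE (lam \<tau>)"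
  unfolding emb_def
proof (intro conjI allI impI)
  show "lam \<tau> \<in> V \<rightarrow> GV" using lam_in[OF assms(2)] by auto
  show "inj_on (lam \<tau>) V" using lam_inj[OF assms(2)] .
  fix i e assume e: "e \<subseteq> V"
  show "lam \<tau> ` e \<in> GE i \<longleftrightarrow> e \<in> E i"
  proof
    assume "e \<in> E i" then show "lam \<tau> ` e \<in> GE i" using assms(2) by (auto simp: GE_def)
  next
    assume "lam \<tau> ` e \<in> GE i"
    then consider \<sigma> e' where "\<sigma> \<in> lines cop N" "e' \<in> E i" "lam \<tau> ` e = lam \<sigma> ` e'"
      | x where "x \<in> X i" "lam \<tau> ` e = Inr ` x"
      unfolding GE_def by blast
    then show "e \<in> E i"
    proof cases
      case 1
      then show ?thesis using lam_reflects[OF assms(2)] e by blast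
    next
      case 2
      then show ?thesis using lam_image_Inr[OF 2(2)] assms unfolding X_ok_def by blast
    qed
  qed
qed

lemma finite_words: "finite words"
proof -
  have "finite D" using sysV DV by (auto simp: sys_def intro: finite_subset)
  then show ?thesis
    using finite_subset[OF _ finite_lists_length_eq[of D N], of words] by (auto simp: words_def)
qed

lemma sys_glue:
  assumes "X_ok"
  shows "sys GV GE"
proof -
  have finV: "finite V" using sysV by (simp add: sys_def)
  then have "finite GV"
    using finite_words
    by (auto simp: GV_def intro!: finite_imageI finite_cartesian_product finite_lines
        finite_copies finA)
  moreover have "e \<subseteq> GV \<and> ok i (card e)" if e: "e \<in> GE i" for i e
  proof -
    consider \<tau> d where "\<tau> \<in> lines cop N" "d \<in> E i" "e = lam \<tau> ` d"
      | x where "x \<in> X i" "e = Inr ` x"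
      using e unfolding GE_def by blast
    then show ?thesis
    proof cases
      case 1
      then have "d \<subseteq> V" "ok i (card d)" using sysV by (auto simp: sys_def)
      moreover from this have "card e = card d"
        using 1 lam_inj card_image inj_on_subset by metis
      ultimately show ?thesis using 1 lam_in by auto
    next
      case 2
      then have "x \<subseteq> words" "ok i (card x)" using assms by (auto simp: X_ok_def)
      then show ?thesis using 2 by (auto simp: GV_def card_image)
    qed
  qed
  ultimately show ?thesis by (simp add: sys_def)
qed

text \<open>This is the link to Hales--Jewett: the copies of \<open>A\<close> inside
  \<open>lam \<tau>\<close> are exactly the points of the combinatorial line \<tau> in the cube over
  \<open>cop\<close>, a word of copies being read coordinatewise as one copy.\<close>

lemma lam_copy:
  assumes "\<tau> \<in> lines cop N" "\<alpha> \<in> cop"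
  shows "compose A (lam \<tau>) \<alpha> = restrict (\<lambda>x. Inr (map (\<lambda>\<beta>. \<beta> x) (inst \<tau> \<alpha>))) A"
proof
  fix x
  show "compose A (lam \<tau>) \<alpha> x = restrict (\<lambda>x. Inr (map (\<lambda>\<beta>. \<beta> x) (inst \<tau> \<alpha>))) A x"
  proof (cases "x \<in> A")
    case True
    have p: "\<pi> (\<alpha> x) = \<theta> x" "\<alpha> x \<in> V" using assms True by (auto simp: copies_def emb_def)
    then have "\<alpha> x \<in> D" using True by (auto simp: D_def)
    moreover have "coord m (\<alpha> x) = (case m of None \<Rightarrow> \<alpha> x | Some \<beta> \<Rightarrow> \<beta> x)" for m
      using p True inj_theta by (auto simp: coord_def split: option.split)
    ultimately show ?thesis
      using True by (auto simp: compose_def lam_def inst_def split: option.split)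
  qed (simp add: compose_def)
qed

lemma glue_mono_line:
  fixes \<chi> :: "('c \<Rightarrow> ('c \<Rightarrow> 'a) option list \<times> 'a + 'a list) \<Rightarrow> nat"
  assumes HJ: "\<And>\<chi>::('c \<Rightarrow> 'a) list \<Rightarrow> nat. (\<forall>w. \<chi> w < k) \<Longrightarrow> mono_line cop N \<chi>"
    and \<chi>: "\<And>f. \<chi> f < k"
  shows "\<exists>\<tau>\<in>lines cop N. \<forall>\<alpha>\<in>cop. \<forall>\<beta>\<in>cop.
    \<chi> (compose A (lam \<tau>) \<alpha>) = \<chi> (compose A (lam \<tau>) \<beta>)"
proof -
  define \<chi>' where "\<chi>' w = \<chi> (restrict (\<lambda>x. Inr (map (\<lambda>\<beta>. \<beta> x) w)) A)" for w
  have "mono_line cop N \<chi>'"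
    by (rule HJ) (simp add: \<chi>'_def \<chi>)
  then obtain \<tau> where \<tau>: "\<tau> \<in> lines cop N"
    "\<And>\<alpha> \<beta>. \<alpha> \<in> cop \<Longrightarrow> \<beta> \<in> cop \<Longrightarrow> \<chi>' (inst \<tau> \<alpha>) = \<chi>' (inst \<tau> \<beta>)"
    unfolding mono_line_def by blast
  have "\<chi> (compose A (lam \<tau>) \<alpha>) = \<chi>' (inst \<tau> \<alpha>)" if "\<alpha> \<in> cop" for \<alpha>
    by (simp add: lam_copy[OF \<tau>(1) that] \<chi>'_def)
  then show ?thesis
    by (intro bexI[OF _ \<tau>(1)] ballI) (metis \<tau>(2))
qed

end

text \<open>Homogeneity is required for each position in \<Theta> separately. The embedding commutes
  with the projections, which is what lets steps for different positions be composed.\<close>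

definition parrow :: "nat \<Rightarrow> 'c set \<Rightarrow> ('i \<Rightarrow> 'c set set) \<Rightarrow> ('c \<Rightarrow> 'p) set \<Rightarrow>
    'a set \<Rightarrow> ('i \<Rightarrow> 'a set set) \<Rightarrow> ('a \<Rightarrow> 'p) \<Rightarrow>
    'b set \<Rightarrow> ('i \<Rightarrow> 'b set set) \<Rightarrow> ('b \<Rightarrow> 'p) \<Rightarrow> bool" where
  "parrow k A EA \<Theta> V E \<pi> V' E' \<pi>' \<longleftrightarrow> (\<forall>\<chi>::('c \<Rightarrow> 'b) \<Rightarrow> nat. (\<forall>f. \<chi> f < k) \<longrightarrow>
    (\<exists>l. emb V E V' E' l \<and> (\<forall>v\<in>V. \<pi>' (l v) = \<pi> v) \<and>
      (\<forall>\<theta>\<in>\<Theta>. \<forall>\<alpha>\<in>copies A EA V E \<pi> \<theta>. \<forall>\<beta>\<in>copies A EA V E \<pi> \<theta>.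
        \<chi> (compose A l \<alpha>) = \<chi> (compose A l \<beta>))))"

lemma parrowD:
  fixes \<chi> :: "('c \<Rightarrow> 'b) \<Rightarrow> nat"
  assumes "parrow k A EA \<Theta> V E \<pi> V' E' \<pi>'" "\<And>f. \<chi> f < k"
  obtains l where "emb V E V' E' l" "\<And>v. v \<in> V \<Longrightarrow> \<pi>' (l v) = \<pi> v"
    "\<And>\<theta> \<alpha> \<beta>. \<theta> \<in> \<Theta> \<Longrightarrow> \<alpha> \<in> copies A EA V E \<pi> \<theta> \<Longrightarrow> \<beta> \<in> copies A EA V E \<pi> \<theta> \<Longrightarrow>
      \<chi> (compose A l \<alpha>) = \<chi> (compose A l \<beta>)"
  using assms(1)[unfolded parrow_def, rule_format, of \<chi>] assms(2) by blast

text \<open>The invariant that keeps the partite construction inside the class. With \<open>\<G>\<close> the set of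
  images of \<open>A\<close> and \<open>B\<close> in the base, it says that irreducible sets embed into \<open>A\<close> or \<open>B\<close>.\<close>

definition hom_irr :: "('i \<Rightarrow> 'p set set) \<Rightarrow> 'p set set \<Rightarrow> 'a set \<Rightarrow> ('i \<Rightarrow> 'a set set) \<Rightarrow>
    ('a \<Rightarrow> 'p) \<Rightarrow> bool" where
  "hom_irr E0 \<G> V E \<pi> \<longleftrightarrow> (\<forall>i. \<forall>e\<in>E i. \<pi> ` e \<in> E0 i \<and> inj_on \<pi> e) \<and>
    (\<forall>W\<subseteq>V. irr E W \<longrightarrow> (\<forall>i e. e \<subseteq> W \<longrightarrow> \<pi> ` e \<in> E0 i \<longrightarrow> e \<in> E i) \<and> (\<exists>G\<in>\<G>. \<pi> ` W \<subseteq> G))"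

lemma hom_irr_edge: "hom_irr E0 \<G> V E \<pi> \<Longrightarrow> e \<in> E i \<Longrightarrow> \<pi> ` e \<in> E0 i \<and> inj_on \<pi> e"
  by (simp add: hom_irr_def)

text \<open>Two points of an irreducible set share an edge, and the projection is injective on
  edges.\<close>

lemma hom_irr_inj:
  assumes "hom_irr E0 \<G> V E \<pi>" "irr E W"
  shows "inj_on \<pi> W"
proof (rule inj_onI, rule ccontr)
  fix a b assume ab: "a \<in> W" "b \<in> W" "\<pi> a = \<pi> b" "a \<noteq> b"
  then obtain i e where "e \<in> E i" "a \<in> e" "b \<in> e" using assms(2) unfolding irr_def by blast
  then show False using hom_irr_edge[OF assms(1)] ab by (meson inj_onD)
qed

lemma hom_irr_emb:
  assumes "hom_irr E0 \<G> V' E' \<pi>'" "emb V E V' E' l" "\<And>v. v \<in> V \<Longrightarrow> \<pi>' (l v) = \<pi> v"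
    and "\<And>i. E i \<subseteq> Pow V"
  shows "hom_irr E0 \<G> V E \<pi>"
proof -
  have im: "\<pi>' ` l ` e = \<pi> ` e" if "e \<subseteq> V" for e
    unfolding image_image using that assms(3) by (intro image_cong) auto
  have "\<pi> ` e \<in> E0 i \<and> inj_on \<pi> e" if e: "e \<in> E i" for i e
  proof -
    have eV: "e \<subseteq> V" using e assms(4) by blast
    then have *: "\<pi>' ` l ` e \<in> E0 i" "inj_on \<pi>' (l ` e)"
      using hom_irr_edge[OF assms(1), of "l ` e" i] emb_edge[OF assms(2) eV] e by auto
    have "inj_on (\<pi>' \<circ> l) e"
      using *(2) inj_on_subset[OF emb_inj[OF assms(2)] eV] by (intro comp_inj_on)
    moreover have "inj_on (\<pi>' \<circ> l) e = inj_on \<pi> e"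
      using assms(3) eV by (intro inj_on_cong) auto
    ultimately show ?thesis using * im[OF eV] by simp
  qed
  moreover have "(\<forall>i e. e \<subseteq> W \<longrightarrow> \<pi> ` e \<in> E0 i \<longrightarrow> e \<in> E i) \<and> (\<exists>G\<in>\<G>. \<pi> ` W \<subseteq> G)"
    if W: "W \<subseteq> V" "irr E W" for W
  proof -
    have lW: "l ` W \<subseteq> V'" "irr E' (l ` W)"
      using W irr_image[OF assms(2)] emb_in[OF assms(2)] by auto
    then have r: "\<And>i e. e \<subseteq> l ` W \<Longrightarrow> \<pi>' ` e \<in> E0 i \<Longrightarrow> e \<in> E' i"
      and G: "\<exists>G\<in>\<G>. \<pi>' ` l ` W \<subseteq> G"
      using assms(1)[unfolded hom_irr_def, THEN conjunct2, rule_format, OF lW] by auto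
    have "e \<in> E i" if "e \<subseteq> W" "\<pi> ` e \<in> E0 i" for i e
      using r[of "l ` e" i] that W(1) im[of e] emb_edge[OF assms(2), of e i] by auto
    then show ?thesis using G im[OF W(1)] by auto
  qed
  ultimately show ?thesis unfolding hom_irr_def by blast
qed

section \<open>Preservation of the projection invariant\<close>

context glue
begin

text \<open>With these edges the coordinate projections send irreducible sets to irreducible sets.\<close>

definition prodX :: "'i \<Rightarrow> 'a list set set" where
  "prodX i = {x. x \<subseteq> words \<and> (\<forall>j<N. (\<lambda>us. us ! j) ` x \<in> E i) \<and> inj_on (\<lambda>us. \<pi> (hd us)) x}"

lemma X_ok_empty:
  assumes "X = (\<lambda>_. {})" shows X_ok
  unfolding X_ok_def by (simp add: assms)

text \<open>Sizes are read off at coordinate 0, where the projection is injective because \<pi>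
  composed with \<open>hd\<close> is; this is where words must be nonempty. Reflection is read off
  at a variable position of \<tau>, where the image of \<open>e\<close> is \<open>e\<close>
  itself.\<close>

lemma X_ok_prod:
  assumes X: "X = prodX" and "0 < N"
  shows X_ok
  unfolding X_ok_def
proof (intro conjI allI ballI impI)
  fix i x assume x: "x \<in> X i"
  then show "x \<subseteq> words" by (simp add: X prodX_def)
  then have hd: "hd us = us ! 0" if "us \<in> x" for us
    using that assms(2) by (intro hd_conv_nth) (auto simp: words_def)
  have "inj_on (\<lambda>us. \<pi> (hd us)) x" using x by (simp add: X prodX_def)
  then have "inj_on (\<lambda>us. us ! 0) x"
    by (auto simp: inj_on_def hd)
  moreover have "(\<lambda>us. us ! 0) ` x \<in> E i"
    using x assms(2) by (simp add: X prodX_def)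
  then have "ok i (card ((\<lambda>us. us ! 0) ` x))"
    using sysV unfolding sys_def by blast
  ultimately show "ok i (card x)"
    using card_image[of "\<lambda>us. us ! 0" x] by metis
next
  fix \<tau> i e assume \<tau>: "\<tau> \<in> lines cop N" and e: "e \<subseteq> D"
    and x: "(\<lambda>v. map (\<lambda>m. coord m v) \<tau>) ` e \<in> X i"
  obtain j where j: "j < N" "\<tau> ! j = None" using None_index[OF \<tau>] .
  have "(\<lambda>us. us ! j) ` (\<lambda>v. map (\<lambda>m. coord m v) \<tau>) ` e = e"
    using \<tau> j by (simp add: image_image lines_def)
  moreover have "(\<lambda>us. us ! j) ` (\<lambda>v. map (\<lambda>m. coord m v) \<tau>) ` e \<in> E i"
    using x j unfolding X prodX_def by blast
  ultimately show "e \<in> E i" by simp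
qed

text \<open>At a constant position \<alpha>, the edge projects to an edge of the base inside
  \<theta>\<open>A\<close>; \<theta> pulls it back to an edge of \<open>A\<close>, and \<alpha>
  pushes that forward to an edge. Thus every edge among words, from whichever line, is a product
  edge.\<close>

lemma lam_edge_prod:
  assumes hom: "hom_irr E0 \<G> V E \<pi>" and \<theta>: "\<And>s i. s \<subseteq> A \<Longrightarrow> \<theta> ` s \<in> E0 i \<longleftrightarrow> s \<in> EA i"
    and \<tau>: "\<tau> \<in> lines cop N" and e: "e \<in> E i" "e \<subseteq> D"
  shows "(\<lambda>v. map (\<lambda>m. coord m v) \<tau>) ` e \<in> prodX i"
proof -
  let ?l = "\<lambda>v. map (\<lambda>m. coord m v) \<tau>"
  have "(\<lambda>us. us ! j) ` ?l ` e \<in> E i" if j: "j < N" for j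
  proof -
    have "(\<lambda>us. us ! j) ` ?l ` e = coord (\<tau> ! j) ` e"
      using \<tau> j by (simp add: image_image lines_def)
    moreover have "coord (\<tau> ! j) ` e \<in> E i"
    proof (cases "\<tau> ! j")
      case None
      then show ?thesis using e by simp
    next
      case (Some \<alpha>)
      then have \<alpha>: "\<alpha> \<in> cop" using nth_line[OF \<tau> j] by simp
      define s where "s = inv_into A \<theta> ` \<pi> ` e"
      have s: "s \<subseteq> A" using e by (auto simp: s_def D_def inv_into_into)
      have "\<theta> ` s = \<pi> ` e"
        unfolding s_def using e by (intro image_inv_into_cancel[of \<theta> A "\<theta> ` A"]) (auto simp: D_def)
      then have "s \<in> EA i" using \<theta>[OF s] hom_irr_edge[OF hom e(1)] by metis
      then have "\<alpha> ` s \<in> E i" using copy_edge[OF \<alpha> s] by blast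
      then show ?thesis unfolding Some coord_Some_image s_def .
    qed
    ultimately show ?thesis by simp
  qed
  moreover have "inj_on (\<lambda>us. \<pi> (hd us)) (?l ` e)"
  proof (rule inj_onI)
    fix u v assume uv: "u \<in> ?l ` e" "v \<in> ?l ` e" "\<pi> (hd u) = \<pi> (hd v)"
    then obtain a b where ab: "u = ?l a" "v = ?l b" "a \<in> e" "b \<in> e" by blast
    then have "\<pi> a = \<pi> b"
      using hd_word[OF \<tau> subsetD[OF e(2)]] uv(3) by metis
    then have "a = b" using hom_irr_edge[OF hom e(1)] ab by (meson inj_onD)
    then show "u = v" using ab by simp
  qed
  moreover have "?l ` e \<subseteq> words" using word_in[OF \<tau>] e by auto
  ultimately show ?thesis by (simp add: prodX_def)
qed

text \<open>Each other point of \<open>W\<close> shares an edge with the new point, and an edge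
  through a point \<open>Inl (\<tau>, v)\<close> can only come from the copy belonging to
  \<tau>.\<close>

lemma irr_through_new:
  assumes W: "W \<subseteq> GV" "irr GE W" and new: "Inl (\<tau>, v) \<in> W"
  shows "\<tau> \<in> lines cop N \<and> W \<subseteq> lam \<tau> ` V"
proof
  have v: "v \<in> V" "v \<notin> D" "\<tau> \<in> lines cop N" using W new by (auto simp: GV_def)
  show "\<tau> \<in> lines cop N" by fact
  show "W \<subseteq> lam \<tau> ` V"
  proof
    fix w assume w: "w \<in> W"
    show "w \<in> lam \<tau> ` V"
    proof (cases "w = Inl (\<tau>, v)")
      case True
      then show ?thesis using v by (intro image_eqI[of _ _ v]) (auto simp: lam_def)
    next
      case False
      then obtain i e where e: "e \<in> GE i" "w \<in> e" "Inl (\<tau>, v) \<in> e"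
        using W(2) new w unfolding irr_def by blast
      then have "e \<notin> image Inr ` X i" by auto
      then obtain \<sigma> d where d: "d \<in> E i" "e = lam \<sigma> ` d"
        using e(1) unfolding GE_def by blast
      then have "\<sigma> = \<tau>" using e(3) by (auto simp: lam_def split: if_splits)
      then show ?thesis using d e(2) sysD[OF sysV d(1)] by auto
    qed
  qed
qed

text \<open>An irreducible set with a new point lies in one copy of the old system, where the
  invariant is known. A set of words is handled coordinatewise: its coordinate projections are
  irreducible in \<open>V\<close>, hence reflect edges, and a set all of whose projections are edges
  is a product edge.\<close>

lemma hom_irr_glue:
  assumes X: "X = prodX" and N: "0 < N"
    and hom: "hom_irr E0 \<G> V E \<pi>" and \<theta>: "\<And>s i. s \<subseteq> A \<Longrightarrow> \<theta> ` s \<in> E0 i \<longleftrightarrow> s \<in> EA i"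
    and \<G>: "\<theta> ` A \<in> \<G>"
  shows "hom_irr E0 \<G> GV GE G\<pi>"
  unfolding hom_irr_def
proof (intro conjI allI ballI impI)
  have hd: "hd us = us ! 0" if "us \<in> words" for us
    using that N by (intro hd_conv_nth) (auto simp: words_def)
  have nth: "\<pi> (us ! j) = \<pi> (hd us)" if "us \<in> words" "j < N" for us j
  proof -
    have "us ! j \<in> set us" "us ! 0 \<in> set us" using that N by (auto simp: words_def)
    then have "\<pi> (us ! j) = \<pi> (us ! 0)" using that(1) unfolding words_def by auto
    then show ?thesis using hd[OF that(1)] by simp
  qed
  have edge: "G\<pi> ` e \<in> E0 i \<and> inj_on G\<pi> e" if e: "e \<in> GE i" for e i
  proof -
    consider \<tau> d where "\<tau> \<in> lines cop N" "d \<in> E i" "e = lam \<tau> ` d" | x where "x \<in> X i" "e = Inr ` x"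
      using e unfolding GE_def by blast
    then show ?thesis
    proof cases
      case 1
      have "inj_on (G\<pi> \<circ> lam \<tau>) d = inj_on \<pi> d"
        using G\<pi>_lam[OF 1(1)] by (intro inj_on_cong) auto
      then have "inj_on G\<pi> e"
        using hom_irr_edge[OF hom 1(2)] 1(3) by (simp add: inj_on_imageI)
      moreover have "G\<pi> ` e = \<pi> ` d" using 1 G\<pi>_lam by (simp add: image_image)
      ultimately show ?thesis using hom_irr_edge[OF hom 1(2)] by simp
    next
      case 2
      then have x: "x \<subseteq> words" "(\<lambda>us. us ! 0) ` x \<in> E i" "inj_on (\<lambda>us. \<pi> (hd us)) x"
        using N by (auto simp: X prodX_def)
      have "G\<pi> ` e = \<pi> ` (\<lambda>us. us ! 0) ` x"
        unfolding 2 image_image using x(1) hd by (intro image_cong) (auto simp: G\<pi>_def)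
      moreover have "inj_on G\<pi> e"
        using x(3) unfolding 2 by (auto simp: inj_on_def G\<pi>_def)
      ultimately show ?thesis using hom_irr_edge[OF hom x(2)] by simp
    qed
  qed
  show "G\<pi> ` e \<in> E0 i" "inj_on G\<pi> e" if "e \<in> GE i" for e i using edge[OF that] by auto
  fix W assume W: "W \<subseteq> GV" "irr GE W"
  have "(\<forall>i e. e \<subseteq> W \<longrightarrow> G\<pi> ` e \<in> E0 i \<longrightarrow> e \<in> GE i) \<and> (\<exists>G\<in>\<G>. G\<pi> ` W \<subseteq> G)"
  proof (cases "\<exists>\<tau> v. Inl (\<tau>, v) \<in> W")
    case True
    then obtain \<tau> where \<tau>: "\<tau> \<in> lines cop N" "W \<subseteq> lam \<tau> ` V"
      using irr_through_new[OF W] by blast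
    then obtain U where U: "U \<subseteq> V" "W = lam \<tau> ` U" by (auto simp: subset_image_iff)
    have em: "emb V E GV GE (lam \<tau>)" using emb_lam[OF X_ok_prod[OF X N] \<tau>(1)] .
    have "irr E U" using irr_image[OF em U(1)] U W by simp
    then have r: "\<And>i e. e \<subseteq> U \<Longrightarrow> \<pi> ` e \<in> E0 i \<Longrightarrow> e \<in> E i" and G: "\<exists>G\<in>\<G>. \<pi> ` U \<subseteq> G"
      using hom U unfolding hom_irr_def by blast+
    have im: "G\<pi> ` lam \<tau> ` d = \<pi> ` d" for d using G\<pi>_lam[OF \<tau>(1)] by (simp add: image_image)
    have "e \<in> GE i" if e: "e \<subseteq> W" "G\<pi> ` e \<in> E0 i" for i e
    proof -
      obtain d where d: "d \<subseteq> U" "e = lam \<tau> ` d" using e U by (auto simp: subset_image_iff)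
      then have "d \<in> E i" using r[of d i] e im by simp
      then show ?thesis using emb_edge[OF em, of d i] d U by auto
    qed
    then show ?thesis using G U im by auto
  next
    case False
    then have "W \<subseteq> Inr ` words" using W(1) by (auto simp: GV_def)
    then obtain U where U: "U \<subseteq> words" "W = Inr ` U" by (auto simp: subset_image_iff)
    have edgeU: "\<exists>x\<in>prodX i. e = Inr ` x" if e: "e \<in> GE i" "e \<subseteq> W" for e i
    proof -
      consider \<tau> d where "\<tau> \<in> lines cop N" "d \<in> E i" "e = lam \<tau> ` d" | x where "x \<in> X i" "e = Inr ` x"
        using e unfolding GE_def by blast
      then show ?thesis
      proof cases
        case 1
        obtain x where x: "e = Inr ` x" using e U by (auto simp: subset_image_iff)
        note * = lam_image_Inr[of \<tau> d x]
        have "lam \<tau> ` d = Inr ` x" using 1 x by simp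
        then show ?thesis
          using * lam_edge_prod[OF hom \<theta> 1(1,2)] x by blast
      next
        case 2
        then show ?thesis by (auto simp: X)
      qed
    qed
    have irrU: "irr E ((\<lambda>us. us ! j) ` U)" if j: "j < N" for j
      unfolding irr_def
    proof (intro ballI impI)
      fix a b assume ab: "a \<in> (\<lambda>us. us ! j) ` U" "b \<in> (\<lambda>us. us ! j) ` U" "a \<noteq> b"
      then obtain u v where uv: "u \<in> U" "v \<in> U" "a = u ! j" "b = v ! j" by blast
      then have "Inr u \<in> W" "Inr v \<in> W" "u \<noteq> v" using U ab by auto
      then obtain i e where e: "e \<in> GE i" "e \<subseteq> W" "Inr u \<in> e" "Inr v \<in> e"
        using W(2) unfolding irr_def by blast
      from edgeU[OF e(1,2)] obtain x where x: "x \<in> prodX i" "e = Inr ` x" by blast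
      have "x \<subseteq> U" "u \<in> x" "v \<in> x" using e x U by auto
      moreover have "(\<lambda>us. us ! j) ` x \<in> E i" using x j by (auto simp: prodX_def)
      ultimately show "\<exists>i. \<exists>e\<in>E i. e \<subseteq> (\<lambda>us. us ! j) ` U \<and> a \<in> e \<and> b \<in> e"
        unfolding uv(3,4) by (intro exI[of _ i] bexI[of _ "(\<lambda>us. us ! j) ` x"]) auto
    qed
    have UV: "(\<lambda>us. us ! j) ` U \<subseteq> V" if j: "j < N" for j
      using U DV j unfolding words_def by fastforce
    have "e \<in> GE i" if e: "e \<subseteq> W" "G\<pi> ` e \<in> E0 i" for i e
    proof -
      obtain x where x: "x \<subseteq> U" "e = Inr ` x" using e U by (auto simp: subset_image_iff)
      have "(\<lambda>us. us ! j) ` x \<in> E i" if j: "j < N" for j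
      proof -
        have "\<pi> ` (\<lambda>us. us ! j) ` x = G\<pi> ` e"
          unfolding x image_image using x(1) U nth j by (intro image_cong) (auto simp: G\<pi>_def)
        then show ?thesis
          using hom irrU[OF j] UV[OF j] x(1) e(2) unfolding hom_irr_def
          by (metis image_mono)
      qed
      \<comment> \<open>The remaining condition on a product edge holds because two words of
        \<open>W\<close> share an edge, on which \<open>G\<pi>\<close> is injective.\<close>
      moreover have "inj_on (\<lambda>us. \<pi> (hd us)) x"
      proof (rule inj_onI, rule ccontr)
        fix u v assume uv: "u \<in> x" "v \<in> x" "\<pi> (hd u) = \<pi> (hd v)" "u \<noteq> v"
        then have "Inr u \<in> W" "Inr v \<in> W" "u \<noteq> v" using x U by auto
        then obtain i e where e: "e \<in> GE i" "Inr u \<in> e" "Inr v \<in> e"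
          using W(2) unfolding irr_def by blast
        then have "inj_on G\<pi> e" using edge by blast
        then have "Inr u = (Inr v :: ('c \<Rightarrow> 'a) option list \<times> 'a + 'a list)"
          using inj_onD[of G\<pi> e "Inr u" "Inr v"] e uv(3) by (simp add: G\<pi>_def)
        then show False using uv by simp
      qed
      ultimately have "x \<in> X i" using x U by (auto simp: X prodX_def)
      then show ?thesis by (auto simp: GE_def x)
    qed
    moreover have "G\<pi> ` W \<subseteq> \<theta> ` A"
    proof
      fix y assume "y \<in> G\<pi> ` W"
      then obtain us where us: "us \<in> words" "y = \<pi> (hd us)" using U by (auto simp: G\<pi>_def)
      then have "us ! 0 \<in> D" using N by (auto simp: words_def)
      then show "y \<in> \<theta> ` A" using us hd by (auto simp: D_def)
    qed
    ultimately show ?thesis using \<G> by blast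
  qed
  then show "\<And>i e. e \<subseteq> W \<Longrightarrow> G\<pi> ` e \<in> E0 i \<Longrightarrow> e \<in> GE i" "\<exists>G\<in>\<G>. G\<pi> ` W \<subseteq> G" by blast+
qed

lemma parrow_glue:
  assumes X_ok
    and HJ: "\<And>\<chi>::('c \<Rightarrow> 'a) list \<Rightarrow> nat. (\<forall>w. \<chi> w < k) \<Longrightarrow> mono_line cop N \<chi>"
  shows "parrow k A EA {\<theta>} V E \<pi> GV GE G\<pi>"
  unfolding parrow_def
proof (intro allI impI)
  fix \<chi> :: "('c \<Rightarrow> ('c \<Rightarrow> 'a) option list \<times> 'a + 'a list) \<Rightarrow> nat" assume \<chi>: "\<forall>f. \<chi> f < k"
  obtain \<tau> where \<tau>: "\<tau> \<in> lines cop N"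
    "\<forall>\<alpha>\<in>cop. \<forall>\<beta>\<in>cop. \<chi> (compose A (lam \<tau>) \<alpha>) = \<chi> (compose A (lam \<tau>) \<beta>)"
    using glue_mono_line[of k \<chi>] HJ \<chi> by blast
  then show "\<exists>l. emb V E GV GE l \<and> (\<forall>v\<in>V. G\<pi> (l v) = \<pi> v) \<and>
      (\<forall>\<theta>\<in>{\<theta>}. \<forall>\<alpha>\<in>copies A EA V E \<pi> \<theta>. \<forall>\<beta>\<in>copies A EA V E \<pi> \<theta>.
        \<chi> (compose A l \<alpha>) = \<chi> (compose A l \<beta>))"
    using emb_lam[OF assms(1) \<tau>(1)] G\<pi>_lam[OF \<tau>(1)] by blast
qed

end

section \<open>Renaming vertices and iterating the step\<close>

context struct_class
begin

text \<open>Gluing changes the type of the vertices. Returning to natural numbers after each step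
  keeps the type fixed, so that the steps can be iterated.\<close>

lemma relabel_nat:
  fixes V' :: "'b set" and A :: "'c set"
  assumes sys: "sys V' E'" and arr: "parrow k A EA \<Theta> V E \<pi> V' E' \<pi>'"
  obtains V'' :: "nat set" and E'' \<pi>'' where "sys V'' E''" "parrow k A EA \<Theta> V E \<pi> V'' E'' \<pi>''"
    "\<And>E0 \<G>. hom_irr E0 \<G> V' E' \<pi>' \<Longrightarrow> hom_irr E0 \<G> V'' E'' \<pi>''"
proof -
  have fin: "finite V'" and EV: "\<And>i. E' i \<subseteq> Pow V'" using sys by (auto simp: sys_def)
  obtain \<rho> :: "'b \<Rightarrow> nat" where \<rho>: "inj_on \<rho> V'"
    using finite_imp_inj_to_nat_seg[OF fin] by blast
  define E'' where "E'' i = image \<rho> ` E' i" for i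
  define \<pi>'' where "\<pi>'' = \<pi>' \<circ> inv_into V' \<rho>"
  have emb1: "emb V' E' (\<rho> ` V') E'' \<rho>" and emb2: "emb (\<rho> ` V') E'' V' E' (inv_into V' \<rho>)"
    using emb_relabel[of \<rho> V' E', OF \<rho> EV] unfolding E''_def by blast+
  have sys'': "sys (\<rho> ` V') E''"
    using sys_relabel[OF sys \<rho>] unfolding E''_def .
  moreover have "parrow k A EA \<Theta> V E \<pi> (\<rho> ` V') E'' \<pi>''"
    unfolding parrow_def
  proof (intro allI impI)
    fix \<chi> :: "('c \<Rightarrow> nat) \<Rightarrow> nat" assume \<chi>: "\<forall>f. \<chi> f < k"
    obtain l where l: "emb V E V' E' l" "\<And>v. v \<in> V \<Longrightarrow> \<pi>' (l v) = \<pi> v"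
      "\<And>\<theta> \<alpha> \<beta>. \<theta> \<in> \<Theta> \<Longrightarrow> \<alpha> \<in> copies A EA V E \<pi> \<theta> \<Longrightarrow> \<beta> \<in> copies A EA V E \<pi> \<theta> \<Longrightarrow>
        \<chi> (compose A \<rho> (compose A l \<alpha>)) = \<chi> (compose A \<rho> (compose A l \<beta>))"
      by (rule parrowD[OF arr, of "\<lambda>f. \<chi> (compose A \<rho> f)"]) (rule \<chi>[rule_format], rule that)
    have c: "compose A \<rho> (compose A l \<alpha>) = compose A (\<rho> \<circ> l) \<alpha>" for \<alpha>
      by (auto simp: compose_def fun_eq_iff)
    have "\<pi>'' ((\<rho> \<circ> l) v) = \<pi> v" if "v \<in> V" for v
      using l(2)[OF that] emb_in[OF l(1) that] \<rho> by (simp add: \<pi>''_def)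
    then show "\<exists>l. emb V E (\<rho> ` V') E'' l \<and> (\<forall>v\<in>V. \<pi>'' (l v) = \<pi> v) \<and>
      (\<forall>\<theta>\<in>\<Theta>. \<forall>\<alpha>\<in>copies A EA V E \<pi> \<theta>. \<forall>\<beta>\<in>copies A EA V E \<pi> \<theta>.
        \<chi> (compose A l \<alpha>) = \<chi> (compose A l \<beta>))"
      using emb_comp[OF l(1) emb1] l(3) unfolding c by (intro exI[of _ "\<rho> \<circ> l"]) blast
  qed
  moreover have "hom_irr E0 \<G> (\<rho> ` V') E'' \<pi>''" if "hom_irr E0 \<G> V' E' \<pi>'" for E0 \<G>
    using hom_irr_emb[OF that emb2, of \<pi>''] sysD[OF sys''] by (auto simp: \<pi>''_def)
  ultimately show ?thesis using that by blast
qed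

lemma partite_step:
  fixes V :: "nat set" and A :: "'c set"
  assumes "sys V E" "finite A" "inj_on \<theta> A"
  obtains V' :: "nat set" and E' \<pi>' where "sys V' E'" "parrow k A EA {\<theta>} V E \<pi> V' E' \<pi>'"
proof -
  have "finite (copies A EA V E \<pi> \<theta>)"
    using assms by (intro finite_copies) (auto simp: sys_def)
  from hales_jewett[OF this, of k] obtain N where
    N: "\<forall>\<chi>. (\<forall>w. \<chi> w < k) \<longrightarrow> mono_line (copies A EA V E \<pi> \<theta>) N \<chi>" ..
  interpret glue ok V E \<pi> A EA \<theta> N "\<lambda>_. {}"
    by unfold_locales (use assms in auto)
  show ?thesis
    using relabel_nat[OF sys_glue parrow_glue[of k]] X_ok_empty N that by metis
qed

lemma partite_step_hom:
  fixes V :: "nat set" and A :: "'c set"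
  assumes "sys V E" "finite A" "inj_on \<theta> A" "0 < k"
    and hom: "hom_irr E0 \<G> V E \<pi>" "\<And>s i. s \<subseteq> A \<Longrightarrow> \<theta> ` s \<in> E0 i \<longleftrightarrow> s \<in> EA i" "\<theta> ` A \<in> \<G>"
  obtains V' :: "nat set" and E' \<pi>' where "sys V' E'" "parrow k A EA {\<theta>} V E \<pi> V' E' \<pi>'"
    "hom_irr E0 \<G> V' E' \<pi>'"
proof -
  have "finite (copies A EA V E \<pi> \<theta>)"
    using assms by (intro finite_copies) (auto simp: sys_def)
  from hales_jewett[OF this, of k] obtain N where
    N: "\<forall>\<chi>. (\<forall>w. \<chi> w < k) \<longrightarrow> mono_line (copies A EA V E \<pi> \<theta>) N \<chi>" ..
  \<comment> \<open>Some line exists already for the constant colouring, and a line contains a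
    variable; hence words are nonempty.\<close>
  have "mono_line (copies A EA V E \<pi> \<theta>) N (\<lambda>_. 0::nat)"
    using N assms(4) by simp
  then have N0: "0 < N" by (auto simp: mono_line_def lines_def)
  define X where "X = glue.prodX V E \<pi> A \<theta> N"
  interpret glue ok V E \<pi> A EA \<theta> N X
    by unfold_locales (use assms in auto)
  have X: "X = prodX" by (simp add: X_def)
  note ok = X_ok_prod[OF X N0]
  show ?thesis
    using relabel_nat[OF sys_glue[OF ok] parrow_glue[OF ok, of k]] N that
      hom_irr_glue[OF X N0 hom] by metis
qed

text \<open>The embedding for the last position is chosen first, then the earlier positions are
  treated for the colouring pulled back along it. \<open>\<Phi>\<close> is an invariant of the
  systems: trivial in the first construction, \<open>hom_irr\<close> in the second.\<close>

lemma partite_iterate: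
  fixes V :: "nat set" and A :: "'c set" and \<Phi> :: "nat set \<Rightarrow> ('i \<Rightarrow> nat set set) \<Rightarrow> (nat \<Rightarrow> 'p) \<Rightarrow> bool"
  assumes "finite \<Theta>"
    and "\<And>\<theta> V E \<pi>. \<theta> \<in> \<Theta> \<Longrightarrow> sys V E \<Longrightarrow> \<Phi> V E \<pi> \<Longrightarrow>
      \<exists>V' E' \<pi>'. sys V' E' \<and> \<Phi> V' E' \<pi>' \<and> parrow k A EA {\<theta>} V E \<pi> V' E' \<pi>'"
    and "sys V E" "\<Phi> V E \<pi>"
  shows "\<exists>V' E' \<pi>'. sys V' E' \<and> \<Phi> V' E' \<pi>' \<and> parrow k A EA \<Theta> V E \<pi> V' E' \<pi>'"
  using assms(1,2)
proof (induction \<Theta> rule: finite_induct)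
  case empty
  have "emb V E V E (\<lambda>x. x)" by (simp add: emb_def)
  then have "parrow k A EA {} V E \<pi> V E \<pi>" unfolding parrow_def by blast
  then show ?case using assms(3,4) by blast
next
  case (insert \<theta> \<Theta>)
  from insert.IH insert.prems obtain V1 E1 \<pi>1 where 1: "sys V1 E1" "\<Phi> V1 E1 \<pi>1"
    "parrow k A EA \<Theta> V E \<pi> V1 E1 \<pi>1" by blast
  from insert.prems[OF _ 1(1,2), of \<theta>] obtain V2 E2 \<pi>2 where 2: "sys V2 E2" "\<Phi> V2 E2 \<pi>2"
    "parrow k A EA {\<theta>} V1 E1 \<pi>1 V2 E2 \<pi>2" by blast
  have "parrow k A EA (insert \<theta> \<Theta>) V E \<pi> V2 E2 \<pi>2"
    unfolding parrow_def
  proof (intro allI impI)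
    fix \<chi> :: "('c \<Rightarrow> nat) \<Rightarrow> nat" assume \<chi>: "\<forall>f. \<chi> f < k"
    obtain l2 where l2: "emb V1 E1 V2 E2 l2" "\<And>v. v \<in> V1 \<Longrightarrow> \<pi>2 (l2 v) = \<pi>1 v"
      "\<And>\<theta>' \<alpha> \<beta>. \<theta>' \<in> {\<theta>} \<Longrightarrow> \<alpha> \<in> copies A EA V1 E1 \<pi>1 \<theta>' \<Longrightarrow> \<beta> \<in> copies A EA V1 E1 \<pi>1 \<theta>' \<Longrightarrow>
        \<chi> (compose A l2 \<alpha>) = \<chi> (compose A l2 \<beta>)"
      by (rule parrowD[OF 2(3) \<chi>[rule_format]]) (rule that)
    obtain l1 where l1: "emb V E V1 E1 l1" "\<And>v. v \<in> V \<Longrightarrow> \<pi>1 (l1 v) = \<pi> v"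
      "\<And>\<theta> \<alpha> \<beta>. \<theta> \<in> \<Theta> \<Longrightarrow> \<alpha> \<in> copies A EA V E \<pi> \<theta> \<Longrightarrow> \<beta> \<in> copies A EA V E \<pi> \<theta> \<Longrightarrow>
        \<chi> (compose A l2 (compose A l1 \<alpha>)) = \<chi> (compose A l2 (compose A l1 \<beta>))"
      by (rule parrowD[OF 1(3), of "\<lambda>f. \<chi> (compose A l2 f)"]) (rule \<chi>[rule_format], rule that)
    have c: "compose A (l2 \<circ> l1) \<alpha> = compose A l2 (compose A l1 \<alpha>)" for \<alpha>
      by (auto simp: compose_def fun_eq_iff)
    have cp: "compose A l1 \<alpha> \<in> copies A EA V1 E1 \<pi>1 \<theta>'" if \<alpha>: "\<alpha> \<in> copies A EA V E \<pi> \<theta>'" for \<alpha> \<theta>'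
    proof -
      have "emb A EA V E \<alpha>" using \<alpha> by (simp add: copies_def)
      then show ?thesis
        using emb_compose[OF _ l1(1)] l1(2) \<alpha> emb_in[of A EA V E \<alpha>]
        by (auto simp: copies_def compose_eq)
    qed
    have "\<chi> (compose A (l2 \<circ> l1) \<alpha>) = \<chi> (compose A (l2 \<circ> l1) \<beta>)"
      if "\<theta>' \<in> insert \<theta> \<Theta>" "\<alpha> \<in> copies A EA V E \<pi> \<theta>'" "\<beta> \<in> copies A EA V E \<pi> \<theta>'" for \<theta>' \<alpha> \<beta>
    proof (cases "\<theta>' = \<theta>")
      case True
      then show ?thesis unfolding c using l2(3) cp that by blast
    next
      case False
      then show ?thesis unfolding c using l1(3) that by blast
    qed
    moreover have "\<pi>2 ((l2 \<circ> l1) v) = \<pi> v" if "v \<in> V" for v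
      using l1(2)[OF that] l2(2) emb_in[OF l1(1) that] by simp
    ultimately show "\<exists>l. emb V E V2 E2 l \<and> (\<forall>v\<in>V. \<pi>2 (l v) = \<pi> v) \<and>
      (\<forall>\<theta>\<in>insert \<theta> \<Theta>. \<forall>\<alpha>\<in>copies A EA V E \<pi> \<theta>. \<forall>\<beta>\<in>copies A EA V E \<pi> \<theta>.
        \<chi> (compose A l \<alpha>) = \<chi> (compose A l \<beta>))"
      using emb_comp[OF l1(1) l2(1)] by (intro exI[of _ "l2 \<circ> l1"]) blast
  qed
  then show ?case using 2 by blast
qed

end

section \<open>Ramsey theorems for ordered structures\<close>

definition oemb :: "nat set \<Rightarrow> ('i \<Rightarrow> nat set set) \<Rightarrow> nat set \<Rightarrow> ('i \<Rightarrow> nat set set) \<Rightarrow> (nat \<Rightarrow> nat) \<Rightarrow> bool"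
  where "oemb V E V' E' f \<longleftrightarrow> emb V E V' E' f \<and> strict_mono_on V f"

definition Oemb :: "nat set \<Rightarrow> ('i \<Rightarrow> nat set set) \<Rightarrow> nat set \<Rightarrow> ('i \<Rightarrow> nat set set) \<Rightarrow> (nat \<Rightarrow> nat) set"
  where "Oemb V E V' E' = {f \<in> extensional V. oemb V E V' E' f}"

definition arrows :: "nat \<Rightarrow> nat set \<Rightarrow> ('i \<Rightarrow> nat set set) \<Rightarrow> nat set \<Rightarrow> ('i \<Rightarrow> nat set set) \<Rightarrow>
    nat set \<Rightarrow> ('i \<Rightarrow> nat set set) \<Rightarrow> bool" where
  "arrows k A EA B EB C EC \<longleftrightarrow> (\<forall>\<chi>::(nat \<Rightarrow> nat) \<Rightarrow> nat. (\<forall>f. \<chi> f < k) \<longrightarrow>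
    (\<exists>w. oemb B EB C EC w \<and> (\<forall>f\<in>Oemb A EA B EB. \<forall>g\<in>Oemb A EA B EB.
      \<chi> (compose A w f) = \<chi> (compose A w g))))"

lemma oemb_emb: "oemb V E V' E' f \<Longrightarrow> emb V E V' E' f"
  by (simp add: oemb_def)

lemma oemb_mono: "oemb V E V' E' f \<Longrightarrow> x \<in> V \<Longrightarrow> y \<in> V \<Longrightarrow> x < y \<Longrightarrow> f x < f y"
  by (simp add: oemb_def strict_mono_on_def)

lemma OembD: "f \<in> Oemb V E V' E' \<Longrightarrow> oemb V E V' E' f"
  by (simp add: Oemb_def)

lemma oemb_cong:
  assumes "\<And>x. x \<in> V \<Longrightarrow> f x = g x"
  shows "oemb V E V' E' f = oemb V E V' E' g"
  using emb_cong[of V f g E V' E'] assms by (auto simp: oemb_def strict_mono_on_def)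

lemma oemb_comp:
  assumes "oemb V E V' E' f" "oemb V' E' V'' E'' g"
  shows "oemb V E V'' E'' (g \<circ> f)"
  using assms emb_comp[of V E V' E' f V'' E'' g] emb_in[of V E V' E' f]
  by (auto simp: oemb_def strict_mono_on_def)

lemma oemb_compose:
  assumes "oemb V E V' E' f" "oemb V' E' V'' E'' g"
  shows "oemb V E V'' E'' (compose V g f)"
  using oemb_comp[OF assms] oemb_cong[of V "compose V g f" "g \<circ> f" E V'' E'']
  by (simp add: compose_def)

lemma compose_in_Oemb:
  assumes "oemb V E V' E' f" "oemb V' E' V'' E'' g"
  shows "compose V g f \<in> Oemb V E V'' E''"
  using oemb_compose[OF assms] by (simp add: Oemb_def)

lemma restrict_in_Oemb: "oemb V E V' E' f \<Longrightarrow> restrict f V \<in> Oemb V E V' E'"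
  using oemb_cong[of V "restrict f V" f E V' E'] by (simp add: Oemb_def)

lemma finite_Oemb:
  assumes "finite V" "finite V'"
  shows "finite (Oemb V E V' E')"
  by (rule finite_subset[OF _ finite_PiE[OF assms(1), of "\<lambda>_. V'"]])
    (auto simp: Oemb_def oemb_def emb_def PiE_def assms)

text \<open>By induction on \<open>x\<close>: the value \<open>f x\<close> equals some
  \<open>g y\<close>, and \<open>y < x\<close> would give \<open>f y = f x\<close>. Hence
  \<open>g x \<le> f x\<close>, and the situation is symmetric.\<close>

lemma strict_mono_on_eqI:
  fixes f g :: "nat \<Rightarrow> nat"
  assumes "strict_mono_on A f" "strict_mono_on A g" "f ` A = g ` A"
  shows "x \<in> A \<Longrightarrow> f x = g x"
proof (induction x rule: less_induct)
  case (less x)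
  have 1: "g x \<le> f x" if fg: "strict_mono_on A f" "strict_mono_on A g" "f ` A = g ` A"
    "\<And>y. y < x \<Longrightarrow> y \<in> A \<Longrightarrow> f y = g y" for f g :: "nat \<Rightarrow> nat"
  proof -
    obtain y where y: "y \<in> A" "f x = g y" using fg(3) less.prems by blast
    have "x \<le> y"
    proof (rule ccontr)
      assume "\<not> x \<le> y"
      then show False
        using fg(4)[of y] strict_mono_onD[OF fg(1), of y x] y less.prems by simp
    qed
    then show ?thesis
      using fg(2) y less.prems by (auto simp: strict_mono_on_def le_less)
  qed
  show ?case
    using 1[of f g] 1[of g f] assms less by (simp add: antisym)
qed

lemma ex_strict_mono_onto:
  fixes B H :: "nat set"
  assumes "finite B" "finite H" "card B = card H"
  obtains t where "strict_mono_on B t" "t ` B = H"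
proof -
  obtain b where b: "bij_betw b {..<card B} B" "strict_mono_on {..<card B} b"
    using ex_bij_betw_strict_mono_card[OF assms(1)] by blast
  obtain h where h: "bij_betw h {..<card B} H" "strict_mono_on {..<card B} h"
    using ex_bij_betw_strict_mono_card[OF assms(2)] assms(3) by metis
  let ?b = "inv_into {..<card B} b"
  have ib: "bij_betw ?b B {..<card B}" using b(1) by (rule bij_betw_inv_into)
  have "?b x < ?b y" if "x \<in> B" "y \<in> B" "x < y" for x y
  proof (rule ccontr)
    assume "\<not> ?b x < ?b y"
    then have "?b y < ?b x \<or> ?b x = ?b y" by linarith
    moreover have "?b x \<in> {..<card B}" "?b y \<in> {..<card B}" "b (?b x) = x" "b (?b y) = y"
      using that ib b(1) by (auto simp: bij_betw_def f_inv_into_f inv_into_into)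
    ultimately show False
      using that(3) strict_mono_onD[OF b(2), of "?b y" "?b x"] by auto
  qed
  then have "strict_mono_on B (h \<circ> ?b)"
    using h(2) bij_betw_apply[OF ib] by (simp add: strict_mono_on_def)
  moreover have "(h \<circ> ?b) ` B = H"
    unfolding image_comp[symmetric] using h(1) ib by (simp add: bij_betw_def)
  ultimately show ?thesis using that by blast
qed

lemma ramsey_increasing_maps:
  fixes A B :: "nat set"
  assumes "finite A" "finite B"
  obtains p :: nat where "\<And>\<chi>::(nat \<Rightarrow> nat) \<Rightarrow> nat. (\<And>f. \<chi> f < k) \<Longrightarrow>
    \<exists>t. strict_mono_on B t \<and> t \<in> B \<rightarrow>\<^sub>E {..<p} \<and>
      (\<forall>f g. strict_mono_on A f \<longrightarrow> strict_mono_on A g \<longrightarrow> f \<in> A \<rightarrow> B \<longrightarrow> g \<in> A \<rightarrow> B \<longrightarrow>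
        \<chi> (compose A t f) = \<chi> (compose A t g))"
proof -
  obtain p :: nat where p: "partn_lst {..<p} (replicate k (card B)) (card A)"
    using ramsey_full by blast
  have "\<exists>t. strict_mono_on B t \<and> t \<in> B \<rightarrow>\<^sub>E {..<p} \<and>
      (\<forall>f g. strict_mono_on A f \<longrightarrow> strict_mono_on A g \<longrightarrow> f \<in> A \<rightarrow> B \<longrightarrow> g \<in> A \<rightarrow> B \<longrightarrow>
        \<chi> (compose A t f) = \<chi> (compose A t g))"
    if \<chi>: "\<And>f. \<chi> f < k" for \<chi> :: "(nat \<Rightarrow> nat) \<Rightarrow> nat"
  proof -
    \<comment> \<open>An increasing map on \<open>A\<close> is determined by its image, so colouring
      maps amounts to colouring sets of size \<open>card A\<close>.\<close>
    define c where "c S = \<chi> (SOME \<theta>. \<theta> \<in> extensional A \<and> strict_mono_on A \<theta> \<and> \<theta> ` A = S)" for S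
    have c: "c (\<theta> ` A) = \<chi> \<theta>" if \<theta>: "\<theta> \<in> extensional A" "strict_mono_on A \<theta>" for \<theta>
    proof -
      let ?s = "SOME \<eta>. \<eta> \<in> extensional A \<and> strict_mono_on A \<eta> \<and> \<eta> ` A = \<theta> ` A"
      have s: "?s \<in> extensional A \<and> strict_mono_on A ?s \<and> ?s ` A = \<theta> ` A"
        by (rule someI[of _ \<theta>]) (simp add: \<theta>)
      then have "?s x = \<theta> x" if "x \<in> A" for x
        using strict_mono_on_eqI[of A ?s \<theta>] \<theta> that by blast
      then have "?s = \<theta>"
        using s \<theta> by (intro extensionalityI[of _ A]) auto
      then show ?thesis by (simp add: c_def)
    qed
    have "c \<in> nsets {..<p} (card A) \<rightarrow> {..<k}" using \<chi> by (auto simp: c_def)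
    then obtain i H where i: "i < k" and H: "H \<in> nsets {..<p} (replicate k (card B) ! i)"
      and mono: "c ` nsets H (card A) \<subseteq> {i}"
      using p by (elim partn_lstE) auto
    have H': "H \<subseteq> {..<p}" "finite H" "card B = card H"
      using H i by (auto simp: nsets_def)
    obtain t where t: "strict_mono_on B t" "t ` B = H"
      using ex_strict_mono_onto[OF assms(2) H'(2,3)] by blast
    let ?t = "restrict t B"
    have tB: "strict_mono_on B ?t" using t(1) by (simp add: strict_mono_on_def)
    have col: "\<chi> (compose A ?t f) = i" if f: "strict_mono_on A f" "f \<in> A \<rightarrow> B" for f
    proof -
      have inc: "strict_mono_on A (compose A ?t f)"
        using f tB by (auto simp: strict_mono_on_def compose_eq Pi_iff)
      have "inj_on (compose A ?t f) A" using strict_mono_on_imp_inj_on[OF inc] .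
      then have "card (compose A ?t f ` A) = card A" by (rule card_image)
      moreover have "compose A ?t f ` A \<subseteq> H"
        using f(2) t(2) by (auto simp: compose_eq Pi_iff)
      ultimately have "compose A ?t f ` A \<in> nsets H (card A)"
        using assms(1) by (simp add: nsets_def)
      then have "c (compose A ?t f ` A) = i" using mono by blast
      then show ?thesis using c[OF _ inc] by (simp add: compose_def)
    qed
    have "?t \<in> B \<rightarrow>\<^sub>E {..<p}" using t(2) H'(1) by auto
    then show ?thesis using tB col by metis
  qed
  then show ?thesis using that by blast
qed

section \<open>From partite systems to ordered structures\<close>

context struct_class
begin

text \<open>This is the initial system of both constructions: one copy of \<open>B\<close> for each
  position \<open>t\<close> in the base, projected by \<open>t\<close>. Irreducible sets stay within
  one copy; \<open>T \<noteq> {}\<close> provides a member of \<open>\<G>\<close> for the empty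
  set.\<close>

lemma disjoint_copies:
  fixes B :: "nat set" and T :: "(nat \<Rightarrow> nat) set"
  assumes B: "sys B EB" and T: "finite T"
  obtains V :: "nat set" and E \<pi> j where "sys V E" "\<And>t. t \<in> T \<Longrightarrow> emb B EB V E (j t)"
    "\<And>t b. t \<in> T \<Longrightarrow> b \<in> B \<Longrightarrow> \<pi> (j t b) = t b"
    "\<forall>E0 \<G>. (\<forall>t\<in>T. t ` B \<in> \<G> \<and> emb B EB UNIV E0 t) \<longrightarrow> T \<noteq> {} \<longrightarrow> hom_irr E0 \<G> V E \<pi>"
proof -
  define V1 where "V1 = T \<times> B"
  define E1 where "E1 i = {Pair t ` e |t e. t \<in> T \<and> e \<in> EB i}" for i
  define \<pi>1 :: "(nat \<Rightarrow> nat) \<times> nat \<Rightarrow> nat" where "\<pi>1 = (\<lambda>(t, b). t b)"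
  have sys1: "sys V1 E1"
  proof -
    have "finite V1" using assms by (simp add: V1_def sys_def)
    moreover have "card (Pair t ` e) = card e" for t :: "nat \<Rightarrow> nat" and e :: "nat set"
      by (rule card_image) (simp add: inj_on_def)
    ultimately show ?thesis using B by (auto simp: sys_def E1_def V1_def dest: subsetD[OF sysD[OF B]])
  qed
  have emb1: "emb B EB V1 E1 (Pair t)" if t: "t \<in> T" for t
    unfolding emb_def
  proof (intro conjI allI impI)
    show "Pair t \<in> B \<rightarrow> V1" using t by (auto simp: V1_def)
    show "inj_on (Pair t) B" by (simp add: inj_on_def)
    fix i e assume "e \<subseteq> B"
    show "Pair t ` e \<in> E1 i \<longleftrightarrow> e \<in> EB i"
    proof
      assume "Pair t ` e \<in> E1 i"
      then obtain t' e' where e': "e' \<in> EB i" "Pair t ` e = Pair t' ` e'" by (auto simp: E1_def)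
      have "snd ` Pair t ` e = e" "snd ` Pair t' ` e' = e'" by (auto simp: image_image)
      then show "e \<in> EB i" using e' by metis
    qed (use t in \<open>auto simp: E1_def\<close>)
  qed
  have hom1: "hom_irr E0 \<G> V1 E1 \<pi>1"
    if *: "\<And>t. t \<in> T \<Longrightarrow> t ` B \<in> \<G> \<and> emb B EB UNIV E0 t" and ne: "T \<noteq> {}" for E0 \<G>
    unfolding hom_irr_def
  proof (intro conjI allI ballI impI)
    fix i e assume "e \<in> E1 i"
    then obtain t d where td: "t \<in> T" "d \<in> EB i" "e = Pair t ` d" by (auto simp: E1_def)
    have dB: "d \<subseteq> B" using sysD[OF B td(2)] .
    have em: "emb B EB UNIV E0 t" using * td by blast
    have "\<pi>1 ` e = t ` d" unfolding td image_image by (simp add: \<pi>1_def)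
    then show "\<pi>1 ` e \<in> E0 i" using emb_edge[OF em dB] td by simp
    have "inj_on t d" using inj_on_subset[OF emb_inj[OF em] dB] .
    then show "inj_on \<pi>1 e" unfolding td by (auto simp: inj_on_def \<pi>1_def)
  next
    fix W assume W: "W \<subseteq> V1" "irr E1 W"
    have "\<exists>t\<in>T. W \<subseteq> Pair t ` B"
    proof (cases "W = {}")
      case True
      then show ?thesis using ne by auto
    next
      case False
      then obtain t b where tb: "(t, b) \<in> W" by auto
      then have t: "t \<in> T" "b \<in> B" using W by (auto simp: V1_def)
      have "w \<in> Pair t ` B" if w: "w \<in> W" for w
      proof (cases "w = (t, b)")
        case False
        then obtain i e where e: "e \<in> E1 i" "e \<subseteq> W" "w \<in> e" "(t, b) \<in> e"
          using W(2) tb w unfolding irr_def by blast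
        then obtain t' d where "e = Pair t' ` d" by (auto simp: E1_def)
        then have "fst w = t" using e by auto
        then show ?thesis using w W(1) by (cases w) (auto simp: V1_def)
      qed (use t in auto)
      then show ?thesis using t by blast
    qed
    then obtain t where t: "t \<in> T" "W \<subseteq> Pair t ` B" by blast
    have em: "emb B EB UNIV E0 t" and G: "t ` B \<in> \<G>" using * t by auto
    have "\<pi>1 ` W \<subseteq> t ` B" using t(2) by (auto simp: \<pi>1_def)
    then show "\<exists>G\<in>\<G>. \<pi>1 ` W \<subseteq> G" using G by blast
    fix i e assume e: "e \<subseteq> W" "\<pi>1 ` e \<in> E0 i"
    then obtain d where d: "d \<subseteq> B" "e = Pair t ` d" using t(2) by (metis order_trans subset_image_iff)
    then have "\<pi>1 ` e = t ` d" by (simp add: image_image \<pi>1_def)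
    then have "d \<in> EB i" using emb_edge[OF em d(1)] e by simp
    then show "e \<in> E1 i" using d t by (auto simp: E1_def)
  qed
  have fin: "finite V1" and EV: "\<And>i. E1 i \<subseteq> Pow V1" using sys1 by (auto simp: sys_def)
  obtain \<rho> :: "(nat \<Rightarrow> nat) \<times> nat \<Rightarrow> nat" where \<rho>: "inj_on \<rho> V1"
    using finite_imp_inj_to_nat_seg[OF fin] by blast
  define E2 where "E2 i = image \<rho> ` E1 i" for i
  define \<pi>2 where "\<pi>2 = \<pi>1 \<circ> inv_into V1 \<rho>"
  have r1: "emb V1 E1 (\<rho> ` V1) E2 \<rho>" and r2: "emb (\<rho> ` V1) E2 V1 E1 (inv_into V1 \<rho>)"
    using emb_relabel[of \<rho> V1 E1, OF \<rho> EV] unfolding E2_def by blast+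
  have sys2: "sys (\<rho> ` V1) E2" using sys_relabel[OF sys1 \<rho>] unfolding E2_def .
  show ?thesis
  proof (rule that[OF sys2])
    show "emb B EB (\<rho> ` V1) E2 ((\<lambda>t. \<rho> \<circ> Pair t) t)" if "t \<in> T" for t
      using emb_comp[OF emb1[OF that] r1] .
    show "\<pi>2 ((\<lambda>t. \<rho> \<circ> Pair t) t b) = t b" if "t \<in> T" "b \<in> B" for t b
      using that \<rho> by (simp add: \<pi>2_def V1_def \<pi>1_def)
    have "hom_irr E0 \<G> (\<rho> ` V1) E2 \<pi>2"
      if *: "\<forall>t\<in>T. t ` B \<in> \<G> \<and> emb B EB UNIV E0 t" "T \<noteq> {}" for E0 \<G>
    proof -
      have "hom_irr E0 \<G> V1 E1 \<pi>1" by (rule hom1) (use * in auto)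
      then show ?thesis
        using hom_irr_emb[OF _ r2, of E0 \<G> \<pi>1 \<pi>2] sysD[OF sys2] by (auto simp: \<pi>2_def)
    qed
    then show "\<forall>E0 \<G>. (\<forall>t\<in>T. t ` B \<in> \<G> \<and> emb B EB UNIV E0 t) \<longrightarrow> T \<noteq> {} \<longrightarrow>
        hom_irr E0 \<G> (\<rho> ` V1) E2 \<pi>2" by blast
  qed
qed

lemma lex_less:
  fixes a b u v M :: nat
  assumes "a < b" "u < M"
  shows "a * M + u < b * M + v"
proof -
  have "a * M + u < (a + 1) * M" using assms by simp
  also have "\<dots> \<le> b * M" using assms by (intro mult_right_mono) auto
  finally show ?thesis by simp
qed

lemma lex_inj:
  fixes \<pi> :: "nat \<Rightarrow> nat"
  assumes "V \<subseteq> {..<M}"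
  shows "inj_on (\<lambda>v. \<pi> v * M + v) V"
proof (rule inj_onI)
  fix u v assume uv: "u \<in> V" "v \<in> V" "\<pi> u * M + u = \<pi> v * M + v"
  then have "u < M" "v < M" using assms by auto
  then have "\<pi> u = \<pi> v" using lex_less[of "\<pi> u" "\<pi> v" u M v] lex_less[of "\<pi> v" "\<pi> u" v M u] uv(3)
    by (metis nat_neq_iff)
  then show "u = v" using uv by simp
qed

text \<open>The code \<open>\<pi>' v * M + v\<close> orders the vertices by their part, and arbitrarily inside a part.\<close>

lemma arrows_of_parrow:
  fixes A B V V' :: "nat set" and \<pi> \<pi>' :: "nat \<Rightarrow> nat"
  assumes base: "\<And>\<chi>::(nat \<Rightarrow> nat) \<Rightarrow> nat. (\<And>f. \<chi> f < k) \<Longrightarrow>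
      \<exists>t\<in>T. \<forall>f\<in>Oemb A EA B EB. \<forall>g\<in>Oemb A EA B EB. \<chi> (compose A t f) = \<chi> (compose A t g)"
    and T: "\<And>t. t \<in> T \<Longrightarrow> strict_mono_on B t"
      "\<And>t f. t \<in> T \<Longrightarrow> f \<in> Oemb A EA B EB \<Longrightarrow> compose A t f \<in> \<Theta>"
    and j: "\<And>t. t \<in> T \<Longrightarrow> emb B EB V E (j t)" "\<And>t b. t \<in> T \<Longrightarrow> b \<in> B \<Longrightarrow> \<pi> (j t b) = t b"
    and V': "sys V' E'" "V' \<subseteq> {..<M}" and arr: "parrow k A EA \<Theta> V E \<pi> V' E' \<pi>'"
  shows "arrows k A EA B EB ((\<lambda>v. \<pi>' v * M + v) ` V') (\<lambda>i. image (\<lambda>v. \<pi>' v * M + v) ` E' i)"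
  unfolding arrows_def
proof (intro allI impI)
  fix \<chi> :: "(nat \<Rightarrow> nat) \<Rightarrow> nat" assume \<chi>: "\<forall>f. \<chi> f < k"
  let ?\<rho> = "\<lambda>v. \<pi>' v * M + v"
  let ?E = "\<lambda>i. image ?\<rho> ` E' i"
  have inj: "inj_on ?\<rho> V'" using lex_inj[OF V'(2)] .
  have em: "emb V' E' (?\<rho> ` V') ?E ?\<rho>"
    using emb_relabel(1)[OF inj, of E'] sysD[OF V'(1)] by blast
  obtain l where l: "emb V E V' E' l" "\<And>v. v \<in> V \<Longrightarrow> \<pi>' (l v) = \<pi> v"
    "\<And>\<theta> \<alpha> \<beta>. \<theta> \<in> \<Theta> \<Longrightarrow> \<alpha> \<in> copies A EA V E \<pi> \<theta> \<Longrightarrow> \<beta> \<in> copies A EA V E \<pi> \<theta> \<Longrightarrow>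
      \<chi> (compose A ?\<rho> (compose A l \<alpha>)) = \<chi> (compose A ?\<rho> (compose A l \<beta>))"
    by (rule parrowD[OF arr, of "\<lambda>f. \<chi> (compose A ?\<rho> f)"]) (rule \<chi>[rule_format], rule that)
  \<comment> \<open>On the homogenized system the colour of a copy depends only on its position, so
    it defines a colouring of the base; the Ramsey property of the base then selects the right copy
    of \<open>B\<close>.\<close>
  define \<chi>0 where "\<chi>0 \<theta> = \<chi> (compose A ?\<rho> (compose A l (SOME \<alpha>. \<alpha> \<in> copies A EA V E \<pi> \<theta>)))" for \<theta>
  obtain t where t: "t \<in> T"
    "\<forall>f\<in>Oemb A EA B EB. \<forall>g\<in>Oemb A EA B EB. \<chi>0 (compose A t f) = \<chi>0 (compose A t g)"
    using base[of \<chi>0] \<chi> by (auto simp: \<chi>0_def)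
  define w where "w = ?\<rho> \<circ> (l \<circ> j t)"
  have w: "oemb B EB (?\<rho> ` V') ?E w"
    unfolding oemb_def
  proof
    show "emb B EB (?\<rho> ` V') ?E w"
      unfolding w_def using emb_comp[OF emb_comp[OF j(1)[OF t(1)] l(1)] em] .
    have "\<pi>' (l (j t b)) = t b" "l (j t b) \<in> V'" if "b \<in> B" for b
      using that l(2) j(2)[OF t(1)] emb_in[OF j(1)[OF t(1)]] emb_in[OF l(1)] by auto
    moreover from this have "l (j t b) < M" if "b \<in> B" for b using V'(2) that by blast
    ultimately show "strict_mono_on B w"
      using T(1)[OF t(1)] lex_less unfolding strict_mono_on_def w_def by simp
  qed
  have col: "\<chi> (compose A w f) = \<chi>0 (compose A t f)" if f: "f \<in> Oemb A EA B EB" for f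
  proof -
    have fe: "emb A EA B EB f" using f by (simp add: Oemb_def oemb_def)
    let ?\<alpha> = "compose A (j t) f"
    have "?\<alpha> \<in> copies A EA V E \<pi> (compose A t f)"
      using emb_compose[OF fe j(1)[OF t(1)]] j(2)[OF t(1)] emb_in[OF fe]
      by (simp add: copies_def compose_eq)
    moreover from this have "(SOME \<alpha>. \<alpha> \<in> copies A EA V E \<pi> (compose A t f)) \<in>
        copies A EA V E \<pi> (compose A t f)" by (auto simp: some_in_eq)
    ultimately have "\<chi> (compose A ?\<rho> (compose A l ?\<alpha>)) = \<chi>0 (compose A t f)"
      unfolding \<chi>0_def using l(3) T(2)[OF t(1) f] by blast
    moreover have "compose A w f = compose A ?\<rho> (compose A l ?\<alpha>)"
      by (auto simp: compose_def w_def fun_eq_iff)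
    ultimately show ?thesis by simp
  qed
  show "\<exists>w. oemb B EB (?\<rho> ` V') ?E w \<and> (\<forall>f\<in>Oemb A EA B EB. \<forall>g\<in>Oemb A EA B EB.
      \<chi> (compose A w f) = \<chi> (compose A w g))"
  proof (intro exI[of _ w] conjI w ballI)
    fix f g assume "f \<in> Oemb A EA B EB" "g \<in> Oemb A EA B EB"
    then show "\<chi> (compose A w f) = \<chi> (compose A w g)" using t(2) col by metis
  qed
qed

lemma finite_bound:
  fixes V :: "nat set"
  assumes "sys V E"
  obtains M where "V \<subseteq> {..<M}"
  using assms finite_nat_iff_bounded[of V] by (auto simp: sys_def)

text \<open>The base is the bare order \<open>{..<p}\<close>; \<Theta> consists of all increasing
  maps into it, because any of them can be the position of a copy of \<open>A\<close>.\<close>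

theorem ramsey_unrestricted:
  fixes A B :: "nat set"
  assumes A: "finite A" and B: "sys B EB"
  obtains C :: "nat set" and EC where "sys C EC" "arrows k A EA B EB C EC"
proof -
  have finB: "finite B" using B by (simp add: sys_def)
  obtain p where p: "\<And>\<chi>::(nat \<Rightarrow> nat) \<Rightarrow> nat. (\<And>f. \<chi> f < k) \<Longrightarrow>
    \<exists>t. strict_mono_on B t \<and> t \<in> B \<rightarrow>\<^sub>E {..<p} \<and>
      (\<forall>f g. strict_mono_on A f \<longrightarrow> strict_mono_on A g \<longrightarrow> f \<in> A \<rightarrow> B \<longrightarrow> g \<in> A \<rightarrow> B \<longrightarrow>
        \<chi> (compose A t f) = \<chi> (compose A t g))"
    using ramsey_increasing_maps[OF A finB, of k] by blast
  define T where "T = {t \<in> B \<rightarrow>\<^sub>E {..<p}. strict_mono_on B t}"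
  define \<Theta> where "\<Theta> = {t \<in> A \<rightarrow>\<^sub>E {..<p}. strict_mono_on A t}"
  have finT: "finite T" using finite_PiE[OF finB, of "\<lambda>_. {..<p}"] by (simp add: T_def)
  have fin\<Theta>: "finite \<Theta>" using finite_PiE[OF A, of "\<lambda>_. {..<p}"] by (simp add: \<Theta>_def)
  obtain V :: "nat set" and E \<pi> j where V: "sys V E" "\<And>t. t \<in> T \<Longrightarrow> emb B EB V E (j t)"
    "\<And>t b. t \<in> T \<Longrightarrow> b \<in> B \<Longrightarrow> \<pi> (j t b) = t b"
    using disjoint_copies[OF B finT] by metis
  have "\<exists>(V' :: nat set) E' \<pi>'. sys V' E' \<and> True \<and> parrow k A EA \<Theta> V E \<pi> V' E' \<pi>'"
  proof (rule partite_iterate[OF fin\<Theta> _ V(1), where \<Phi> = "\<lambda>_ _ _. True"])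
    fix \<theta> E and V :: "nat set" and \<pi> :: "nat \<Rightarrow> nat" assume \<theta>: "\<theta> \<in> \<Theta>" and V: "sys V E"
    have inj: "inj_on \<theta> A" using \<theta> strict_mono_on_imp_inj_on by (auto simp: \<Theta>_def)
    show "\<exists>(V' :: nat set) E' \<pi>'. sys V' E' \<and> True \<and> parrow k A EA {\<theta>} V E \<pi> V' E' \<pi>'"
      by (rule partite_step[OF V A inj, of k EA \<pi>]) blast
  qed simp
  then obtain V' :: "nat set" and E' \<pi>' where V': "sys V' E'" "parrow k A EA \<Theta> V E \<pi> V' E' \<pi>'" by blast
  obtain M where M: "V' \<subseteq> {..<M}" using finite_bound[OF V'(1)] .
  have "arrows k A EA B EB ((\<lambda>v. \<pi>' v * M + v) ` V') (\<lambda>i. image (\<lambda>v. \<pi>' v * M + v) ` E' i)"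
  proof (rule arrows_of_parrow[OF _ _ _ V(2,3) V'(1) M V'(2)])
    fix \<chi> :: "(nat \<Rightarrow> nat) \<Rightarrow> nat" assume "\<And>f. \<chi> f < k"
    from p[of \<chi>, OF this] obtain t where t: "strict_mono_on B t" "t \<in> B \<rightarrow>\<^sub>E {..<p}"
      "\<And>f g. strict_mono_on A f \<Longrightarrow> strict_mono_on A g \<Longrightarrow> f \<in> A \<rightarrow> B \<Longrightarrow> g \<in> A \<rightarrow> B \<Longrightarrow>
        \<chi> (compose A t f) = \<chi> (compose A t g)" by blast
    then show "\<exists>t\<in>T. \<forall>f\<in>Oemb A EA B EB. \<forall>g\<in>Oemb A EA B EB. \<chi> (compose A t f) = \<chi> (compose A t g)"
      by (intro bexI[of _ t] ballI t(3)) (auto simp: T_def Oemb_def oemb_def emb_def)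
  next
    fix t f assume "t \<in> T" "f \<in> Oemb A EA B EB"
    then show "compose A t f \<in> \<Theta>"
      by (fastforce simp: T_def \<Theta>_def Oemb_def oemb_def emb_def strict_mono_on_def compose_def
          Pi_iff PiE_def)
  qed (simp add: T_def)
  then show ?thesis
    using that sys_relabel[OF V'(1) lex_inj[OF M]] by blast
qed

end

text \<open>This closure property is the only access to the forbidden hypergraphs: membership of a
  structure is decided by its irreducible subsets, each of which must embed into some
  member.\<close>

locale forb_class = struct_class ok for ok :: "'i \<Rightarrow> nat \<Rightarrow> bool" +
  fixes K :: "nat set \<Rightarrow> ('i \<Rightarrow> nat set set) \<Rightarrow> bool"
  assumes K_irr: "sys V E \<Longrightarrow> (\<And>W. W \<subseteq> V \<Longrightarrow> irr E W \<Longrightarrow> \<exists>V' E' g. K V' E' \<and> oemb W E V' E' g) \<Longrightarrow> K V E"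
begin

text \<open>An irreducible set of the result projects injectively into \<open>C0\<close>, reflects
  edges there and lands in a copy of \<open>A\<close> or of \<open>B\<close>. Composing with the
  inverse of that copy embeds it into a member of the class.\<close>

theorem ramsey_forb:
  assumes A: "sys A EA" "K A EA" and B: "sys B EB" "K B EB" and k: "0 < k"
  obtains C EC where "sys C EC" "K C EC" "arrows k A EA B EB C EC"
proof -
  have finA: "finite A" and finB: "finite B" using A B by (auto simp: sys_def)
  obtain C0 E0 where C0: "sys C0 E0" "arrows k A EA B EB C0 E0"
    using ramsey_unrestricted[OF finA B(1)] by blast
  have finC: "finite C0" using C0 by (simp add: sys_def)
  define T where "T = Oemb B EB C0 E0"
  define \<Theta> where "\<Theta> = Oemb A EA C0 E0"
  define \<G> where "\<G> = (\<lambda>t. t ` B) ` T \<union> (\<lambda>t. t ` A) ` \<Theta>"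
  have finT: "finite T" "finite \<Theta>" using finite_Oemb finA finB finC by (auto simp: T_def \<Theta>_def)
  have base: "\<exists>t\<in>T. \<forall>f\<in>Oemb A EA B EB. \<forall>g\<in>Oemb A EA B EB. \<chi> (compose A t f) = \<chi> (compose A t g)"
    if \<chi>: "\<And>f. \<chi> f < k" for \<chi> :: "(nat \<Rightarrow> nat) \<Rightarrow> nat"
  proof -
    obtain w where w: "oemb B EB C0 E0 w"
      "\<And>f g. f \<in> Oemb A EA B EB \<Longrightarrow> g \<in> Oemb A EA B EB \<Longrightarrow> \<chi> (compose A w f) = \<chi> (compose A w g)"
      using C0(2)[unfolded arrows_def, rule_format, of \<chi>] \<chi> by blast
    have "compose A (restrict w B) f = compose A w f" if "f \<in> Oemb A EA B EB" for f
      using that by (auto simp: compose_def fun_eq_iff Oemb_def oemb_def emb_def)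
    then have "\<chi> (compose A (restrict w B) f) = \<chi> (compose A (restrict w B) g)"
      if "f \<in> Oemb A EA B EB" "g \<in> Oemb A EA B EB" for f g
      using w(2)[OF that] that by simp
    then show ?thesis
      using restrict_in_Oemb[OF w(1)] unfolding T_def by blast
  qed
  have ne: "T \<noteq> {}" using base[of "\<lambda>_. 0"] k by auto
  obtain V :: "nat set" and E \<pi> j where V: "sys V E" "\<And>t. t \<in> T \<Longrightarrow> emb B EB V E (j t)"
    "\<And>t b. t \<in> T \<Longrightarrow> b \<in> B \<Longrightarrow> \<pi> (j t b) = t b"
    and homV: "\<forall>E0 \<G>. (\<forall>t\<in>T. t ` B \<in> \<G> \<and> emb B EB UNIV E0 t) \<longrightarrow> T \<noteq> {} \<longrightarrow> hom_irr E0 \<G> V E \<pi>"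
    by (rule disjoint_copies[OF B(1) finT(1)]) (rule that)
  have hom: "hom_irr E0 \<G> V E \<pi>"
    by (rule homV[rule_format, OF _ ne]) (auto simp: \<G>_def T_def Oemb_def oemb_def emb_def)
  have "\<exists>(V' :: nat set) E' \<pi>'. sys V' E' \<and> hom_irr E0 \<G> V' E' \<pi>' \<and> parrow k A EA \<Theta> V E \<pi> V' E' \<pi>'"
  proof (rule partite_iterate[OF finT(2) _ V(1), where \<Phi> = "hom_irr E0 \<G>", OF _ hom])
    fix \<theta> E and V :: "nat set" and \<pi> :: "nat \<Rightarrow> nat"
    assume \<theta>: "\<theta> \<in> \<Theta>" and V: "sys V E" "hom_irr E0 \<G> V E \<pi>"
    have e: "emb A EA C0 E0 \<theta>" and G: "\<theta> ` A \<in> \<G>"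
      using \<theta> by (auto simp: \<Theta>_def \<G>_def Oemb_def oemb_def)
    show "\<exists>(V' :: nat set) E' \<pi>'. sys V' E' \<and> hom_irr E0 \<G> V' E' \<pi>' \<and> parrow k A EA {\<theta>} V E \<pi> V' E' \<pi>'"
      by (rule partite_step_hom[OF V(1) finA emb_inj[OF e] k V(2) emb_edge[OF e] G]) blast+
  qed
  then obtain V' :: "nat set" and E' \<pi>' where V': "sys V' E'" "parrow k A EA \<Theta> V E \<pi> V' E' \<pi>'"
    and hom': "hom_irr E0 \<G> V' E' \<pi>'" by blast
  obtain M where M: "V' \<subseteq> {..<M}" using finite_bound[OF V'(1)] .
  define \<rho> where "\<rho> v = \<pi>' v * M + v" for v
  define C where "C = \<rho> ` V'"
  define EC where "EC i = image \<rho> ` E' i" for i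
  have inj: "inj_on \<rho> V'" using lex_inj[OF M, of \<pi>'] by (simp add: \<rho>_def[abs_def])
  have em: "emb V' E' C EC \<rho>"
    using emb_relabel(1)[OF inj, of E'] sysD[OF V'(1)] unfolding C_def EC_def[abs_def] by blast
  have sysC: "sys C EC" using sys_relabel[OF V'(1) inj] by (simp add: C_def EC_def[abs_def])
  have "arrows k A EA B EB ((\<lambda>v. \<pi>' v * M + v) ` V') (\<lambda>i. image (\<lambda>v. \<pi>' v * M + v) ` E' i)"
  proof (rule arrows_of_parrow[OF base _ _ V(2,3) V'(1) M V'(2)])
    show "strict_mono_on B t" if "t \<in> T" for t using that by (simp add: T_def Oemb_def oemb_def)
    show "compose A t f \<in> \<Theta>" if "t \<in> T" "f \<in> Oemb A EA B EB" for t f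
      using that compose_in_Oemb by (auto simp: T_def \<Theta>_def dest!: OembD)
  qed
  then have "arrows k A EA B EB C EC" by (simp add: C_def EC_def[abs_def] \<rho>_def[abs_def])
  moreover have "K C EC"
  proof (rule K_irr[OF sysC])
    fix W assume W: "W \<subseteq> C" "irr EC W"
    obtain U where U: "U \<subseteq> V'" "W = \<rho> ` U" using W(1) by (auto simp: C_def subset_image_iff)
    have irrU: "irr E' U" using irr_image[OF em U(1)] W U by simp
    have injU: "inj_on \<pi>' U" using hom_irr_inj[OF hom' irrU] .
    have refl: "\<And>i e. e \<subseteq> U \<Longrightarrow> \<pi>' ` e \<in> E0 i \<Longrightarrow> e \<in> E' i" and "\<exists>G\<in>\<G>. \<pi>' ` U \<subseteq> G"
      using hom'[unfolded hom_irr_def, THEN conjunct2, rule_format, OF U(1) irrU] by auto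
    then obtain S FS t where S: "K S FS" "t \<in> Oemb S FS C0 E0" "\<pi>' ` U \<subseteq> t ` S"
      using A(2) B(2) unfolding \<G>_def T_def \<Theta>_def by blast
    have t: "emb S FS C0 E0 t" "strict_mono_on S t" using S(2) by (auto simp: Oemb_def oemb_def)
    define h where "h u = inv_into S t (\<pi>' u)" for u
    have h: "h u \<in> S" "t (h u) = \<pi>' u" if "u \<in> U" for u
      using that S(3) by (auto simp: h_def inv_into_into f_inv_into_f)
    define g where "g = h \<circ> inv_into V' \<rho>"
    have g: "g (\<rho> u) = h u" if "u \<in> U" for u
      using that U(1) inj by (auto simp: g_def subset_iff)
    have mono: "g a < g b" if ab: "a \<in> W" "b \<in> W" "a < b" for a b
    proof -
      obtain u v where uv: "u \<in> U" "v \<in> U" "a = \<rho> u" "b = \<rho> v" using ab U by blast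
      have "v < M" using uv U M by auto
      \<comment> \<open>The code of a vertex orders first by part, and different vertices of
        \<open>U\<close> lie in different parts; so the projection is increasing on
        \<open>W\<close>.\<close>
      then have "\<not> \<pi>' v < \<pi>' u"
        using lex_less[of "\<pi>' v" "\<pi>' u" v M u] uv ab(3) by (auto simp: \<rho>_def)
      moreover have "\<pi>' u \<noteq> \<pi>' v" using injU uv ab(3) by (auto dest: inj_onD)
      ultimately have lt: "t (h u) < t (h v)" using h uv by simp
      have "h u < h v"
      proof (rule ccontr)
        assume "\<not> h u < h v"
        then have "t (h v) \<le> t (h u)"
          using t(2) h(1) uv by (auto simp: strict_mono_on_def not_less le_less)
        then show False using lt by simp
      qed
      then show ?thesis using g uv by simp
    qed
    have "oemb W EC S FS g"
      unfolding oemb_def emb_def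
    proof (intro conjI allI impI)
      show "g \<in> W \<rightarrow> S" using U g h by auto
      show sm: "strict_mono_on W g" using mono by (simp add: strict_mono_on_def)
      then show "inj_on g W" by (rule strict_mono_on_imp_inj_on)
      fix i e assume e: "e \<subseteq> W"
      then obtain d where d: "d \<subseteq> U" "e = \<rho> ` d" using U by (auto simp: subset_image_iff)
      have "g ` e = h ` d" unfolding d image_image using d(1) g by (intro image_cong) auto
      moreover have hd: "h ` d \<subseteq> S" "t ` h ` d = \<pi>' ` d"
        using h d(1) by (auto simp: image_image subset_iff intro!: image_cong)
      ultimately have "g ` e \<in> FS i \<longleftrightarrow> \<pi>' ` d \<in> E0 i"
        using emb_edge[OF t(1) hd(1), of i] by simp
      also have "\<dots> \<longleftrightarrow> d \<in> E' i"
        using refl[OF d(1)] hom_irr_edge[OF hom'] by blast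
      also have "\<dots> \<longleftrightarrow> e \<in> EC i"
        using emb_edge[OF em, of d i] d U by auto
      finally show "g ` e \<in> FS i \<longleftrightarrow> e \<in> EC i" .
    qed
    then show "\<exists>V' E' g. K V' E' \<and> oemb W EC V' E' g" using S(1) by blast
  qed
  ultimately show ?thesis using that sysC by blast
qed

end

section \<open>Unions, duplications and free moves\<close>

type_synonym 'i chart = "nat set \<times> ('i \<Rightarrow> nat set set) \<times> (nat \<Rightarrow> nat)"

definition union_verts :: "'i chart set \<Rightarrow> nat set" where
  "union_verts \<C> = {m x |S FS m x. (S, FS, m) \<in> \<C> \<and> x \<in> S}"

definition union_edges :: "'i chart set \<Rightarrow> 'i \<Rightarrow> nat set set" where
  "union_edges \<C> i = {m ` e |S FS m e. (S, FS, m) \<in> \<C> \<and> e \<in> FS i}"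

lemma oemb_inv:
  assumes "oemb S FS V E m" "W \<subseteq> m ` S"
  shows "oemb W E S FS (inv_into S m)"
proof -
  have inv: "inv_into S m w \<in> S" "m (inv_into S m w) = w" if "w \<in> W" for w
    using assms(2) that by (auto simp: inv_into_into f_inv_into_f)
  have "inv_into S m a < inv_into S m b" if ab: "a \<in> W" "b \<in> W" "a < b" for a b
  proof (rule ccontr)
    assume "\<not> inv_into S m a < inv_into S m b"
    then have "b \<le> a"
      using oemb_mono[OF assms(1), of "inv_into S m b" "inv_into S m a"] inv ab
      by (metis le_less not_less)
    then show False using ab by simp
  qed
  then have mono: "strict_mono_on W (inv_into S m)" by (simp add: strict_mono_on_def)
  have "inv_into S m ` e \<in> FS i \<longleftrightarrow> e \<in> E i" if e: "e \<subseteq> W" for e i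
  proof -
    have "m ` inv_into S m ` e = e"
      using inv e by (force simp: image_image)
    moreover have "inv_into S m ` e \<subseteq> S" using inv e by auto
    ultimately show ?thesis using emb_edge[OF oemb_emb[OF assms(1)], of "inv_into S m ` e" i] by simp
  qed
  then show ?thesis
    using mono inv strict_mono_on_imp_inj_on[OF mono] by (auto simp: oemb_def emb_def)
qed

text \<open>Duplicating the vertex \<open>v\<close>: its two incarnations \<open>2 * v\<close> and \<open>2 * v + 1\<close> are consecutive
  and lie in no common edge.\<close>

definition dup_map :: "nat \<Rightarrow> bool \<Rightarrow> nat \<Rightarrow> nat" where
  "dup_map v c b = 2 * b + (if c \<and> b = v then 1 else 0)"

definition dup_verts :: "nat set \<Rightarrow> nat \<Rightarrow> nat set" where
  "dup_verts V v = dup_map v False ` V \<union> dup_map v True ` V"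

definition dup_edges :: "nat set \<Rightarrow> ('i \<Rightarrow> nat set set) \<Rightarrow> nat \<Rightarrow> 'i \<Rightarrow> nat set set" where
  "dup_edges V E v = union_edges (range (\<lambda>c. (V, E, dup_map v c)))"

lemma dup_map_div [simp]: "dup_map v c b div 2 = b"
  by (simp add: dup_map_def)

lemma dup_verts_iff: "n \<in> dup_verts V v \<longleftrightarrow> n div 2 \<in> V \<and> (odd n \<longrightarrow> n div 2 = v)"
proof
  assume "n \<in> dup_verts V v"
  then obtain c b where b: "n = dup_map v c b" "b \<in> V" by (auto simp: dup_verts_def)
  then show "n div 2 \<in> V \<and> (odd n \<longrightarrow> n div 2 = v)"
    by (simp add: dup_map_def)
next
  assume *: "n div 2 \<in> V \<and> (odd n \<longrightarrow> n div 2 = v)"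
  then have "n = dup_map v (odd n) (n div 2)" by (auto simp: dup_map_def)
  then show "n \<in> dup_verts V v"
    using * unfolding dup_verts_def by (cases "odd n") (metis UnI1 UnI2 imageI)+
qed

lemma dup_map_image_div: "(\<lambda>n. n div 2) ` dup_map v c ` e = e"
  by (simp add: image_image)

text \<open>In other words, the two copies together form \<open>A\<close> with \<open>x\<close>
  duplicated. Only edges within the two images are excluded from joining the two positions of
  \<open>x\<close>: larger structures may well have further edges through both, and the notion has
  to survive embeddings.\<close>

definition free_move :: "nat set \<Rightarrow> ('i \<Rightarrow> nat set set) \<Rightarrow> nat set \<Rightarrow> ('i \<Rightarrow> nat set set) \<Rightarrow>
    nat \<Rightarrow> (nat \<Rightarrow> nat) \<Rightarrow> (nat \<Rightarrow> nat) \<Rightarrow> bool" where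
  "free_move A EA M EM x m m' \<longleftrightarrow> x \<in> A \<and> oemb A EA M EM m \<and> oemb A EA M EM m' \<and>
    (\<forall>a\<in>A. a \<noteq> x \<longrightarrow> m a = m' a) \<and> m x < m' x \<and>
    (\<forall>i. \<forall>e\<in>EM i. e \<subseteq> m ` A \<union> m' ` A \<longrightarrow> m x \<in> e \<longrightarrow> m' x \<notin> e)"

lemma free_move_oemb:
  assumes "free_move A EA M EM x m m'" "oemb M EM N EN h"
  shows "free_move A EA N EN x (h \<circ> m) (h \<circ> m')"
proof -
  have m: "x \<in> A" "oemb A EA M EM m" "oemb A EA M EM m'" "\<forall>a\<in>A. a \<noteq> x \<longrightarrow> m a = m' a" "m x < m' x"
    and free: "\<And>i e. e \<in> EM i \<Longrightarrow> e \<subseteq> m ` A \<union> m' ` A \<Longrightarrow> m x \<in> e \<Longrightarrow> m' x \<notin> e"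
    using assms(1) by (auto simp: free_move_def)
  have in_M: "m a \<in> M" "m' a \<in> M" if "a \<in> A" for a
    using that emb_in[OF oemb_emb[OF m(2)]] emb_in[OF oemb_emb[OF m(3)]] by auto
  have "(h \<circ> m') x \<notin> e" if e: "e \<in> EN i" "e \<subseteq> (h \<circ> m) ` A \<union> (h \<circ> m') ` A" "(h \<circ> m) x \<in> e" for i e
  proof
    assume x': "(h \<circ> m') x \<in> e"
    have "e \<subseteq> h ` (m ` A \<union> m' ` A)" using e(2) by auto
    then obtain d where d: "d \<subseteq> m ` A \<union> m' ` A" "e = h ` d" by (auto simp: subset_image_iff)
    have dM: "d \<subseteq> M" using d(1) in_M by auto
    have "d \<in> EM i" using emb_edge[OF oemb_emb[OF assms(2)] dM] d e by simp
    moreover have "m x \<in> d" "m' x \<in> d"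
      using e(3) x' d(2) inj_on_image_mem_iff[OF emb_inj[OF oemb_emb[OF assms(2)]] _ dM]
        in_M[OF m(1)] by auto
    ultimately show False using free d by blast
  qed
  moreover have "h (m x) < h (m' x)" using oemb_mono[OF assms(2)] in_M m by blast
  ultimately show ?thesis
    using m oemb_comp[OF _ assms(2)] unfolding free_move_def by auto
qed

context forb_class
begin

text \<open>The condition \<open>compat\<close> says that no chart acquires an edge from another
  one; this is exactly what makes each chart an embedding.\<close>

lemma union_chart:
  assumes fin: "finite (union_verts \<C>)"
    and charts: "\<And>S FS m. (S, FS, m) \<in> \<C> \<Longrightarrow> sys S FS \<and> strict_mono_on S m"
    and compat: "\<And>S FS m S' FS' m' s e i. (S, FS, m) \<in> \<C> \<Longrightarrow> (S', FS', m') \<in> \<C> \<Longrightarrow>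
      s \<subseteq> S \<Longrightarrow> e \<in> FS' i \<Longrightarrow> m ` s = m' ` e \<Longrightarrow> s \<in> FS i"
  shows "sys (union_verts \<C>) (union_edges \<C>)"
    and "(S, FS, m) \<in> \<C> \<Longrightarrow> oemb S FS (union_verts \<C>) (union_edges \<C>) m"
proof -
  have inj: "inj_on m S" if "(S, FS, m) \<in> \<C>" for S FS m
    using charts[OF that] strict_mono_on_imp_inj_on by blast
  have "d \<subseteq> union_verts \<C> \<and> ok i (card d)" if d: "d \<in> union_edges \<C> i" for d i
  proof -
    obtain S FS m e where c: "(S, FS, m) \<in> \<C>" "e \<in> FS i" "d = m ` e"
      using d by (auto simp: union_edges_def)
    have e: "e \<subseteq> S" "ok i (card e)" using charts[OF c(1)] c(2) by (auto simp: sys_def)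
    have "card d = card e" using card_image[OF inj_on_subset[OF inj[OF c(1)] e(1)]] c by simp
    moreover have "d \<subseteq> union_verts \<C>" using c e unfolding union_verts_def by blast
    ultimately show ?thesis using e by simp
  qed
  then show "sys (union_verts \<C>) (union_edges \<C>)" using fin by (simp add: sys_def)
  assume c: "(S, FS, m) \<in> \<C>"
  have "m ` s \<in> union_edges \<C> i \<longleftrightarrow> s \<in> FS i" if s: "s \<subseteq> S" for s i
  proof
    assume "m ` s \<in> union_edges \<C> i"
    then obtain S' FS' m' e where e: "(S', FS', m') \<in> \<C>" "e \<in> FS' i" "m ` s = m' ` e"
      by (auto simp: union_edges_def)
    show "s \<in> FS i" by (rule compat[OF c e(1) s e(2,3)])
  qed (use c in \<open>auto simp: union_edges_def\<close>)
  moreover have "m \<in> S \<rightarrow> union_verts \<C>" using c by (force simp: union_verts_def)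
  ultimately show "oemb S FS (union_verts \<C>) (union_edges \<C>) m"
    using inj[OF c] charts[OF c] by (auto simp: oemb_def emb_def)
qed

lemma K_union:
  assumes "sys V E"
    and "\<And>W. W \<subseteq> V \<Longrightarrow> irr E W \<Longrightarrow> \<exists>S FS m. K S FS \<and> oemb S FS V E m \<and> W \<subseteq> m ` S"
  shows "K V E"
proof (rule K_irr[OF assms(1)])
  fix W assume "W \<subseteq> V" "irr E W"
  then show "\<exists>V' E' g. K V' E' \<and> oemb W E V' E' g"
    using assms(2) oemb_inv by metis
qed

lemma finite_dup_verts: "finite V \<Longrightarrow> finite (dup_verts V v)"
  by (simp add: dup_verts_def)

lemma dup_struct:
  assumes "sys V E"
  shows "sys (dup_verts V v) (dup_edges V E v)"
    and "oemb V E (dup_verts V v) (dup_edges V E v) (dup_map v c)"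
proof -
  let ?C = "range (\<lambda>c. (V, E, dup_map v c))"
  have V: "dup_verts V v = union_verts ?C" by (auto simp: dup_verts_def union_verts_def UNIV_bool)
  have "finite V" using assms by (simp add: sys_def)
  have 1: "finite (union_verts ?C)"
    using finite_dup_verts[OF \<open>finite V\<close>, of v] unfolding V .
  have mono: "strict_mono_on V (dup_map v c)" for c
    by (auto simp: strict_mono_on_def dup_map_def)
  have 2: "s \<in> FS i" if a: "(S, FS, m) \<in> ?C" "(S', FS', m') \<in> ?C" "e \<in> FS' i" "m ` s = m' ` e"
    for S FS m S' FS' m' s e i
  proof -
    obtain c c' where "m = dup_map v c" "m' = dup_map v c'" "FS = E" "FS' = E"
      using a(1,2) by auto
    then show ?thesis
      using a(3,4) dup_map_image_div[of v c s] dup_map_image_div[of v c' e] by metis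
  qed
  show "sys (dup_verts V v) (dup_edges V E v)"
    unfolding V dup_edges_def by (rule union_chart(1)[OF 1]) (use assms mono in blast, rule 2)
  show "oemb V E (dup_verts V v) (dup_edges V E v) (dup_map v c)"
    unfolding V dup_edges_def by (rule union_chart(2)[OF 1]) (use assms mono in blast, (rule 2; assumption), blast)
qed

lemma dup_edge_free:
  assumes "e \<in> dup_edges V E v i" "2 * v \<in> e"
  shows "2 * v + 1 \<notin> e"
proof
  assume "2 * v + 1 \<in> e"
  moreover obtain c d where "e = dup_map v c ` d"
    using assms(1) by (auto simp: dup_edges_def union_edges_def)
  ultimately show False using assms(2) by (auto simp: dup_map_def split: if_splits) presburger+
qed

text \<open>The two incarnations of \<open>v\<close> share no edge, so an irreducible set misses one
  of them and lies in one of the two copies of the original structure.\<close>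

lemma dup_K:
  assumes "sys V E" "K V E"
  shows "K (dup_verts V v) (dup_edges V E v)"
proof (rule K_union[OF dup_struct(1)[OF assms(1)]])
  fix W assume W: "W \<subseteq> dup_verts V v" "irr (dup_edges V E v) W"
  have "2 * v \<notin> W \<or> 2 * v + 1 \<notin> W"
  proof (rule ccontr)
    assume "\<not> ?thesis"
    then obtain i e where e: "e \<in> dup_edges V E v i" "2 * v \<in> e" "2 * v + 1 \<in> e"
      using W(2) unfolding irr_def by (metis n_not_Suc_n Suc_eq_plus1)
    show False using dup_edge_free[OF e(1,2)] e(3) by blast
  qed
  moreover have "n = dup_map v False (n div 2)" if "n \<in> W" "2 * v + 1 \<notin> W" for n
  proof -
    have "even n"
    proof (rule ccontr)
      assume "odd n"
      then have "n = 2 * v + 1"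
        using that(1) W(1) odd_two_times_div_two_succ[of n] dup_verts_iff[of n V v] by auto
      then show False using that by simp
    qed
    then show ?thesis by (simp add: dup_map_def)
  qed
  moreover have "n = dup_map v True (n div 2)" if "n \<in> W" "2 * v \<notin> W" for n
  proof (cases "even n")
    case True
    then have "n div 2 \<noteq> v" using that by auto
    then show ?thesis using True by (simp add: dup_map_def)
  next
    case False
    then have "n div 2 = v" using that W(1) by (auto simp: dup_verts_iff)
    then show ?thesis using odd_two_times_div_two_succ[OF False] by (simp add: dup_map_def)
  qed
  moreover have "n div 2 \<in> V" if "n \<in> W" for n using that W(1) by (auto simp: dup_verts_iff)
  ultimately have "\<exists>c. W \<subseteq> dup_map v c ` V" by blast
  then show "\<exists>S FS m. K S FS \<and> oemb S FS (dup_verts V v) (dup_edges V E v) m \<and> W \<subseteq> m ` S"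
    using assms dup_struct(2)[OF assms(1)] by blast
qed

lemma free_move_dup:
  assumes A: "sys A EA" and mv: "free_move A EA M EM x m m'"
  obtains d where "oemb (dup_verts A x) (dup_edges A EA x) M EM d"
    "\<And>a. a \<in> A \<Longrightarrow> d (dup_map x False a) = m a" "\<And>a. a \<in> A \<Longrightarrow> d (dup_map x True a) = m' a"
proof -
  have m: "x \<in> A" "oemb A EA M EM m" "oemb A EA M EM m'" "\<And>a. a \<in> A \<Longrightarrow> a \<noteq> x \<Longrightarrow> m a = m' a"
      "m x < m' x"
    and free: "\<And>i e. e \<in> EM i \<Longrightarrow> e \<subseteq> m ` A \<union> m' ` A \<Longrightarrow> m x \<in> e \<Longrightarrow> m' x \<notin> e"
    using mv by (auto simp: free_move_def)
  \<comment> \<open>The only odd vertex is \<open>2 * x + 1\<close>, the upper incarnation of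
    \<open>x\<close>.\<close>
  define d where "d n = (if odd n then m' x else m (n div 2))" for n
  have d0: "d (dup_map x False a) = m a" for a by (simp add: d_def dup_map_def)
  have d1: "d (dup_map x True a) = m' a" if "a \<in> A" for a
    using that m(4) by (auto simp: d_def dup_map_def)
  have split: "n \<in> dup_map x False ` A \<or> n = 2 * x + 1" if "n \<in> dup_verts A x" for n
    using that unfolding dup_verts_iff dup_map_def by (cases "even n") (auto elim!: evenE oddE)
  have d2: "d (2 * x + 1) = m' x" by (simp add: d_def)
  have inM: "m a \<in> M" "m' a \<in> M" if "a \<in> A" for a
    using that emb_in[OF oemb_emb[OF m(2)]] emb_in[OF oemb_emb[OF m(3)]] by auto
  have into: "d \<in> dup_verts A x \<rightarrow> M"
    using split inM m(1) d0 d2 by fastforce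
  have mono: "d n < d n'" if n: "n \<in> dup_verts A x" "n' \<in> dup_verts A x" "n < n'" for n n'
  proof -
    have *: "n div 2 \<in> A" "n' div 2 \<in> A" "odd n \<Longrightarrow> n div 2 = x" "odd n' \<Longrightarrow> n' div 2 = x"
      using n by (auto simp: dup_verts_iff)
    show ?thesis
    proof (cases "n div 2 = n' div 2")
      case True
      then have "even n" "odd n'" using n(3) by presburger+
      then show ?thesis using m(5) * True by (simp add: d_def)
    next
      case False
      then have lt: "n div 2 < n' div 2" using n(3) by linarith
      have mm: "m (n div 2) < m (n' div 2)" "m' (n div 2) < m' (n' div 2)"
        using oemb_mono[OF m(2) *(1,2) lt] oemb_mono[OF m(3) *(1,2) lt] .
      show ?thesis
      proof (cases "odd n")
        case True
        then have "d n = m' (n div 2)" "n' div 2 \<noteq> x" using * False by (auto simp: d_def)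
        moreover from this have "d n' = m' (n' div 2)" using * m(4) by (auto simp: d_def)
        ultimately show ?thesis using mm by simp
      next
        case even: False
        show ?thesis
        proof (cases "odd n'")
          case True
          then have "m (n' div 2) < d n'" using * m(5) by (simp add: d_def)
          then show ?thesis using mm even by (simp add: d_def)
        qed (use mm even in \<open>simp add: d_def\<close>)
      qed
    qed
  qed
  then have sm: "strict_mono_on (dup_verts A x) d" by (simp add: strict_mono_on_def)
  have "d ` e \<in> EM i \<longleftrightarrow> e \<in> dup_edges A EA x i" if e: "e \<subseteq> dup_verts A x" for e i
  proof (cases "2 * x \<in> e \<and> 2 * x + 1 \<in> e")
    case True
    have "d ` e \<subseteq> m ` A \<union> m' ` A"
    proof
      fix y assume "y \<in> d ` e"
      then obtain n where "n \<in> e" "y = d n" by blast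
      then show "y \<in> m ` A \<union> m' ` A" using split[of n] e d0 d2 m(1) by auto
    qed
    moreover have "m x \<in> d ` e" "m' x \<in> d ` e"
      using True imageI[of "2 * x" e d] imageI[of "2 * x + 1" e d] by (simp_all add: d_def)
    ultimately have "d ` e \<notin> EM i" using free by blast
    moreover have "e \<notin> dup_edges A EA x i" using True dup_edge_free[of e A EA x i] by blast
    ultimately show ?thesis by simp
  next
    case False
    have "\<exists>c s. s \<subseteq> A \<and> e = dup_map x c ` s"
    proof (cases "2 * x + 1 \<in> e")
      case True
      have "n \<in> dup_map x True ` A" if n: "n \<in> e" for n
      proof -
        have "n \<noteq> 2 * x" using False True n by blast
        then have "n \<in> dup_map x False ` (A - {x}) \<or> n = dup_map x True x"
          using split[of n] n e by (auto simp: dup_map_def)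
        then show ?thesis using m(1) by (auto simp: dup_map_def)
      qed
      then have "e \<subseteq> dup_map x True ` A" by blast
      then show ?thesis by (auto simp: subset_image_iff)
    next
      case False
      then have "e \<subseteq> dup_map x False ` A" using split e by blast
      then show ?thesis by (auto simp: subset_image_iff)
    qed
    then obtain c s where s: "s \<subseteq> A" "e = dup_map x c ` s" by blast
    have "e \<in> dup_edges A EA x i \<longleftrightarrow> s \<in> EA i"
      using emb_edge[OF oemb_emb[OF dup_struct(2)[OF A]] s(1)] s(2) by simp
    moreover have "d ` e \<in> EM i \<longleftrightarrow> s \<in> EA i"
    proof (cases c)
      case True
      have "d ` e = m' ` s" unfolding s image_image using s(1) d1 True by (intro image_cong) auto
      then show ?thesis using emb_edge[OF oemb_emb[OF m(3)] s(1)] by simp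
    next
      case False
      have "d ` e = m ` s" unfolding s image_image using s(1) d0 False by (intro image_cong) auto
      then show ?thesis using emb_edge[OF oemb_emb[OF m(2)] s(1)] by simp
    qed
    ultimately show ?thesis by simp
  qed
  then have "oemb (dup_verts A x) (dup_edges A EA x) M EM d"
    using into sm strict_mono_on_imp_inj_on[OF sm] by (simp add: oemb_def emb_def)
  then show ?thesis using that d0 d1 by blast
qed

text \<open>Any vertex of a copy of \<open>A\<close> in \<open>B\<close> can be moved freely after
  duplicating its image in \<open>B\<close>. This produces the moves by which colours of different
  copies are compared.\<close>

lemma free_move_flip:
  assumes B: "sys B EB" and f: "oemb A EA B EB f" and x: "x \<in> A"
  shows "free_move A EA (dup_verts B (f x)) (dup_edges B EB (f x)) x
    (dup_map (f x) False \<circ> f) (dup_map (f x) True \<circ> f)"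
proof -
  have "f a \<noteq> f x" if "a \<in> A" "a \<noteq> x" for a
    using that x inj_onD[OF emb_inj[OF oemb_emb[OF f]]] by blast
  then show ?thesis
    using x oemb_comp[OF f dup_struct(2)[OF B]] dup_edge_free[of _ B EB "f x"]
    unfolding free_move_def by (auto simp: dup_map_def)
qed

lemma disjoint_union:
  fixes \<S> :: "(nat set \<times> ('i \<Rightarrow> nat set set)) set"
  assumes fin: "finite \<S>" and ne: "\<S> \<noteq> {}" and \<S>: "\<And>S FS. (S, FS) \<in> \<S> \<Longrightarrow> sys S FS \<and> K S FS"
  obtains V E where "sys V E" "K V E" "\<And>S FS. (S, FS) \<in> \<S> \<Longrightarrow> \<exists>h. oemb S FS V E h"
proof -
  obtain h where h: "bij_betw h \<S> {0..<card \<S>}" using ex_bij_betw_finite_nat[OF fin] by blast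
  define n where "n = card \<S>"
  \<comment> \<open>The components are interleaved: the residue modulo \<open>n\<close> tells the
    component, the quotient the vertex.\<close>
  define m where "m c x = n * x + h c" for c x
  have hn: "h c < n" if "c \<in> \<S>" for c using h that by (auto simp: bij_betw_def n_def)
  have mn: "m c x mod n = h c" "m c x div n = x" if "c \<in> \<S>" for c x using hn[OF that] by (auto simp: m_def)
  define \<C> where "\<C> = (\<lambda>(S, FS). (S, FS, m (S, FS))) ` \<S>"
  have \<C>: "(S, FS, k) \<in> \<C> \<longleftrightarrow> (S, FS) \<in> \<S> \<and> k = m (S, FS)" for S FS k by (auto simp: \<C>_def)
  have finU: "finite (union_verts \<C>)"
  proof (rule finite_subset)
    show "union_verts \<C> \<subseteq> (\<Union>c\<in>\<S>. m c ` fst c)"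
      by (force simp: union_verts_def \<C>)
    show "finite (\<Union>c\<in>\<S>. m c ` fst c)"
      using fin \<S> by (fastforce simp: sys_def)
  qed
  have charts: "sys S FS \<and> strict_mono_on S k" if "(S, FS, k) \<in> \<C>" for S FS k
  proof -
    have "(S, FS) \<in> \<S>" "k = m (S, FS)" using that \<C> by auto
    moreover from this have "0 < n" using hn by fastforce
    ultimately show ?thesis using \<S> by (simp add: strict_mono_on_def m_def)
  qed
  have same: "c = c'" if "c \<in> \<S>" "c' \<in> \<S>" "m c x = m c' y" for c c' x y
    using mn(1)[OF that(1), of x] mn(1)[OF that(2), of y] that h
    by (auto simp: bij_betw_def inj_on_def)
  have compat: "s \<in> FS i" if a: "(S, FS, k) \<in> \<C>" "(S', FS', k') \<in> \<C>" "s \<subseteq> S" "e \<in> FS' i" "k ` s = k' ` e"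
    for S FS k S' FS' k' s e i
  proof -
    have c: "(S, FS) \<in> \<S>" "(S', FS') \<in> \<S>" "k = m (S, FS)" "k' = m (S', FS')" using a \<C> by auto
    \<comment> \<open>An edge is nonempty, and any of its vertices reveals the component.\<close>
    obtain y where "y \<in> e" using sys_nonempty \<S>[OF c(2)] a(4) by blast
    then obtain x where "k x = k' y" using a(5) by (metis imageE imageI)
    then have eq: "(S, FS) = (S', FS')" using same c by blast
    then have "k = k'" using c by simp
    have "(\<lambda>z. z div n) ` k ` t = t" for t using mn(2)[OF c(1)] c(3) by (simp add: image_image)
    then have "s = e" using a(5) \<open>k = k'\<close> by metis
    then show ?thesis using a(4) eq by simp
  qed
  have U1: "sys (union_verts \<C>) (union_edges \<C>)"
    by (rule union_chart(1)[OF finU]) (erule charts, rule compat)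
  have U2: "oemb S FS (union_verts \<C>) (union_edges \<C>) k" if "(S, FS, k) \<in> \<C>" for S FS k
    by (rule union_chart(2)[OF finU _ _ that]) (erule charts, rule compat)
  show ?thesis
  proof (rule that[OF U1])
    show "\<exists>h. oemb S FS (union_verts \<C>) (union_edges \<C>) h" if "(S, FS) \<in> \<S>" for S FS
      using U2[of S FS "m (S, FS)"] \<C> that by blast
    show "K (union_verts \<C>) (union_edges \<C>)"
    proof (rule K_union[OF U1])
      fix W assume W: "W \<subseteq> union_verts \<C>" "irr (union_edges \<C>) W"
      have "\<exists>S FS k. (S, FS, k) \<in> \<C> \<and> W \<subseteq> k ` S"
      proof (cases "W = {}")
        case True
        then show ?thesis using ne \<C> by fastforce
      next
        case False
        then obtain a where a: "a \<in> W" by blast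
        then obtain S FS k where c: "(S, FS, k) \<in> \<C>" "a \<in> k ` S"
          using W(1) by (auto simp: union_verts_def)
        have "b \<in> k ` S" if b: "b \<in> W" for b
        proof (cases "b = a")
          case False
          then obtain i e where e: "e \<in> union_edges \<C> i" "a \<in> e" "b \<in> e"
            using W(2) a b unfolding irr_def by blast
          then obtain S' FS' k' d where c': "(S', FS', k') \<in> \<C>" "d \<in> FS' i" "e = k' ` d"
            by (auto simp: union_edges_def)
          then have d: "d \<subseteq> S'" using charts sysD by blast
          obtain x y where "k x = k' y" using c(2) e(2) c'(3) by blast
          then have "(S, FS) = (S', FS')"
            using same[of "(S, FS)" "(S', FS')" x y] c(1) c'(1) by (simp add: \<C>)
          then have "k = k'" "S = S'" using c(1) c'(1) \<C> by auto
          then show ?thesis using e(3) c'(3) d by blast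
        qed (use c in simp)
        then show ?thesis using c by blast
      qed
      then show "\<exists>S FS k. K S FS \<and> oemb S FS (union_verts \<C>) (union_edges \<C>) k \<and> W \<subseteq> k ` S"
        using U2 \<C> \<S> by blast
    qed
  qed
qed

text \<open>The Ramsey theorem is iterated over the finitely many structures \<open>S x\<close>,
  each with its own colouring. Homogeneity for \<open>y\<close> holds on all of \<open>C\<close> and
  so persists on the copy of \<open>B\<close> chosen inside it.\<close>

lemma ramsey_multi:
  fixes S :: "'x \<Rightarrow> nat set" and FS :: "'x \<Rightarrow> 'i \<Rightarrow> nat set set"
  assumes "finite Ix" "\<And>x. x \<in> Ix \<Longrightarrow> sys (S x) (FS x) \<and> K (S x) (FS x)"
    and B: "sys B EB" "K B EB" and k: "0 < k"
  shows "\<exists>C EC. sys C EC \<and> K C EC \<and> (\<forall>\<chi>::'x \<Rightarrow> (nat \<Rightarrow> nat) \<Rightarrow> nat. (\<forall>x f. \<chi> x f < k) \<longrightarrow>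
    (\<exists>w. oemb B EB C EC w \<and> (\<forall>x\<in>Ix. \<forall>f\<in>Oemb (S x) (FS x) B EB. \<forall>g\<in>Oemb (S x) (FS x) B EB.
      \<chi> x (compose (S x) w f) = \<chi> x (compose (S x) w g))))"
  using assms(1,2)
proof (induction Ix rule: finite_induct)
  case empty
  have "oemb B EB B EB (\<lambda>x. x)" by (simp add: oemb_def emb_def strict_mono_on_def)
  then show ?case using B by blast
next
  case (insert y Ix)
  from insert.IH insert.prems obtain C EC where C: "sys C EC" "K C EC"
    and arr: "\<forall>\<chi>::'x \<Rightarrow> (nat \<Rightarrow> nat) \<Rightarrow> nat. (\<forall>x f. \<chi> x f < k) \<longrightarrow>
    (\<exists>w. oemb B EB C EC w \<and> (\<forall>x\<in>Ix. \<forall>f\<in>Oemb (S x) (FS x) B EB. \<forall>g\<in>Oemb (S x) (FS x) B EB.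
      \<chi> x (compose (S x) w f) = \<chi> x (compose (S x) w g)))"
    by auto
  have y: "sys (S y) (FS y)" "K (S y) (FS y)" using insert.prems by auto
  obtain D ED where D: "sys D ED" "K D ED" and arrD: "arrows k (S y) (FS y) C EC D ED"
    by (rule ramsey_forb[OF y C k]) (rule that)
  have "\<exists>w. oemb B EB D ED w \<and> (\<forall>x\<in>insert y Ix. \<forall>f\<in>Oemb (S x) (FS x) B EB. \<forall>g\<in>Oemb (S x) (FS x) B EB.
      \<chi> x (compose (S x) w f) = \<chi> x (compose (S x) w g))"
    if \<chi>: "\<forall>x f. \<chi> x f < k" for \<chi> :: "'x \<Rightarrow> (nat \<Rightarrow> nat) \<Rightarrow> nat"
  proof -
    obtain u where u: "oemb C EC D ED u" "\<And>f g. f \<in> Oemb (S y) (FS y) C EC \<Longrightarrow>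
        g \<in> Oemb (S y) (FS y) C EC \<Longrightarrow> \<chi> y (compose (S y) u f) = \<chi> y (compose (S y) u g)"
      using arrD[unfolded arrows_def, rule_format, of "\<chi> y"] \<chi> by blast
    obtain w where w: "oemb B EB C EC w"
      "\<forall>x\<in>Ix. \<forall>f\<in>Oemb (S x) (FS x) B EB. \<forall>g\<in>Oemb (S x) (FS x) B EB.
        \<chi> x (compose (S x) u (compose (S x) w f)) = \<chi> x (compose (S x) u (compose (S x) w g))"
      using arr[rule_format, of "\<lambda>x f. \<chi> x (compose (S x) u f)"] \<chi> by blast
    have c: "compose X (u \<circ> w) f = compose X u (compose X w f)" for X f
      by (auto simp: compose_def fun_eq_iff)
    have "\<chi> x (compose (S x) (u \<circ> w) f) = \<chi> x (compose (S x) (u \<circ> w) g)"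
      if x: "x \<in> insert y Ix" and fg: "f \<in> Oemb (S x) (FS x) B EB" "g \<in> Oemb (S x) (FS x) B EB" for x f g
    proof (cases "x = y")
      case True
      then show ?thesis
        unfolding c using u(2) compose_in_Oemb[OF OembD w(1)] fg by blast
    next
      case False
      then show ?thesis unfolding c using w(2) x fg by blast
    qed
    then show ?thesis using oemb_comp[OF w(1) u(1)] by blast
  qed
  then show ?case using D by blast
qed

end

section \<open>Connecting two copies by free moves\<close>

definition vx :: "nat \<Rightarrow> nat \<Rightarrow> nat" where
  "vx b k = 4 * b + k"

lemma vx_eq_iff: "k < 4 \<Longrightarrow> k' < 4 \<Longrightarrow> vx b k = vx b' k' \<longleftrightarrow> b = b' \<and> k = k'"
  unfolding vx_def by presburger

lemma vx_less_iff: "k < 4 \<Longrightarrow> k' < 4 \<Longrightarrow> vx b k < vx b' k' \<longleftrightarrow> b < b' \<or> b = b' \<and> k < k'"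
  unfolding vx_def by presburger

text \<open>The structure that connects two copies \<open>f\<close> and \<open>g\<close> of \<open>A\<close> in \<open>B\<close> agreeing on \<open>Q\<close> by a
  path of free moves of vertices outside \<open>Q\<close>. It consists of \<open>B\<close> (at level 0) and of three further
  copies of \<open>A\<close> over \<open>Q\<close>: \<open>p1\<close> just above \<open>f\<close>, \<open>p3\<close> just above \<open>g\<close>, and \<open>p2\<close> above both. Consecutive
  copies \<open>(l, u)\<close> are joined by the maps that follow \<open>l\<close> below a threshold and \<open>u\<close> from it on;
  the detour through \<open>p1\<close> and \<open>p3\<close> keeps irreducible sets from meeting \<open>f\<close>, \<open>p2\<close> and \<open>g\<close> at once.\<close>

locale connection = forb_class ok K for ok :: "'i \<Rightarrow> nat \<Rightarrow> bool" and K +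
  fixes A B :: "nat set" and EA EB :: "'i \<Rightarrow> nat set set" and f g :: "nat \<Rightarrow> nat" and Q :: "nat set"
  assumes A: "sys A EA" "K A EA" and B: "sys B EB" "K B EB"
    and f: "oemb A EA B EB f" and g: "oemb A EA B EB g"
    and agree: "\<And>x. x \<in> Q \<Longrightarrow> f x = g x" and QA: "Q \<subseteq> A"
begin

definition p0 :: "nat \<Rightarrow> nat" where "p0 x = vx (f x) 0"
definition p1 :: "nat \<Rightarrow> nat" where "p1 x = (if x \<in> Q then vx (f x) 0 else vx (f x) 1)"
definition p2 :: "nat \<Rightarrow> nat" where "p2 x = (if x \<in> Q then vx (f x) 0 else vx (max (f x) (g x)) 3)"
definition p3 :: "nat \<Rightarrow> nat" where "p3 x = (if x \<in> Q then vx (f x) 0 else vx (g x) 2)"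
definition p4 :: "nat \<Rightarrow> nat" where "p4 x = vx (g x) 0"

lemmas p_defs = p0_def p1_def p2_def p3_def p4_def

text \<open>In each pair the second map is the larger one. The path from \<open>p0\<close> to
  \<open>p4\<close> climbs through the first two pairs to \<open>p2\<close> and descends through the
  other two.\<close>

definition LU :: "((nat \<Rightarrow> nat) \<times> (nat \<Rightarrow> nat)) set" where
  "LU = {(p0, p1), (p1, p2), (p3, p2), (p4, p3)}"

definition mix :: "(nat \<Rightarrow> nat) \<Rightarrow> (nat \<Rightarrow> nat) \<Rightarrow> nat \<Rightarrow> nat \<Rightarrow> nat" where
  "mix l u t x = (if x < t then l x else u x)"

definition mixes :: "(nat \<Rightarrow> nat) set" where
  "mixes = {mix l u t |l u t. (l, u) \<in> LU}"

definition charts :: "'i chart set" where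
  "charts = insert (B, EB, \<lambda>b. vx b 0) {(A, EA, m) |m. m \<in> mixes}"

abbreviation "NV \<equiv> union_verts charts"
abbreviation "NE \<equiv> union_edges charts"

lemma f_less: "x \<in> A \<Longrightarrow> y \<in> A \<Longrightarrow> x < y \<Longrightarrow> f x < f y"
  and g_less: "x \<in> A \<Longrightarrow> y \<in> A \<Longrightarrow> x < y \<Longrightarrow> g x < g y"
  using oemb_mono[OF f] oemb_mono[OF g] by auto

lemma f_eq: "x \<in> A \<Longrightarrow> y \<in> A \<Longrightarrow> f x = f y \<longleftrightarrow> x = y"
  and g_eq: "x \<in> A \<Longrightarrow> y \<in> A \<Longrightarrow> g x = g y \<longleftrightarrow> x = y"
  using inj_on_eq_iff[OF emb_inj[OF oemb_emb[OF f]]] inj_on_eq_iff[OF emb_inj[OF oemb_emb[OF g]]]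
  by auto

lemma max_less:
  "x \<in> A \<Longrightarrow> y \<in> A \<Longrightarrow> x < y \<Longrightarrow> max (f x) (g x) < max (f y) (g y)"
  using f_less[of x y] g_less[of x y] by (auto simp: less_max_iff_disj)

lemma max_eq: "x \<in> A \<Longrightarrow> y \<in> A \<Longrightarrow> max (f x) (g x) = max (f y) (g y) \<longleftrightarrow> x = y"
  using max_less[of x y] max_less[of y x] by (metis nat_neq_iff)

lemma f_in: "x \<in> A \<Longrightarrow> f x \<in> B" and g_in: "x \<in> A \<Longrightarrow> g x \<in> B"
  using emb_in[OF oemb_emb[OF f]] emb_in[OF oemb_emb[OF g]] by auto

lemma LU_mono:
  assumes "(l, u) \<in> LU"
  shows "strict_mono_on A l" "strict_mono_on A u"
proof -
  have "strict_mono_on A p0" "strict_mono_on A p4"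
    using f_less g_less by (auto simp: strict_mono_on_def p_defs vx_less_iff)
  moreover have "strict_mono_on A p1"
    using f_less by (auto simp: strict_mono_on_def p_defs vx_less_iff)
  moreover have "strict_mono_on A p3"
    using f_less g_less agree by (auto simp: strict_mono_on_def p_defs vx_less_iff)
  moreover have "strict_mono_on A p2"
    unfolding strict_mono_on_def
  proof (intro allI impI)
    fix r s assume "r \<in> A \<and> s \<in> A \<and> r < s"
    then show "p2 r < p2 s"
      using f_less[of r s] g_less[of r s] max_less[of r s] agree[of r] agree[of s]
      by (auto simp: p_defs vx_less_iff less_max_iff_disj)
  qed
  ultimately show "strict_mono_on A l" "strict_mono_on A u"
    using assms by (auto simp: LU_def)
qed

lemma LU_le:
  assumes "(l, u) \<in> LU"
  shows "x \<in> Q \<Longrightarrow> l x = u x" "x \<notin> Q \<Longrightarrow> l x < u x"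
  using assms agree by (auto simp: LU_def p_defs vx_less_iff vx_eq_iff less_max_iff_disj)

text \<open>Switching from the smaller to the larger map at the threshold can only widen the gap
  there.\<close>

lemma mix_mono:
  assumes "(l, u) \<in> LU"
  shows "strict_mono_on A (mix l u t)"
proof -
  have "l x \<le> u x" for x using LU_le[OF assms, of x] by (cases "x \<in> Q") auto
  then have "l x < u y" if "x \<in> A" "y \<in> A" "x < y" for x y
    using LU_mono(1)[OF assms] that by (meson strict_mono_onD order_less_le_trans)
  then show ?thesis
    using LU_mono[OF assms] by (auto simp: strict_mono_on_def mix_def)
qed

lemma mixes_mono: "m \<in> mixes \<Longrightarrow> strict_mono_on A m"
  using mix_mono by (auto simp: mixes_def)

section \<open>Agreement of the charts on edges\<close>

definition lev :: "nat \<Rightarrow> nat" where "lev n = n mod 4"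

lemma lev_vx [simp]: "k < 4 \<Longrightarrow> lev (vx b k) = k"
  by (simp add: lev_def vx_def)

text \<open>Recovers the vertex of \<open>A\<close> that a point stands for. Level 0 is ambiguous,
  since the images of \<open>f\<close> and of \<open>g\<close> both lie there; the parameter
  \<open>h\<close> says by which of them it is read.\<close>

definition lab :: "(nat \<Rightarrow> nat) \<Rightarrow> nat \<Rightarrow> nat" where
  "lab h n = (if lev n = 0 then inv_into A h (n div 4) else if lev n = 1 then inv_into A f (n div 4)
     else if lev n = 2 then inv_into A g (n div 4) else inv_into A (\<lambda>x. max (f x) (g x)) (n div 4))"

lemma vx_div [simp]: "k < 4 \<Longrightarrow> vx b k div 4 = b"
  by (simp add: vx_def)

lemma inv_f: "x \<in> A \<Longrightarrow> inv_into A f (f x) = x"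
  and inv_g: "x \<in> A \<Longrightarrow> inv_into A g (g x) = x"
  and inv_max: "x \<in> A \<Longrightarrow> inv_into A (\<lambda>x. max (f x) (g x)) (max (f x) (g x)) = x"
proof -
  have "inj_on f A" "inj_on g A" "inj_on (\<lambda>x. max (f x) (g x)) A"
    using f_eq g_eq max_eq by (auto simp: inj_on_def)
  then show "x \<in> A \<Longrightarrow> inv_into A f (f x) = x" "x \<in> A \<Longrightarrow> inv_into A g (g x) = x"
    "x \<in> A \<Longrightarrow> inv_into A (\<lambda>x. max (f x) (g x)) (max (f x) (g x)) = x"
    using inv_into_f_f[of "\<lambda>x. max (f x) (g x)" A x] by auto
qed

lemma lab_f: "x \<in> A \<Longrightarrow> p \<in> {p0, p1, p2, p3} \<Longrightarrow> lab f (p x) = x"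
  using inv_f inv_g inv_max by (cases "x \<in> Q") (auto simp: lab_def p_defs)

lemma lab_g: "x \<in> A \<Longrightarrow> p \<in> {p1, p2, p3, p4} \<Longrightarrow> lab g (p x) = x"
  using inv_f inv_g inv_max agree by (cases "x \<in> Q") (auto simp: lab_def p_defs)

definition compatible :: "(nat \<Rightarrow> nat) \<Rightarrow> (nat \<Rightarrow> nat) \<Rightarrow> bool" where
  "compatible h m \<longleftrightarrow> (\<forall>x\<in>A. lab h (m x) = x \<and> (lev (m x) = 0 \<longrightarrow> m x = vx (h x) 0))"

text \<open>Only \<open>p0\<close> and \<open>p4\<close> have points of level 0 outside
  \<open>Q\<close>. A mix involving neither uses level 0 only on \<open>Q\<close>, where
  \<open>f\<close> and \<open>g\<close> agree, and can be read both ways. A mix of \<open>p0\<close>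
  and \<open>p1\<close> is read by \<open>f\<close>, one of \<open>p4\<close> and \<open>p3\<close>
  by \<open>g\<close>.\<close>

lemma mixes_cases:
  assumes "m \<in> mixes"
  shows "compatible f m \<and> compatible g m \<or> compatible f m \<and> (\<forall>x\<in>A. lev (m x) \<in> {0, 1})
    \<or> compatible g m \<and> (\<forall>x\<in>A. lev (m x) \<in> {0, 2})"
proof -
  obtain l u t where lu: "m = mix l u t" "(l, u) \<in> LU" using assms by (auto simp: mixes_def)
  consider "l = p0" "u = p1" | "l = p1" "u = p2" | "l = p3" "u = p2" | "l = p4" "u = p3"
    using lu(2) by (auto simp: LU_def)
  then show ?thesis
  proof cases
    case 1
    then have "compatible f m" using lab_f by (auto simp: compatible_def lu mix_def) (auto simp: p_defs)
    moreover have "\<forall>x\<in>A. lev (m x) \<in> {0, 1}" using 1 by (auto simp: lu mix_def p_defs)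
    ultimately show ?thesis by blast
  next
    case 2
    then have "compatible f m \<and> compatible g m"
      using lab_f lab_g agree by (auto simp: compatible_def lu mix_def) (auto simp: p_defs split: if_splits)
    then show ?thesis by blast
  next
    case 3
    then have "compatible f m \<and> compatible g m"
      using lab_f lab_g agree by (auto simp: compatible_def lu mix_def) (auto simp: p_defs split: if_splits)
    then show ?thesis by blast
  next
    case 4
    then have "compatible g m"
      using lab_g agree by (auto simp: compatible_def lu mix_def) (auto simp: p_defs split: if_splits)
    moreover have "\<forall>x\<in>A. lev (m x) \<in> {0, 2}" using 4 by (auto simp: lu mix_def p_defs)
    ultimately show ?thesis by blast
  qed
qed

lemma compatible_eq:
  assumes "compatible h m" "compatible h m'" "s \<subseteq> A" "e \<subseteq> A" "m ` s = m' ` e"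
  shows "s = e"
proof -
  have "lab h ` m ` s = (\<lambda>x. x) ` s"
    unfolding image_image using assms(1,3) by (intro image_cong) (auto simp: compatible_def)
  moreover have "lab h ` m' ` e = (\<lambda>x. x) ` e"
    unfolding image_image using assms(2,4) by (intro image_cong) (auto simp: compatible_def)
  ultimately show ?thesis using assms(5) by simp
qed

lemma level0_edge:
  assumes "m \<in> mixes" "s \<subseteq> A" "m ` s = (\<lambda>b. vx b 0) ` e"
  shows "e \<in> EB i \<longleftrightarrow> s \<in> EA i"
proof -
  have "compatible f m \<or> compatible g m" using mixes_cases[OF assms(1)] by blast
  then obtain h where h: "compatible h m" "h = f \<or> h = g" by blast
  have "m x = vx (h x) 0" if "x \<in> s" for x
  proof -
    have "m x \<in> (\<lambda>b. vx b 0) ` e" using that assms(3) by blast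
    then have "lev (m x) = 0" by auto
    then show ?thesis using h that assms(2) by (auto simp: compatible_def)
  qed
  then have "m ` s = (\<lambda>b. vx b 0) ` h ` s" by (force simp: image_image)
  then have "(\<lambda>n. n div 4) ` (\<lambda>b. vx b 0) ` e = (\<lambda>n. n div 4) ` (\<lambda>b. vx b 0) ` h ` s"
    using assms(3) by simp
  then have "e = h ` s" by (simp add: image_image)
  then show ?thesis
    using h(2) emb_edge[OF oemb_emb[OF f] assms(2)] emb_edge[OF oemb_emb[OF g] assms(2)] by auto
qed

lemma charts_ok: "(S, FS, m) \<in> charts \<Longrightarrow> sys S FS \<and> strict_mono_on S m"
  using A B mixes_mono by (auto simp: charts_def strict_mono_on_def vx_less_iff)

text \<open>Mixes readable in the same way pull a common image back to the same subset of
  \<open>A\<close>. Otherwise one joins \<open>p0\<close> to \<open>p1\<close> and the other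
  \<open>p4\<close> to \<open>p3\<close>; what they share lies at level 0, where both can be
  compared with \<open>B\<close>.\<close>

lemma charts_compat:
  assumes c: "(S, FS, m) \<in> charts" "(S', FS', m') \<in> charts" and s: "s \<subseteq> S" and e: "e \<in> FS' i"
    and eq: "m ` s = m' ` e"
  shows "s \<in> FS i"
proof -
  have e': "e \<subseteq> S'" using charts_ok[OF c(2)] e sysD by blast
  consider (BB) "FS = EB" "FS' = EB" "m = (\<lambda>b. vx b 0)" "m' = (\<lambda>b. vx b 0)"
    | (BA) "FS = EB" "FS' = EA" "S' = A" "m = (\<lambda>b. vx b 0)" "m' \<in> mixes"
    | (AB) "FS = EA" "FS' = EB" "S = A" "m' = (\<lambda>b. vx b 0)" "m \<in> mixes"
    | (AA) "FS = EA" "FS' = EA" "S = A" "S' = A" "m \<in> mixes" "m' \<in> mixes"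
  proof -
    have "FS = EB \<and> m = (\<lambda>b. vx b 0) \<or> FS = EA \<and> S = A \<and> m \<in> mixes"
      "FS' = EB \<and> m' = (\<lambda>b. vx b 0) \<or> FS' = EA \<and> S' = A \<and> m' \<in> mixes"
      using c unfolding charts_def by blast+
    then show ?thesis using that by blast
  qed
  then show ?thesis
  proof cases
    case BB
    then have "(\<lambda>n. n div 4) ` (\<lambda>b. vx b 0) ` s = (\<lambda>n. n div 4) ` (\<lambda>b. vx b 0) ` e" using eq by simp
    then show ?thesis using e BB by (simp add: image_image)
  next
    case BA
    then show ?thesis using level0_edge[of m' e s i] e e' eq by simp
  next
    case AB
    then show ?thesis using level0_edge[of m s e i] e s eq by simp
  next
    case AA
    show ?thesis
    proof (cases "\<exists>h. compatible h m \<and> compatible h m'")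
      case True
      then have "s = e" using compatible_eq s e' eq AA by blast
      then show ?thesis using e AA by simp
    next
      case False
      then have lev: "(\<forall>x\<in>A. lev (m x) \<in> {0, 1}) \<and> (\<forall>x\<in>A. lev (m' x) \<in> {0, 2}) \<or>
          (\<forall>x\<in>A. lev (m x) \<in> {0, 2}) \<and> (\<forall>x\<in>A. lev (m' x) \<in> {0, 1})"
        using mixes_cases[OF AA(5)] mixes_cases[OF AA(6)] by blast
      have lev0: "lev z = 0" if "z \<in> m ` s" for z
      proof -
        have "z \<in> m ` A" using that s AA(3) by blast
        moreover have "z \<in> m' ` A" using that e' AA(4) unfolding eq by blast
        ultimately have "lev z \<in> {0, 1} \<and> lev z \<in> {0, 2}" using lev by (metis imageE)
        then show ?thesis by auto
      qed
      have "z \<in> (\<lambda>b. vx b 0) ` (\<lambda>n. n div 4) ` m ` s" if z: "z \<in> m ` s" for z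
      proof -
        have "z = vx (z div 4) 0" using lev0[OF z] by (auto simp: lev_def vx_def)
        then show ?thesis using z by blast
      qed
      moreover have "vx (z div 4) 0 = z" if z: "z \<in> m ` s" for z
        using lev0[OF z] by (auto simp: lev_def vx_def)
      ultimately have *: "m ` s = (\<lambda>b. vx b 0) ` (\<lambda>n. n div 4) ` m ` s" by force
      show ?thesis
        using level0_edge[OF AA(5) _ *] level0_edge[OF AA(6), of e "(\<lambda>n. n div 4) ` m ` s" i] * eq
          s e' e AA by simp
    qed
  qed
qed

section \<open>The connecting structure and its irreducible sets\<close>

lemma p_bound:
  assumes "m \<in> mixes" "x \<in> A"
  shows "\<exists>b\<in>B. \<exists>k<4. m x = vx b k"
proof -
  obtain l u t where lu: "m = mix l u t" "(l, u) \<in> LU" using assms by (auto simp: mixes_def)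
  have "p x \<in> {vx (f x) 0, vx (f x) 1, vx (max (f x) (g x)) 3, vx (g x) 2, vx (g x) 0}"
    if "p \<in> {p0, p1, p2, p3, p4}" for p
    using that by (auto simp: p_defs)
  moreover have "m x = l x \<or> m x = u x" "l \<in> {p0, p1, p2, p3, p4}" "u \<in> {p0, p1, p2, p3, p4}"
    using lu by (auto simp: mix_def LU_def)
  ultimately have "m x \<in> {vx (f x) 0, vx (f x) 1, vx (max (f x) (g x)) 3, vx (g x) 2, vx (g x) 0}"
    by metis
  moreover have "max (f x) (g x) \<in> B" using f_in g_in assms by (simp add: max_def)
  moreover have "(0::nat) < 4" "(1::nat) < 4" "(2::nat) < 4" "(3::nat) < 4" by auto
  ultimately show ?thesis using f_in[OF assms(2)] g_in[OF assms(2)] by blast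
qed

lemma finite_NV: "finite NV"
proof (rule finite_subset)
  show "NV \<subseteq> (\<lambda>(b, k). vx b k) ` (B \<times> {..<4})"
  proof
    fix n assume "n \<in> NV"
    then consider b where "b \<in> B" "n = vx b 0" | m x where "m \<in> mixes" "x \<in> A" "n = m x"
      by (auto simp: union_verts_def charts_def)
    then show "n \<in> (\<lambda>(b, k). vx b k) ` (B \<times> {..<4})"
      using p_bound by cases force+
  qed
  show "finite ((\<lambda>(b, k). vx b k) ` (B \<times> {..<4}))"
    using B(1) by (simp add: sys_def)
qed

lemma sys_N: "sys NV NE"
  by (rule union_chart(1)[OF finite_NV]) (erule charts_ok, (rule charts_compat; assumption))

lemma oemb_N: "(S, FS, m) \<in> charts \<Longrightarrow> oemb S FS NV NE m"
  by (rule union_chart(2)[OF finite_NV]) (erule charts_ok, (rule charts_compat; assumption), assumption)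

lemma oemb_base: "oemb B EB NV NE (\<lambda>b. vx b 0)"
  by (rule oemb_N) (simp add: charts_def)

lemma oemb_mix: "m \<in> mixes \<Longrightarrow> oemb A EA NV NE m"
  by (rule oemb_N) (simp add: charts_def)

text \<open>Labels show that \<open>m\<close> takes the value \<open>u x\<close> at \<open>x\<close>
  and \<open>l y\<close> at \<open>y\<close>. The levels of these values are attained together only
  by a mix of the same pair, so \<open>y\<close> lies below its threshold and \<open>x\<close> does
  not.\<close>

lemma threshold:
  assumes "(l, u) \<in> LU" "m \<in> mixes" "x \<in> A - Q" "y \<in> A - Q" "u x \<in> m ` A" "l y \<in> m ` A"
  shows "y < x"
proof -
  obtain l' u' t where lu: "m = mix l' u' t" "(l', u') \<in> LU" using assms(2) by (auto simp: mixes_def)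
  obtain z z' where z: "z \<in> A" "z' \<in> A" "u x = m z" "l y = m z'"
    using assms(5,6) by blast
  have xy: "x \<in> A" "y \<in> A" "x \<notin> Q" "y \<notin> Q" using assms by auto
  have lev: "lev (p0 v) = 0" "lev (p1 v) = 1" "lev (p2 v) = 3" "lev (p3 v) = 2" "lev (p4 v) = 0"
    if "v \<notin> Q" for v
    using that by (simp_all add: p_defs)
  have lu_cases: "l = p0 \<and> u = p1 \<or> l = p1 \<and> u = p2 \<or> l = p3 \<and> u = p2 \<or> l = p4 \<and> u = p3"
    "l' = p0 \<and> u' = p1 \<or> l' = p1 \<and> u' = p2 \<or> l' = p3 \<and> u' = p2 \<or> l' = p4 \<and> u' = p3"
    using assms(1) lu(2) by (auto simp: LU_def)
  have "\<exists>h. compatible h m \<and> lab h (u x) = x \<and> lab h (l y) = y"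
  proof -
    consider "l = p0" "u = p1" | "l = p4" "u = p3" | "l \<in> {p1, p3}" "u = p2"
      using lu_cases(1) by blast
    then show ?thesis
    proof cases
      case 1
      then have "compatible f m"
        using mixes_cases[OF assms(2)] z(1,3) lev(2)[OF xy(3)] by auto
      moreover have "lab f (u x) = x" "lab f (l y) = y" using lab_f xy 1 by auto
      ultimately show ?thesis by blast
    next
      case 2
      then have "compatible g m"
        using mixes_cases[OF assms(2)] z(1,3) lev(4)[OF xy(3)] by auto
      moreover have "lab g (u x) = x" "lab g (l y) = y" using lab_g xy 2 by auto
      ultimately show ?thesis by blast
    next
      case 3
      then have "lab f (u x) = x" "lab f (l y) = y" "lab g (u x) = x" "lab g (l y) = y"
        using lab_f lab_g xy by auto
      moreover have "compatible f m \<or> compatible g m" using mixes_cases[OF assms(2)] by blast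
      ultimately show ?thesis by blast
    qed
  qed
  then have "z = x" "z' = y" using z by (auto simp: compatible_def)
  then have "lev (u x) = lev (if x < t then l' x else u' x)" "lev (l y) = lev (if y < t then l' y else u' y)"
    using z(3,4) by (auto simp: lu(1) mix_def)
  then show ?thesis
    using lu_cases
    by (elim disjE conjE) (use xy(3,4) in \<open>simp_all add: lev split: if_splits\<close>)
qed

lemma cover_by_mix:
  assumes lu: "(l, u) \<in> LU" and W: "W \<subseteq> l ` A \<union> u ` A"
    and less: "\<And>x y. x \<in> A - Q \<Longrightarrow> y \<in> A - Q \<Longrightarrow> u x \<in> W \<Longrightarrow> l y \<in> W \<Longrightarrow> y < x"
  shows "\<exists>m\<in>mixes. W \<subseteq> m ` A"
proof -
  obtain T where T: "A \<subseteq> {..<T}" using finite_bound[OF A(1)] .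
  \<comment> \<open>The threshold is the first vertex outside \<open>Q\<close> that occurs in its
    upper position; \<open>T\<close>, beyond all of \<open>A\<close>, is the default if there is
    none.\<close>
  define t where "t = (LEAST x. x = T \<or> x \<in> A - Q \<and> u x \<in> W)"
  have t: "t = T \<or> t \<in> A - Q \<and> u t \<in> W"
    unfolding t_def by (rule LeastI[of _ T]) simp
  have "w \<in> mix l u t ` A" if w: "w \<in> W" for w
  proof -
    have "w = mix l u t y" if "w = l y" "y \<in> A" for y
    proof (cases "y \<in> Q")
      case True
      then show ?thesis using LU_le(1)[OF lu True] that by (simp add: mix_def)
    next
      case False
      then have "y < t" using t less[of t y] w that T by auto
      then show ?thesis using that by (simp add: mix_def)
    qed
    moreover have "w = mix l u t x" if "w = u x" "x \<in> A" for x
    proof (cases "x \<in> Q")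
      case True
      then show ?thesis using LU_le(1)[OF lu True] that by (simp add: mix_def)
    next
      case False
      then have "t \<le> x" unfolding t_def using that w by (intro Least_le) simp
      then show ?thesis using that by (simp add: mix_def)
    qed
    ultimately show ?thesis using w W by blast
  qed
  then show ?thesis using lu by (auto simp: mixes_def)
qed

lemma edge_of_mix:
  assumes "e \<in> NE i" "a \<in> e" "lev a \<noteq> 0"
  obtains m where "m \<in> mixes" "e \<subseteq> m ` A"
proof -
  obtain S FS m d where c: "(S, FS, m) \<in> charts" "d \<in> FS i" "e = m ` d"
    using assms(1) by (auto simp: union_edges_def)
  have "d \<subseteq> S" using charts_ok[OF c(1)] c(2) sysD by blast
  moreover have "m \<noteq> (\<lambda>b. vx b 0)" using c(3) assms(2,3) by auto
  ultimately show ?thesis using that c unfolding charts_def by blast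
qed

lemma mixes_levels:
  assumes "m \<in> mixes" "a \<in> m ` A" "b \<in> m ` A"
  shows "lev a = 3 \<Longrightarrow> b \<in> p1 ` A \<union> p2 ` A \<union> p3 ` A"
    and "lev a = 1 \<Longrightarrow> b \<in> p0 ` A \<union> p1 ` A \<union> p2 ` A"
    and "lev a = 2 \<Longrightarrow> b \<in> p2 ` A \<union> p3 ` A \<union> p4 ` A"
    and "lev a = 1 \<Longrightarrow> lev b \<noteq> 2"
proof -
  obtain l u t where lu: "m = mix l u t" "(l, u) \<in> LU" using assms(1) by (auto simp: mixes_def)
  obtain x y where xy: "x \<in> A" "y \<in> A" "a = m x" "b = m y" using assms(2,3) by blast
  have a: "a \<in> {l x, u x}" and b: "b \<in> {l y, u y}" using xy lu by (auto simp: mix_def)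
  have lev: "lev (p0 z) = 0" "lev (p1 z) \<in> {0, 1}" "lev (p2 z) \<in> {0, 3}" "lev (p3 z) \<in> {0, 2}"
    "lev (p4 z) = 0" for z by (auto simp: p_defs)
  consider "l = p0" "u = p1" | "l = p1" "u = p2" | "l = p3" "u = p2" | "l = p4" "u = p3"
    using lu(2) by (auto simp: LU_def)
  then have "lev a \<in> {0, 1} \<and> lev b \<in> {0, 1} \<and> b \<in> p0 ` A \<union> p1 ` A \<or>
      lev a \<in> {0, 1, 3} \<and> lev b \<in> {0, 1, 3} \<and> b \<in> p1 ` A \<union> p2 ` A \<or>
      lev a \<in> {0, 2, 3} \<and> lev b \<in> {0, 2, 3} \<and> b \<in> p2 ` A \<union> p3 ` A \<or>
      lev a \<in> {0, 2} \<and> lev b \<in> {0, 2} \<and> b \<in> p3 ` A \<union> p4 ` A"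
  proof cases
    case 1
    have "lev a \<in> {0, 1}" "lev b \<in> {0, 1}" "b \<in> p0 ` A \<union> p1 ` A"
      using a b lev(1,2)[of x] lev(1,2)[of y] xy(2) unfolding 1 by auto
    then show ?thesis by blast
  next
    case 2
    have "lev a \<in> {0, 1, 3}" "lev b \<in> {0, 1, 3}" "b \<in> p1 ` A \<union> p2 ` A"
      using a b lev(2,3)[of x] lev(2,3)[of y] xy(2) unfolding 2 by auto
    then show ?thesis by blast
  next
    case 3
    have "lev a \<in> {0, 2, 3}" "lev b \<in> {0, 2, 3}" "b \<in> p2 ` A \<union> p3 ` A"
      using a b lev(3,4)[of x] lev(3,4)[of y] xy(2) unfolding 3 by auto
    then show ?thesis by blast
  next
    case 4
    have "lev a \<in> {0, 2}" "lev b \<in> {0, 2}" "b \<in> p3 ` A \<union> p4 ` A"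
      using a b lev(4,5)[of x] lev(4,5)[of y] xy(2) unfolding 4 by auto
    then show ?thesis by blast
  qed
  then have "(lev a = 3 \<longrightarrow> b \<in> p1 ` A \<union> p2 ` A \<union> p3 ` A) \<and> (lev a = 1 \<longrightarrow> b \<in> p0 ` A \<union> p1 ` A \<union> p2 ` A)
    \<and> (lev a = 2 \<longrightarrow> b \<in> p2 ` A \<union> p3 ` A \<union> p4 ` A) \<and> (lev a = 1 \<longrightarrow> lev b \<noteq> 2)"
    by (elim disjE conjE) auto
  then show "lev a = 3 \<Longrightarrow> b \<in> p1 ` A \<union> p2 ` A \<union> p3 ` A"
    "lev a = 1 \<Longrightarrow> b \<in> p0 ` A \<union> p1 ` A \<union> p2 ` A"
    "lev a = 2 \<Longrightarrow> b \<in> p2 ` A \<union> p3 ` A \<union> p4 ` A" "lev a = 1 \<Longrightarrow> lev b \<noteq> 2" by blast+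
qed

lemma LU_upper_level: "(l, u) \<in> LU \<Longrightarrow> x \<notin> Q \<Longrightarrow> lev (u x) \<noteq> 0"
  by (auto simp: LU_def p_defs)

text \<open>A point of positive level forces every other point of \<open>W\<close> into a common mix
  with it. Levels 1 and 2 never meet in a mix, and points over \<open>Q\<close> belong to all the
  maps; so the levels that occur confine \<open>W\<close> to one pair \<open>(l, u)\<close>, where
  \<open>cover_by_mix\<close> applies, or else to level 0, which is \<open>B\<close>.\<close>

lemma irr_N:
  assumes W: "W \<subseteq> NV" "irr NE W"
  shows "W \<subseteq> (\<lambda>b. vx b 0) ` B \<or> (\<exists>m\<in>mixes. W \<subseteq> m ` A)"
proof -
  have pair: "\<exists>m\<in>mixes. a \<in> m ` A \<and> b \<in> m ` A" if ab: "a \<in> W" "b \<in> W" "lev a \<noteq> 0" for a b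
  proof (cases "a = b")
    case True
    have "a \<in> NV" using ab W by blast
    then obtain S FS m x where c: "(S, FS, m) \<in> charts" "a = m x" "x \<in> S"
      by (auto simp: union_verts_def)
    moreover have "m \<noteq> (\<lambda>b. vx b 0)" using c(2) ab(3) by auto
    ultimately show ?thesis using True unfolding charts_def by blast
  next
    case False
    then obtain i e where e: "e \<in> NE i" "a \<in> e" "b \<in> e" using W(2) ab unfolding irr_def by blast
    obtain m where "m \<in> mixes" "e \<subseteq> m ` A" using edge_of_mix[OF e(1,2) ab(3)] .
    then show ?thesis using e by blast
  qed
  have less: "y < x" if "(l, u) \<in> LU" "x \<in> A - Q" "y \<in> A - Q" "u x \<in> W" "l y \<in> W" for l u x y
    using pair[of "u x" "l y"] threshold[OF that(1) _ that(2,3)] LU_upper_level[OF that(1), of x] that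
    by blast
  have cover: "\<exists>m\<in>mixes. W \<subseteq> m ` A" if "(l, u) \<in> LU" "\<And>b. b \<in> W \<Longrightarrow> b \<in> l ` A \<union> u ` A" for l u
    using cover_by_mix[OF that(1), of W] that(2) less[OF that(1)] by blast
  have Qp: "p3 y = p1 y" "p2 y = p0 y" "p2 y = p4 y" if "y \<in> Q" for y
    using that agree by (auto simp: p_defs)
  have lev1: "y \<in> Q" if "lev (p1 y) \<noteq> 1" for y using that by (auto simp: p_defs split: if_splits)
  have lev2: "y \<in> Q" if "lev (p3 y) \<noteq> 2" for y using that by (auto simp: p_defs split: if_splits)
  have lev3: "y \<in> Q" if "lev (p2 y) \<noteq> 3" for y using that by (auto simp: p_defs split: if_splits)
  have lev4: "lev n \<in> {0, 1, 2, 3}" for n unfolding lev_def by auto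
  show ?thesis
  proof (cases "\<exists>a\<in>W. lev a = 3")
    case True
    then obtain a where a: "a \<in> W" "lev a = 3" by blast
    have b: "b \<in> p1 ` A \<union> p2 ` A \<union> p3 ` A" if "b \<in> W" for b
      using pair[OF a(1) that] a(2) mixes_levels(1) by fastforce
    show ?thesis
    proof (cases "\<exists>a'\<in>W. lev a' = 2")
      case True
      then obtain a' where a': "a' \<in> W" "lev a' = 2" by blast
      have no1: "lev b \<noteq> 1" if "b \<in> W" for b
        using pair[OF that a'(1)] a'(2) mixes_levels(4) by fastforce
      have "b \<in> p3 ` A \<union> p2 ` A" if bW: "b \<in> W" for b
      proof -
        consider y where "y \<in> A" "b = p1 y" | "b \<in> p3 ` A \<union> p2 ` A" using b[OF bW] by blast
        then show ?thesis
        proof cases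
          case 1
          then have "lev (p1 y) \<noteq> 1" using no1[OF bW] by simp
          then have "b = p3 y" using lev1[of y] Qp(1)[of y] 1 by simp
          then show ?thesis using 1 by blast
        qed
      qed
      then show ?thesis using cover[of p3 p2] by (auto simp: LU_def)
    next
      case False
      have "b \<in> p1 ` A \<union> p2 ` A" if bW: "b \<in> W" for b
      proof -
        consider y where "y \<in> A" "b = p3 y" | "b \<in> p1 ` A \<union> p2 ` A" using b[OF bW] by blast
        then show ?thesis
        proof cases
          case 1
          then have "lev (p3 y) \<noteq> 2" using False bW by auto
          then have "b = p1 y" using lev2[of y] Qp(1)[of y] 1 by simp
          then show ?thesis using 1 by blast
        qed
      qed
      then show ?thesis using cover[of p1 p2] by (auto simp: LU_def)
    qed
  next
    case no3: False
    show ?thesis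
    proof (cases "\<exists>a\<in>W. lev a = 1")
      case True
      then obtain a where a: "a \<in> W" "lev a = 1" by blast
      have b: "b \<in> p0 ` A \<union> p1 ` A \<union> p2 ` A" if "b \<in> W" for b
        using pair[OF a(1) that] a(2) mixes_levels(2) by fastforce
      have "b \<in> p0 ` A \<union> p1 ` A" if bW: "b \<in> W" for b
      proof -
        consider y where "y \<in> A" "b = p2 y" | "b \<in> p0 ` A \<union> p1 ` A" using b[OF bW] by blast
        then show ?thesis
        proof cases
          case 1
          then have "lev (p2 y) \<noteq> 3" using no3 bW by auto
          then have "b = p0 y" using lev3[of y] Qp(2)[of y] 1 by simp
          then show ?thesis using 1 by blast
        qed
      qed
      then show ?thesis using cover[of p0 p1] by (auto simp: LU_def)
    next
      case no1: False
      show ?thesis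
      proof (cases "\<exists>a\<in>W. lev a = 2")
        case True
        then obtain a where a: "a \<in> W" "lev a = 2" by blast
        have b: "b \<in> p2 ` A \<union> p3 ` A \<union> p4 ` A" if "b \<in> W" for b
          using pair[OF a(1) that] a(2) mixes_levels(3) by fastforce
        have "b \<in> p4 ` A \<union> p3 ` A" if bW: "b \<in> W" for b
      proof -
        consider y where "y \<in> A" "b = p2 y" | "b \<in> p4 ` A \<union> p3 ` A" using b[OF bW] by blast
        then show ?thesis
        proof cases
          case 1
          then have "lev (p2 y) \<noteq> 3" using no3 bW by auto
          then have "b = p4 y" using lev3[of y] Qp(3)[of y] 1 by simp
          then show ?thesis using 1 by blast
        qed
      qed
        then show ?thesis using cover[of p4 p3] by (auto simp: LU_def)
      next
        case False
        have "w \<in> (\<lambda>b. vx b 0) ` B" if w: "w \<in> W" for w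
        proof -
          have lev0: "lev w = 0" using lev4[of w] no3 no1 False w by auto
          have "w \<in> NV" using W w by blast
          then consider b where "b \<in> B" "w = vx b 0" | m x where "m \<in> mixes" "x \<in> A" "w = m x"
            by (auto simp: union_verts_def charts_def)
          then show ?thesis
          proof cases
            case 2
            then obtain b k where "b \<in> B" "k < 4" "w = vx b k" using p_bound by blast
            then show ?thesis using lev0 by auto
          qed blast
        qed
        then show ?thesis by blast
      qed
    qed
  qed
qed

lemma K_N: "K NV NE"
proof (rule K_union[OF sys_N])
  fix W assume "W \<subseteq> NV" "irr NE W"
  from irr_N[OF this] show "\<exists>S FS m. K S FS \<and> oemb S FS NV NE m \<and> W \<subseteq> m ` S"
    using A B oemb_base oemb_mix by blast
qed

text \<open>An edge through both \<open>l t\<close> and \<open>u t\<close> would lie in one mix, and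
  \<open>threshold\<close> would yield \<open>t < t\<close>.\<close>

lemma free_move_mix:
  assumes lu: "(l, u) \<in> LU" and t: "t \<in> A - Q"
  shows "free_move A EA NV NE t (mix l u (Suc t)) (mix l u t)"
proof -
  have m: "mix l u (Suc t) \<in> mixes" "mix l u t \<in> mixes" using lu by (auto simp: mixes_def)
  have "u t \<notin> e" if e: "e \<in> NE i" "l t \<in> e" for i e
  proof
    assume "u t \<in> e"
    then obtain m where "m \<in> mixes" "e \<subseteq> m ` A"
      using edge_of_mix[OF e(1)] LU_upper_level[OF lu, of t] t by blast
    then have "t < t" using threshold[OF lu _ t t] e(2) \<open>u t \<in> e\<close> by blast
    then show False by simp
  qed
  then show ?thesis
    using t oemb_mix[OF m(1)] oemb_mix[OF m(2)] LU_le(2)[OF lu, of t]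
    unfolding free_move_def by (auto simp: mix_def)
qed

lemma connected:
  assumes cong: "\<And>m m'. (\<And>x. x \<in> A \<Longrightarrow> m x = m' x) \<Longrightarrow> c m = c m'"
    and move: "\<And>x m m'. x \<notin> Q \<Longrightarrow> free_move A EA NV NE x m m' \<Longrightarrow> c m = c m'"
  shows "c (\<lambda>x. vx (f x) 0) = c (\<lambda>x. vx (g x) 0)"
proof -
  have step: "c l = c u" if lu: "(l, u) \<in> LU" for l u
  proof -
    have "c (mix l u t) = c u" for t
    proof (induction t)
      case 0
      show ?case by (rule cong) (simp add: mix_def)
    next
      case (Suc t)
      have "c (mix l u (Suc t)) = c (mix l u t)"
      proof (cases "t \<in> A - Q")
        case True
        then show ?thesis using move[OF _ free_move_mix[OF lu True]] by blast
      next
        case False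
        show ?thesis
        proof (rule cong)
          fix x assume "x \<in> A"
          then have "x = t \<Longrightarrow> l x = u x" using False LU_le(1)[OF lu, of x] by blast
          then show "mix l u (Suc t) x = mix l u t x" by (auto simp: mix_def less_Suc_eq)
        qed
      qed
      then show ?case using Suc by simp
    qed
    moreover obtain T where T: "A \<subseteq> {..<T}" using finite_bound[OF A(1)] .
    \<comment> \<open>The threshold 0 gives \<open>u\<close>, a threshold beyond \<open>A\<close>
      gives \<open>l\<close>; lowering it by one is a free move or, on \<open>Q\<close> and outside
      \<open>A\<close>, no change at all.\<close>
    have "c (mix l u T) = c l" by (rule cong) (use T in \<open>auto simp: mix_def\<close>)
    ultimately show ?thesis by metis
  qed
  have "c p0 = c p4"
    using step[of p0 p1] step[of p1 p2] step[of p3 p2] step[of p4 p3] by (simp add: LU_def)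
  then show ?thesis by (simp add: p0_def[abs_def] p4_def[abs_def])
qed

end

section \<open>The canonical Ramsey theorem\<close>

context forb_class
begin

text \<open>The path is hidden behind an arbitrary invariant \<open>c\<close> of free moves. In this
  form it is transported along an embedding \<open>j\<close> simply by applying it to
  \<open>c (j \<circ> m)\<close>.\<close>

definition linked :: "nat set \<Rightarrow> ('i \<Rightarrow> nat set set) \<Rightarrow> nat set \<Rightarrow> ('i \<Rightarrow> nat set set) \<Rightarrow> nat set \<Rightarrow>
    ('i \<Rightarrow> nat set set) \<Rightarrow> (nat \<Rightarrow> nat) \<Rightarrow> (nat \<Rightarrow> nat) \<Rightarrow> (nat \<Rightarrow> nat) \<Rightarrow> nat set \<Rightarrow> bool" where
  "linked A EA B EB V E h f g Q \<longleftrightarrow> sys V E \<and> K V E \<and> oemb B EB V E h \<and>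
    (\<forall>c :: (nat \<Rightarrow> nat) \<Rightarrow> nat. (\<forall>m m'. (\<forall>x\<in>A. m x = m' x) \<longrightarrow> c m = c m') \<longrightarrow>
      (\<forall>x m m'. x \<notin> Q \<longrightarrow> free_move A EA V E x m m' \<longrightarrow> c m = c m') \<longrightarrow> c (h \<circ> f) = c (h \<circ> g))"

lemma ex_linked:
  assumes "sys A EA" "K A EA" "sys B EB" "K B EB" "oemb A EA B EB f" "oemb A EA B EB g"
    "\<forall>x\<in>Q. f x = g x" "Q \<subseteq> A"
  shows "\<exists>V E h. linked A EA B EB V E h f g Q"
proof -
  interpret connection ok K A B EA EB f g Q
    by unfold_locales (use assms in auto)
  have "linked A EA B EB NV NE (\<lambda>b. vx b 0) f g Q"
    unfolding linked_def
  proof (intro conjI allI impI sys_N K_N oemb_base)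
    fix c :: "(nat \<Rightarrow> nat) \<Rightarrow> nat"
    assume "\<forall>m m'. (\<forall>x\<in>A. m x = m' x) \<longrightarrow> c m = c m'"
      "\<forall>x m m'. x \<notin> Q \<longrightarrow> free_move A EA NV NE x m m' \<longrightarrow> c m = c m'"
    then have "c (\<lambda>x. vx (f x) 0) = c (\<lambda>x. vx (g x) 0)"
      by (intro connected[of c]) blast+
    then show "c ((\<lambda>b. vx b 0) \<circ> f) = c ((\<lambda>b. vx b 0) \<circ> g)" by (simp add: comp_def)
  qed
  then show ?thesis by blast
qed

theorem canonical:
  assumes A: "sys A EA" "K A EA" and B: "sys B EB" "K B EB"
  obtains C EC where "sys C EC" "K C EC"
    "\<And>\<chi> :: (nat \<Rightarrow> nat) \<Rightarrow> nat. \<exists>w Q. oemb B EB C EC w \<and> Q \<subseteq> A \<and>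
      (\<forall>f\<in>Oemb A EA B EB. \<forall>g\<in>Oemb A EA B EB.
        \<chi> (compose A w f) = \<chi> (compose A w g) \<longleftrightarrow> (\<forall>x\<in>Q. f x = g x))"
proof -
  have finA: "finite A" and finB: "finite B" using A B by (auto simp: sys_def)
  define Hom0 where "Hom0 = Oemb A EA B EB"
  have finHom0: "finite Hom0" using finite_Oemb finA finB by (simp add: Hom0_def)
  have Hom0D: "oemb A EA B EB f" if "f \<in> Hom0" for f using that by (simp add: Hom0_def Oemb_def)
  define Tr where "Tr = {(f, g, Q). f \<in> Hom0 \<and> g \<in> Hom0 \<and> Q \<subseteq> A \<and> (\<forall>x\<in>Q. f x = g x)}"
  have finTr: "finite Tr"
    by (rule finite_subset[of _ "Hom0 \<times> Hom0 \<times> Pow A"]) (auto simp: Tr_def finHom0 finA)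
  have "\<forall>\<tau>\<in>Tr. \<exists>s. case \<tau> of (f, g, Q) \<Rightarrow> linked A EA B EB (fst s) (fst (snd s)) (snd (snd s)) f g Q"
  proof
    fix \<tau> assume \<tau>: "\<tau> \<in> Tr"
    obtain f g Q where fgQ: "\<tau> = (f, g, Q)" by (rule prod_cases3)
    then have "\<exists>V E h. linked A EA B EB V E h f g Q"
      using \<tau> Hom0D by (intro ex_linked A B) (auto simp: Tr_def)
    then show "\<exists>s. case \<tau> of (f, g, Q) \<Rightarrow> linked A EA B EB (fst s) (fst (snd s)) (snd (snd s)) f g Q"
      unfolding fgQ by auto
  qed
  from bchoice[OF this] obtain s where
    "\<forall>\<tau>\<in>Tr. case \<tau> of (f, g, Q) \<Rightarrow>
      linked A EA B EB (fst (s \<tau>)) (fst (snd (s \<tau>))) (snd (snd (s \<tau>))) f g Q" ..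
  then have s: "linked A EA B EB (fst (s (f, g, Q))) (fst (snd (s (f, g, Q))))
      (snd (snd (s (f, g, Q)))) f g Q" if "(f, g, Q) \<in> Tr" for f g Q
    using that by fastforce
  \<comment> \<open>The duplications of \<open>B\<close> serve to show that equal colours force
    agreement on \<open>Q\<close>, the connecting structures serve the converse; \<open>B\<close>
    itself provides the copy \<open>u0\<close>.\<close>
  define \<S> where "\<S> = insert (B, EB) ((\<lambda>v. (dup_verts B v, dup_edges B EB v)) ` B \<union>
    (\<lambda>\<tau>. (fst (s \<tau>), fst (snd (s \<tau>)))) ` Tr)"
  have fin\<S>: "finite \<S>" "\<S> \<noteq> {}" using finB finTr by (auto simp: \<S>_def)
  have \<S>K: "sys S FS \<and> K S FS" if SF: "(S, FS) \<in> \<S>" for S FS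
  proof -
    consider "S = B" "FS = EB" | v where "S = dup_verts B v" "FS = dup_edges B EB v"
      | \<tau> where "\<tau> \<in> Tr" "S = fst (s \<tau>)" "FS = fst (snd (s \<tau>))"
      using SF unfolding \<S>_def by blast
    then show ?thesis
    proof cases
      case 3
      obtain f g Q where fgQ: "\<tau> = (f, g, Q)" by (rule prod_cases3)
      show ?thesis using s[of f g Q] 3 unfolding fgQ linked_def by blast
    qed (use B dup_struct(1)[OF B(1)] dup_K[OF B] in auto)
  qed
  obtain U EU where U: "sys U EU" "K U EU"
    and inU: "\<And>S FS. (S, FS) \<in> \<S> \<Longrightarrow> \<exists>h. oemb S FS U EU h"
    by (rule disjoint_union[OF fin\<S>]) (erule \<S>K, rule that)
  obtain u0 where u0: "oemb B EB U EU u0" using inU[of B EB] by (auto simp: \<S>_def)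
  define S where "S ix = (case ix of None \<Rightarrow> B | Some x \<Rightarrow> dup_verts A x)" for ix
  define FS where "FS ix = (case ix of None \<Rightarrow> EB | Some x \<Rightarrow> dup_edges A EA x)" for ix
  obtain enc :: "((nat \<Rightarrow> nat) \<times> (nat \<Rightarrow> nat)) set \<Rightarrow> nat" where enc: "bij_betw enc (Pow (Hom0 \<times> Hom0)) {0..<card (Pow (Hom0 \<times> Hom0))}"
    using ex_bij_betw_finite_nat[OF finite_Pow_iff[THEN iffD2, OF finite_cartesian_product[OF finHom0 finHom0]]] ..
  \<comment> \<open>Enough colours for the codes of all patterns and for the two values of a
    bit.\<close>
  define k where "k = card (Pow (Hom0 \<times> Hom0)) + 2"
  have Ix: "finite (insert None (Some ` A))" using finA by simp
  have SK: "sys (S ix) (FS ix) \<and> K (S ix) (FS ix)" for ix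
    using A B dup_struct(1)[OF A(1)] dup_K[OF A] by (auto simp: S_def FS_def split: option.split)
  have k0: "0 < k" by (simp add: k_def)
  obtain C EC where C: "sys C EC" "K C EC" and arr: "\<forall>\<chi>::nat option \<Rightarrow> (nat \<Rightarrow> nat) \<Rightarrow> nat. (\<forall>x f. \<chi> x f < k) \<longrightarrow>
    (\<exists>w. oemb U EU C EC w \<and> (\<forall>x\<in>insert None (Some ` A). \<forall>f\<in>Oemb (S x) (FS x) U EU. \<forall>g\<in>Oemb (S x) (FS x) U EU.
      \<chi> x (compose (S x) w f) = \<chi> x (compose (S x) w g)))"
    using ramsey_multi[of "insert None (Some ` A)" S FS U EU k, OF Ix SK U k0] by blast
  have "\<exists>w Q. oemb B EB C EC w \<and> Q \<subseteq> A \<and> (\<forall>f\<in>Oemb A EA B EB. \<forall>g\<in>Oemb A EA B EB.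
        \<chi> (compose A w f) = \<chi> (compose A w g) \<longleftrightarrow> (\<forall>x\<in>Q. f x = g x))" for \<chi> :: "(nat \<Rightarrow> nat) \<Rightarrow> nat"
  proof -
    define pat where "pat d = {(f, g) \<in> Hom0 \<times> Hom0. \<chi> (compose A d f) = \<chi> (compose A d g)}" for d
    define bit where "bit x d = (if \<chi> (compose A d (dup_map x False)) = \<chi> (compose A d (dup_map x True)) then 1 else 0 :: nat)" for x d
    define \<chi>' where "\<chi>' ix d = (case ix of None \<Rightarrow> enc (pat d) | Some x \<Rightarrow> bit x d)" for ix d
    have pat_sub: "pat d \<in> Pow (Hom0 \<times> Hom0)" for d by (auto simp: pat_def)
    have "enc (pat d) < card (Pow (Hom0 \<times> Hom0))" for d using bij_betw_apply[OF enc pat_sub] by simp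
    then have "\<forall>ix d. \<chi>' ix d < k"
      by (auto simp: \<chi>'_def k_def bit_def less_Suc_eq split: option.split)
    then obtain w where w: "oemb U EU C EC w"
      and hom: "\<And>ix f g. ix \<in> insert None (Some ` A) \<Longrightarrow> f \<in> Oemb (S ix) (FS ix) U EU \<Longrightarrow>
        g \<in> Oemb (S ix) (FS ix) U EU \<Longrightarrow> \<chi>' ix (compose (S ix) w f) = \<chi>' ix (compose (S ix) w g)"
      using arr by blast
    define c where "c m = \<chi> (compose A w m)" for m
    have c_cong: "c m = c m'" if "\<And>x. x \<in> A \<Longrightarrow> m x = m' x" for m m'
    proof -
      have "compose A w m = compose A w m'" using that by (auto simp: compose_def fun_eq_iff)
      then show ?thesis by (simp add: c_def)
    qed
    \<comment> \<open>All copies of \<open>B\<close> in \<open>U\<close> induce the same partition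
      of \<open>Hom0\<close>. Whether \<open>f\<close> and \<open>g\<close> have the same colour may
      therefore be tested in whichever copy is convenient.\<close>
    have pattern: "c (u \<circ> f) = c (u \<circ> g) \<longleftrightarrow> c (u' \<circ> f) = c (u' \<circ> g)"
      if u: "oemb B EB U EU u" "oemb B EB U EU u'" and fg: "f \<in> Hom0" "g \<in> Hom0" for u u' f g
    proof -
      have "enc (pat (compose B w (restrict u B))) = enc (pat (compose B w (restrict u' B)))"
        using hom[of None "restrict u B" "restrict u' B"] restrict_in_Oemb[OF u(1)] restrict_in_Oemb[OF u(2)]
        by (simp add: S_def FS_def \<chi>'_def)
      then have "pat (compose B w (restrict u B)) = pat (compose B w (restrict u' B))"
        using enc pat_sub by (auto simp: bij_betw_def inj_on_def)
      moreover have cmp: "compose A (compose B w (restrict v B)) h = compose A w (v \<circ> h)" if "h \<in> Hom0" for v h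
        using emb_in[OF oemb_emb[OF Hom0D[OF that]]] by (auto simp: compose_def fun_eq_iff)
      have "(f, g) \<in> pat (compose B w (restrict v B)) \<longleftrightarrow> c (v \<circ> f) = c (v \<circ> g)" for v
        using fg by (simp add: pat_def cmp c_def)
      ultimately show ?thesis by metis
    qed
    have moves: "c m = c m' \<longleftrightarrow> c n = c n'"
      if mv: "free_move A EA U EU x m m'" "free_move A EA U EU x n n'" for x m m' n n'
    proof -
      have x: "x \<in> A" using mv by (simp add: free_move_def)
      obtain d where d: "oemb (dup_verts A x) (dup_edges A EA x) U EU d"
        "\<And>a. a \<in> A \<Longrightarrow> d (dup_map x False a) = m a" "\<And>a. a \<in> A \<Longrightarrow> d (dup_map x True a) = m' a"
        by (rule free_move_dup[OF A(1) mv(1)]) (rule that)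
      obtain d' where d': "oemb (dup_verts A x) (dup_edges A EA x) U EU d'"
        "\<And>a. a \<in> A \<Longrightarrow> d' (dup_map x False a) = n a" "\<And>a. a \<in> A \<Longrightarrow> d' (dup_map x True a) = n' a"
        by (rule free_move_dup[OF A(1) mv(2)]) (rule that)
      let ?D = "dup_verts A x"
      have eq: "bit x (compose ?D w (restrict d ?D)) = bit x (compose ?D w (restrict d' ?D))"
        using hom[of "Some x" "restrict d ?D" "restrict d' ?D"] x restrict_in_Oemb[OF d(1)] restrict_in_Oemb[OF d'(1)]
        by (simp add: S_def FS_def \<chi>'_def)
      have cc: "\<chi> (compose A (compose ?D w (restrict v ?D)) (dup_map x b)) = c (v \<circ> dup_map x b)" for v b
      proof -
        have "compose A (compose ?D w (restrict v ?D)) (dup_map x b) = compose A w (v \<circ> dup_map x b)"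
          using emb_in[OF oemb_emb[OF dup_struct(2)[OF A(1)]], of _ x b] by (auto simp: compose_def fun_eq_iff)
        then show ?thesis by (simp add: c_def)
      qed
      have "c (d \<circ> dup_map x False) = c m" "c (d \<circ> dup_map x True) = c m'"
        "c (d' \<circ> dup_map x False) = c n" "c (d' \<circ> dup_map x True) = c n'"
        using d d' by (auto intro!: c_cong)
      then show ?thesis using eq unfolding bit_def cc by (auto split: if_splits)
    qed
    \<comment> \<open>The free moves that change the colour; by homogeneity, one for \<open>x\<close> does iff all do.\<close>
    define Q where "Q = {x \<in> A. \<exists>m m'. free_move A EA U EU x m m' \<and> c m \<noteq> c m'}"
    have inQ: "c m \<noteq> c m'" if "x \<in> Q" "free_move A EA U EU x m m'" for x m m'
      using that moves unfolding Q_def by blast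
    have notinQ: "c m = c m'" if "x \<notin> Q" "free_move A EA U EU x m m'" for x m m'
      using that unfolding Q_def free_move_def by blast
    \<comment> \<open>Flipping \<open>v \<in> f ` Q\<close> changes the colour of \<open>f\<close>, hence that of \<open>g\<close>.\<close>
    have sub: "f ` Q \<subseteq> g ` Q" if fg: "f \<in> Hom0" "g \<in> Hom0" and eq: "c (u0 \<circ> f) = c (u0 \<circ> g)" for f g
    proof
      fix v assume "v \<in> f ` Q"
      then obtain x where x: "x \<in> Q" "v = f x" by blast
      then have xA: "x \<in> A" by (simp add: Q_def)
      have vB: "v \<in> B" using emb_in[OF oemb_emb[OF Hom0D[OF fg(1)]] xA] x by simp
      obtain h where h: "oemb (dup_verts B v) (dup_edges B EB v) U EU h"
        using inU[of "dup_verts B v" "dup_edges B EB v"] vB unfolding \<S>_def by blast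
      define u where "u b = h \<circ> dup_map v b" for b
      have u: "oemb B EB U EU (u b)" for b
        unfolding u_def using oemb_comp[OF dup_struct(2)[OF B(1)] h] .
      have e: "c (u b \<circ> f) = c (u b \<circ> g)" for b using pattern[OF u0 u fg] eq by blast
      have flip: "free_move A EA U EU y (u False \<circ> h') (u True \<circ> h')"
        if "h' \<in> Hom0" "y \<in> A" "h' y = v" for h' y
        using free_move_oemb[OF free_move_flip[OF B(1) Hom0D[OF that(1)] that(2)], of U EU h] h
        unfolding u_def that(3) by (simp add: comp_assoc)
      have ne: "c (u False \<circ> f) \<noteq> c (u True \<circ> f)"
        using inQ[OF x(1) flip[OF fg(1) xA]] x(2) by simp
      show "v \<in> g ` Q"
      proof (rule ccontr)
        assume v: "v \<notin> g ` Q"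
        have "c (u False \<circ> g) = c (u True \<circ> g)"
        proof (cases "v \<in> g ` A")
          case True
          then obtain y where y: "y \<in> A" "g y = v" by blast
          then have "y \<notin> Q" using v by blast
          then show ?thesis using notinQ flip[OF fg(2) y] by blast
        next
          \<comment> \<open>Here the duplicated vertex is not in the image of \<open>g\<close>, so
            flipping it does not alter the copy.\<close>
          case False
          show ?thesis
            by (rule c_cong) (use False in \<open>auto simp: u_def dup_map_def\<close>)
        qed
        then show False using ne e by simp
      qed
    qed
    have "c (u0 \<circ> f) = c (u0 \<circ> g) \<longleftrightarrow> (\<forall>x\<in>Q. f x = g x)" if fg: "f \<in> Hom0" "g \<in> Hom0" for f g
    proof
      assume eq: "c (u0 \<circ> f) = c (u0 \<circ> g)"
      have "f ` Q = g ` Q" using sub[OF fg eq] sub[OF fg(2,1) eq[symmetric]] by blast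
      moreover have "strict_mono_on Q f" "strict_mono_on Q g"
        using Hom0D[OF fg(1)] Hom0D[OF fg(2)] by (auto simp: oemb_def strict_mono_on_def Q_def)
      ultimately show "\<forall>x\<in>Q. f x = g x" using strict_mono_on_eqI by blast
    next
      assume agree: "\<forall>x\<in>Q. f x = g x"
      have "(f, g, Q) \<in> Tr" using fg agree by (auto simp: Tr_def Q_def)
      note l = s[OF this]
      define V where "V = fst (s (f, g, Q))"
      define E where "E = fst (snd (s (f, g, Q)))"
      define h where "h = snd (snd (s (f, g, Q)))"
      have l: "linked A EA B EB V E h f g Q" using l unfolding V_def E_def h_def .
      have "(V, E) \<in> \<S>" using \<open>(f, g, Q) \<in> Tr\<close> unfolding \<S>_def V_def E_def by blast
      then obtain j where j: "oemb V E U EU j" using inU by blast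
      have hB: "oemb B EB V E h" using l by (simp add: linked_def)
      have "\<forall>m m'. (\<forall>x\<in>A. m x = m' x) \<longrightarrow> c (j \<circ> m) = c (j \<circ> m')"
        by (intro allI impI c_cong) simp
      moreover have "\<forall>x m m'. x \<notin> Q \<longrightarrow> free_move A EA V E x m m' \<longrightarrow> c (j \<circ> m) = c (j \<circ> m')"
        using notinQ free_move_oemb[OF _ j] by blast
      ultimately have "c (j \<circ> (h \<circ> f)) = c (j \<circ> (h \<circ> g))"
        using l[unfolded linked_def, THEN conjunct2, THEN conjunct2, THEN conjunct2,
            THEN spec[of _ "\<lambda>m. c (j \<circ> m)"]] by blast
      then have "c ((j \<circ> h) \<circ> f) = c ((j \<circ> h) \<circ> g)" by (simp add: comp_assoc)
      \<comment> \<open>The equality obtained in the connecting structure is carried over to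
        \<open>u0\<close> by the common pattern.\<close>
      then show "c (u0 \<circ> f) = c (u0 \<circ> g)" using pattern[OF u0 oemb_comp[OF hB j] fg] by simp
    qed
    moreover have "\<chi> (compose A (w \<circ> u0) f) = c (u0 \<circ> f)" for f
      by (simp add: c_def compose_def)
    ultimately have "\<forall>f\<in>Oemb A EA B EB. \<forall>g\<in>Oemb A EA B EB.
        \<chi> (compose A (w \<circ> u0) f) = \<chi> (compose A (w \<circ> u0) g) \<longleftrightarrow> (\<forall>x\<in>Q. f x = g x)"
      unfolding Hom0_def by simp
    moreover have "Q \<subseteq> A" by (auto simp: Q_def)
    ultimately show ?thesis using oemb_comp[OF u0 w] by blast
  qed
  then show ?thesis using that C by blast
qed

end

section \<open>Hypergraphs on an arbitrary infinite vertex type\<close>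

definition hyp :: "nat set \<Rightarrow> ('i \<Rightarrow> nat set set) \<Rightarrow> (nat, 'i) hypergraph" where
  "hyp V E = \<lparr>verts = V, edges = E, less_rel = {(a, b). a \<in> V \<and> b \<in> V \<and> a < b}\<rparr>"

lemma hyp_simps [simp]: "verts (hyp V E) = V" "edges (hyp V E) = E"
    "(a, b) \<in> less_rel (hyp V E) \<longleftrightarrow> a \<in> V \<and> b \<in> V \<and> a < b"
  by (simp_all add: hyp_def)

definition relabel :: "('a \<Rightarrow> 'b) \<Rightarrow> ('a, 'i) hypergraph \<Rightarrow> ('b, 'i) hypergraph" where
  "relabel \<rho> H = \<lparr>verts = \<rho> ` verts H, edges = (\<lambda>i. image \<rho> ` edges H i),
     less_rel = map_prod \<rho> \<rho> ` less_rel H\<rparr>"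

lemma embeddingsI:
  assumes "\<And>x. x \<in> verts A \<Longrightarrow> f x \<in> verts B" "inj_on f (verts A)"
    "\<And>x y. x \<in> verts A \<Longrightarrow> y \<in> verts A \<Longrightarrow> (x, y) \<in> less_rel A \<longleftrightarrow> (f x, f y) \<in> less_rel B"
    "\<And>i e. i \<in> I \<Longrightarrow> e \<subseteq> verts A \<Longrightarrow> e \<in> edges A i \<longleftrightarrow> f ` e \<in> edges B i"
  shows "restrict f (verts A) \<in> embeddings I A B"
proof -
  have "restrict f (verts A) ` e = f ` e" if "e \<subseteq> verts A" for e using that by force
  moreover have "inj_on (restrict f (verts A)) (verts A)" using assms(2) by (simp add: inj_on_def)
  ultimately show ?thesis using assms by (auto simp: embeddings_def)
qed

lemma relabel_embeddings:
  assumes H: "finite_ordered_hypergraph I r H" and \<rho>: "inj_on \<rho> (verts H)"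
  shows "restrict \<rho> (verts H) \<in> embeddings I H (relabel \<rho> H)"
    and "restrict (inv_into (verts H) \<rho>) (\<rho> ` verts H) \<in> embeddings I (relabel \<rho> H) H"
proof -
  have E: "edges H i \<subseteq> Pow (verts H)" for i
    using H by (cases "i \<in> I") (auto simp: finite_ordered_hypergraph_def nsets_def)
  have L: "less_rel H \<subseteq> verts H \<times> verts H" using H by (simp add: finite_ordered_hypergraph_def)
  have emb: "emb (verts H) (edges H) (\<rho> ` verts H) (\<lambda>i. image \<rho> ` edges H i) \<rho>"
    "emb (\<rho> ` verts H) (\<lambda>i. image \<rho> ` edges H i) (verts H) (edges H) (inv_into (verts H) \<rho>)"
    using emb_relabel[of \<rho> "verts H" "edges H", OF \<rho> E] by blast+
  have less: "(\<rho> x, \<rho> y) \<in> map_prod \<rho> \<rho> ` less_rel H \<longleftrightarrow> (x, y) \<in> less_rel H"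
    if "x \<in> verts H" "y \<in> verts H" for x y
  proof
    assume "(\<rho> x, \<rho> y) \<in> map_prod \<rho> \<rho> ` less_rel H"
    then obtain a b where ab: "(a, b) \<in> less_rel H" "\<rho> x = \<rho> a" "\<rho> y = \<rho> b" by auto
    then have "x = a" "y = b" using L \<rho> that by (auto simp: inj_on_def)
    then show "(x, y) \<in> less_rel H" using ab by simp
  qed (auto intro: rev_image_eqI)
  show "restrict \<rho> (verts H) \<in> embeddings I H (relabel \<rho> H)"
    using \<rho> less emb_edge[OF emb(1)] by (intro embeddingsI) (auto simp: relabel_def)
  have less': "(x, y) \<in> map_prod \<rho> \<rho> ` less_rel H \<longleftrightarrow>
      (inv_into (verts H) \<rho> x, inv_into (verts H) \<rho> y) \<in> less_rel H"
    if "x \<in> \<rho> ` verts H" "y \<in> \<rho> ` verts H" for x y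
    using less[of "inv_into (verts H) \<rho> x" "inv_into (verts H) \<rho> y"] that
    by (simp add: f_inv_into_f inv_into_into)
  have "restrict (inv_into (verts H) \<rho>) (verts (relabel \<rho> H)) \<in> embeddings I (relabel \<rho> H) H"
    using emb_inj[OF emb(2)] emb_edge[OF emb(2)] emb_in[OF emb(2)] less'
    by (intro embeddingsI) (simp_all add: relabel_def)
  then show "restrict (inv_into (verts H) \<rho>) (\<rho> ` verts H) \<in> embeddings I (relabel \<rho> H) H"
    by (simp add: relabel_def)
qed

lemma relabel_hypergraph:
  assumes H: "finite_ordered_hypergraph I r H" and \<rho>: "inj_on \<rho> (verts H)"
  shows "finite_ordered_hypergraph I r (relabel \<rho> H)"
proof -
  have "\<rho> ` e \<in> nsets (\<rho> ` verts H) (r i)" if "i \<in> I" "e \<in> edges H i" for i e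
  proof -
    have e: "e \<subseteq> verts H" "finite e" "card e = r i"
      using H that by (auto simp: finite_ordered_hypergraph_def nsets_def)
    then have "card (\<rho> ` e) = r i" using card_image inj_on_subset[OF \<rho>] by metis
    then show ?thesis using e by (auto simp: nsets_def)
  qed
  moreover have L: "less_rel H \<subseteq> verts H \<times> verts H" and slo: "strict_linear_order_on (verts H) (less_rel H)"
    using H by (auto simp: finite_ordered_hypergraph_def)
  have "strict_linear_order_on (\<rho> ` verts H) (map_prod \<rho> \<rho> ` less_rel H)"
    unfolding strict_linear_order_on_def
  proof (intro conjI)
    show "trans (map_prod \<rho> \<rho> ` less_rel H)"
    proof (rule transI)
      fix x y z assume "(x, y) \<in> map_prod \<rho> \<rho> ` less_rel H" "(y, z) \<in> map_prod \<rho> \<rho> ` less_rel H"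
      then obtain a b c d where *: "(a, b) \<in> less_rel H" "(c, d) \<in> less_rel H" "\<rho> b = \<rho> c"
        "x = \<rho> a" "z = \<rho> d" by auto
      then have "b = c" using L \<rho> by (auto simp: inj_on_def)
      then have "(a, d) \<in> less_rel H" using * slo by (metis strict_linear_order_on_def transD)
      then show "(x, z) \<in> map_prod \<rho> \<rho> ` less_rel H" using * by (auto intro: rev_image_eqI)
    qed
    show "irrefl (map_prod \<rho> \<rho> ` less_rel H)"
      unfolding irrefl_def
    proof (intro allI notI)
      fix x assume "(x, x) \<in> map_prod \<rho> \<rho> ` less_rel H"
      then obtain a b where *: "(a, b) \<in> less_rel H" "\<rho> a = \<rho> b" by auto
      then have "a = b" using L \<rho> by (auto simp: inj_on_def)
      then show False using * slo by (auto simp: strict_linear_order_on_def irrefl_def)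
    qed
    show "total_on (\<rho> ` verts H) (map_prod \<rho> \<rho> ` less_rel H)"
    proof -
      have "(\<rho> x, \<rho> y) \<in> map_prod \<rho> \<rho> ` less_rel H" if "(x, y) \<in> less_rel H" for x y
        using that by (auto intro: rev_image_eqI)
      moreover have "(x, y) \<in> less_rel H \<or> (y, x) \<in> less_rel H"
        if "x \<in> verts H" "y \<in> verts H" "x \<noteq> y" for x y
        using slo that by (simp add: strict_linear_order_on_def total_on_def)
      ultimately show ?thesis unfolding total_on_def by (metis imageE)
    qed
  qed
  ultimately show ?thesis
    using H L by (auto simp: finite_ordered_hypergraph_def relabel_def)
qed

lemma oemb_embeddings:
  assumes "oemb V E V' E' g"
  shows "restrict g V \<in> embeddings I (hyp V E) (hyp V' E')"
proof -
  have inj: "inj_on g V" using emb_inj[OF oemb_emb[OF assms]] .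
  have "x < y \<longleftrightarrow> g x < g y" if "x \<in> V" "y \<in> V" for x y
    using oemb_mono[OF assms that] oemb_mono[OF assms that(2,1)] by (metis nat_neq_iff less_asym)
  then have "restrict g (verts (hyp V E)) \<in> embeddings I (hyp V E) (hyp V' E')"
    using inj emb_edge[OF oemb_emb[OF assms]] emb_in[OF oemb_emb[OF assms]]
    by (intro embeddingsI) auto
  then show ?thesis by simp
qed

lemma embeddings_Oemb:
  assumes f: "f \<in> embeddings I (hyp V E) (hyp V' E')"
    and "\<And>i. i \<notin> I \<Longrightarrow> E i = {}" "\<And>i. i \<notin> I \<Longrightarrow> E' i = {}"
  shows "f \<in> Oemb V E V' E'"
proof -
  have "f ` e \<in> E' i \<longleftrightarrow> e \<in> E i" if "e \<subseteq> V" for e i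
    using f that assms(2,3)[of i] by (cases "i \<in> I") (auto simp: embeddings_def)
  then show ?thesis
    using f by (auto simp: Oemb_def oemb_def emb_def embeddings_def strict_mono_on_def PiE_def)
qed

lemma nat_representation:
  assumes H: "finite_ordered_hypergraph I r H"
  obtains V E a b where "finite_ordered_hypergraph I r (hyp V E)"
    "a \<in> embeddings I H (hyp V E)" "b \<in> embeddings I (hyp V E) H"
    "\<And>x. x \<in> verts H \<Longrightarrow> b (a x) = x" "\<And>y. y \<in> V \<Longrightarrow> a (b y) = y"
proof -
  have fin: "finite (verts H)" and L: "less_rel H \<subseteq> verts H \<times> verts H"
    and tr: "trans (less_rel H)" and ir: "irrefl (less_rel H)" and tot: "total_on (verts H) (less_rel H)"
    using H by (auto simp: finite_ordered_hypergraph_def strict_linear_order_on_def)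
  \<comment> \<open>The rank of a vertex in the linear order; it turns that order into the order of
    the natural numbers.\<close>
  define \<rho> where "\<rho> x = card {y. (y, x) \<in> less_rel H}" for x
  have fin': "finite {y. (y, x) \<in> less_rel H}" for x
    by (rule finite_subset[OF _ fin]) (use L in auto)
  have less: "\<rho> x < \<rho> y" if "(x, y) \<in> less_rel H" for x y
  proof -
    have "{z. (z, x) \<in> less_rel H} \<subset> {z. (z, y) \<in> less_rel H}"
      using that tr ir unfolding trans_def irrefl_def by blast
    then show ?thesis unfolding \<rho>_def by (rule psubset_card_mono[OF fin'])
  qed
  have cases: "x = y \<or> (x, y) \<in> less_rel H \<or> (y, x) \<in> less_rel H" if "x \<in> verts H" "y \<in> verts H" for x y
    using tot that by (auto simp: total_on_def)
  have inj: "inj_on \<rho> (verts H)"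
    by (rule inj_onI) (use cases less in fastforce)
  define E where "E i = image \<rho> ` edges H i" for i
  have "map_prod \<rho> \<rho> ` less_rel H = {(p, q). p \<in> \<rho> ` verts H \<and> q \<in> \<rho> ` verts H \<and> p < q}"
  proof (intro equalityI subsetI)
    fix z assume "z \<in> map_prod \<rho> \<rho> ` less_rel H"
    then show "z \<in> {(p, q). p \<in> \<rho> ` verts H \<and> q \<in> \<rho> ` verts H \<and> p < q}" using less L by auto
  next
    fix z assume "z \<in> {(p, q). p \<in> \<rho> ` verts H \<and> q \<in> \<rho> ` verts H \<and> p < q}"
    then obtain x y where xy: "x \<in> verts H" "y \<in> verts H" "z = (\<rho> x, \<rho> y)" "\<rho> x < \<rho> y" by auto
    then have "(x, y) \<in> less_rel H" using cases[OF xy(1,2)] less[of y x] by fastforce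
    then show "z \<in> map_prod \<rho> \<rho> ` less_rel H" using xy by (auto intro: rev_image_eqI)
  qed
  then have eq: "relabel \<rho> H = hyp (\<rho> ` verts H) E"
    by (simp add: relabel_def hyp_def E_def[abs_def])
  show ?thesis
    using that[of "\<rho> ` verts H" E "restrict \<rho> (verts H)" "restrict (inv_into (verts H) \<rho>) (\<rho> ` verts H)"]
      relabel_hypergraph[OF H inj] relabel_embeddings[OF H inj] inj
    unfolding eq by (simp add: inv_into_into f_inv_into_f)
qed

section \<open>Forbidden hypergraphs as an instance, and the return to the category\<close>

locale hypergraph_forb =
  fixes I :: "'i set" and r :: "'i \<Rightarrow> nat" and F :: "('v, 'i) hypergraph set"
  assumes r_pos: "\<forall>i\<in>I. 0 < r i" and F: "F \<subseteq> Obj (Hgr I r)" and F_irr: "\<forall>X\<in>F. irreducible_hypergraph I X"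
begin

definition ok :: "'i \<Rightarrow> nat \<Rightarrow> bool" where "ok i n \<longleftrightarrow> i \<in> I \<and> n = r i"

definition K :: "nat set \<Rightarrow> ('i \<Rightarrow> nat set set) \<Rightarrow> bool" where
  "K V E \<longleftrightarrow> (\<forall>X\<in>F. embeddings I X (hyp V E) = {})"

sublocale struct_class ok
  by unfold_locales (use r_pos in \<open>auto simp: ok_def\<close>)

text \<open>The image of a forbidden hypergraph is irreducible. If it embedded into a member of the
  class, so would the forbidden hypergraph itself.\<close>

sublocale forb_class ok K
proof unfold_locales
  fix V E
  assume sysV: "sys V E" and irr: "\<And>W. W \<subseteq> V \<Longrightarrow> irr E W \<Longrightarrow> \<exists>V' E' g. K V' E' \<and> oemb W E V' E' g"
  show "K V E"
    unfolding K_def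
  proof (intro ballI, rule ccontr)
    fix X assume X: "X \<in> F" and "embeddings I X (hyp V E) \<noteq> {}"
    then obtain h where h: "h \<in> embeddings I X (hyp V E)" by blast
    let ?W = "h ` verts X"
    have WV: "?W \<subseteq> V" using h by (auto simp: embeddings_def)
    have "irr E ?W"
      unfolding irr_def
    proof (intro ballI impI)
      fix a b assume "a \<in> ?W" "b \<in> ?W" "a \<noteq> b"
      then obtain x y where xy: "x \<in> verts X" "y \<in> verts X" "a = h x" "b = h y" "x \<noteq> y" by blast
      then obtain i e where e: "i \<in> I" "e \<in> edges X i" "x \<in> e" "y \<in> e"
        using F_irr X unfolding irreducible_hypergraph_def by blast
      have "finite_ordered_hypergraph I r X" using F X by (auto simp: Hgr_def)
      then have "edges X i \<subseteq> nsets (verts X) (r i)" using e(1) by (simp add: finite_ordered_hypergraph_def)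
      then have "e \<subseteq> verts X" using e(2) by (auto simp: nsets_def)
      then have "h ` e \<in> E i" "h ` e \<subseteq> ?W" using h e by (auto simp: embeddings_def)
      then show "\<exists>i. \<exists>e\<in>E i. e \<subseteq> ?W \<and> a \<in> e \<and> b \<in> e" using xy e by blast
    qed
    then obtain V' E' g where g: "K V' E'" "oemb ?W E V' E' g" using irr[OF WV] by blast
    have "h \<in> embeddings I X (hyp ?W E)" using h by (auto simp: embeddings_def)
    from compose_in_embeddings[OF this oemb_embeddings[OF g(2)]]
    show False using g(1) X unfolding K_def by blast
  qed
qed

lemma sys_iff: "sys V E \<longleftrightarrow> finite_ordered_hypergraph I r (hyp V E)"
proof -
  have "strict_linear_order_on V {(a, b). a \<in> V \<and> b \<in> V \<and> a < b}" for V :: "nat set"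
    by (auto simp: strict_linear_order_on_def trans_def irrefl_def total_on_def)
  then have "finite_ordered_hypergraph I r (hyp V E) \<longleftrightarrow> finite V \<and>
      (\<forall>i\<in>I. E i \<subseteq> nsets V (r i)) \<and> (\<forall>i. i \<notin> I \<longrightarrow> E i = {})"
    unfolding finite_ordered_hypergraph_def hyp_def by auto
  moreover have "e \<in> nsets V n \<longleftrightarrow> e \<subseteq> V \<and> card e = n" if "finite V" for e n
    using that by (auto simp: nsets_def intro: finite_subset)
  ultimately show ?thesis
    unfolding sys_def ok_def by blast
qed

lemma obj_iff: "H \<in> Obj (Forb (Hgr I r) F) \<longleftrightarrow>
    finite_ordered_hypergraph I r H \<and> (\<forall>X\<in>F. embeddings I X H = {})"
  by (auto simp: Forb_def Hgr_def)

lemma avoids_pullback: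
  assumes "g \<in> embeddings I H H'" "\<forall>X\<in>F. embeddings I X H' = {}"
  shows "\<forall>X\<in>F. embeddings I X H = {}"
  using compose_in_embeddings[OF _ assms(1)] assms(2) by blast

text \<open>The object called for by the canonical arrow is the induced subhypergraph on the
  distinguished vertices, with the inclusion as morphism; precomposing with the inclusion is
  restricting to those vertices.\<close>

definition induced :: "('v, 'i) hypergraph \<Rightarrow> 'v set \<Rightarrow> ('v, 'i) hypergraph" where
  "induced H W = \<lparr>verts = W, edges = (\<lambda>i. {e \<in> edges H i. e \<subseteq> W}), less_rel = less_rel H \<inter> W \<times> W\<rparr>"

lemma induced_obj:
  assumes "H \<in> Obj (Forb (Hgr I r) F)" "W \<subseteq> verts H"
  shows "induced H W \<in> Obj (Forb (Hgr I r) F)" "restrict id W \<in> embeddings I (induced H W) H"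
proof -
  have H: "finite_ordered_hypergraph I r H" using assms by (simp add: obj_iff)
  have "restrict id (verts (induced H W)) \<in> embeddings I (induced H W) H"
    using assms(2) by (intro embeddingsI) (auto simp: induced_def)
  then show inc: "restrict id W \<in> embeddings I (induced H W) H" by (simp add: induced_def)
  have "trans (less_rel H)" using H by (simp add: finite_ordered_hypergraph_def strict_linear_order_on_def)
  then have "trans (less_rel H \<inter> W \<times> W)" by (auto simp: trans_def)
  moreover have "total_on W (less_rel H)" "irrefl (less_rel H)"
    using H total_on_subset[OF _ assms(2)]
    by (auto simp: finite_ordered_hypergraph_def strict_linear_order_on_def)
  then have "total_on W (less_rel H \<inter> W \<times> W)" "irrefl (less_rel H \<inter> W \<times> W)"
    unfolding total_on_def irrefl_def by blast+
  ultimately have "strict_linear_order_on W (less_rel H \<inter> W \<times> W)"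
    by (simp add: strict_linear_order_on_def)
  then have "finite_ordered_hypergraph I r (induced H W)"
    using H assms(2) finite_subset[OF assms(2)]
    by (auto simp: finite_ordered_hypergraph_def induced_def nsets_def)
  then show "induced H W \<in> Obj (Forb (Hgr I r) F)"
    using avoids_pullback[OF inc] assms(1) by (simp add: obj_iff)
qed

lemma canonical_arrow:
  assumes inf: "infinite (UNIV :: 'v set)"
    and A: "A \<in> Obj (Forb (Hgr I r) F)" and B: "B \<in> Obj (Forb (Hgr I r) F)"
  shows "\<exists>D\<in>Obj (Forb (Hgr I r) F). can_arrow (Forb (Hgr I r) F) D B A"
proof -
  obtain VA EA a a' where VA: "finite_ordered_hypergraph I r (hyp VA EA)"
    "a \<in> embeddings I A (hyp VA EA)" "a' \<in> embeddings I (hyp VA EA) A"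
    "\<And>x. x \<in> verts A \<Longrightarrow> a' (a x) = x" "\<And>y. y \<in> VA \<Longrightarrow> a (a' y) = y"
    using nat_representation[of I r A] A unfolding obj_iff by metis
  obtain VB EB b b' where VB: "finite_ordered_hypergraph I r (hyp VB EB)"
    "b \<in> embeddings I B (hyp VB EB)" "b' \<in> embeddings I (hyp VB EB) B"
    "\<And>x. x \<in> verts B \<Longrightarrow> b' (b x) = x" "\<And>y. y \<in> VB \<Longrightarrow> b (b' y) = y"
    using nat_representation[of I r B] B unfolding obj_iff by metis
  have A': "sys VA EA" "K VA EA" and B': "sys VB EB" "K VB EB"
    using VA VB A B avoids_pullback unfolding sys_iff K_def obj_iff by blast+
  obtain C EC where C: "sys C EC" "K C EC" and can:
    "\<And>\<chi> :: (nat \<Rightarrow> nat) \<Rightarrow> nat. \<exists>w Q. oemb VB EB C EC w \<and> Q \<subseteq> VA \<and>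
      (\<forall>f\<in>Oemb VA EA VB EB. \<forall>g\<in>Oemb VA EA VB EB.
        \<chi> (compose VA w f) = \<chi> (compose VA w g) \<longleftrightarrow> (\<forall>x\<in>Q. f x = g x))"
    by (rule canonical[OF A' B']) (rule that)
  obtain \<sigma> :: "nat \<Rightarrow> 'v" where \<sigma>: "inj \<sigma>" using infinite_countable_subset[OF inf] by blast
  have \<sigma>C: "inj_on \<sigma> (verts (hyp C EC))" using \<sigma> by (rule inj_on_subset) simp
  have hC: "finite_ordered_hypergraph I r (hyp C EC)" using C(1) by (simp add: sys_iff)
  define D where "D = relabel \<sigma> (hyp C EC)"
  note emb_D = relabel_embeddings[OF hC \<sigma>C, folded D_def]
  have D: "D \<in> Obj (Forb (Hgr I r) F)"
    using relabel_hypergraph[OF hC \<sigma>C] avoids_pullback[OF emb_D(2)] C(2)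
    unfolding obj_iff K_def D_def by blast
  have aV: "a x \<in> VA" if "x \<in> verts A" for x using VA(2) that by (auto simp: embeddings_def)
  have a'V: "a' x \<in> verts A" if "x \<in> VA" for x using VA(3) that by (auto simp: embeddings_def)
  have bV: "b x \<in> VB" if "x \<in> verts B" for x using VB(2) that by (auto simp: embeddings_def)
  have "can_arrow (Forb (Hgr I r) F) D B A"
    unfolding can_arrow_def
  proof
    fix \<chi> :: "('v \<Rightarrow> 'v) \<Rightarrow> nat"
    obtain w Q where w: "oemb VB EB C EC w" and Q: "Q \<subseteq> VA"
      and wQ: "\<And>f g. f \<in> Oemb VA EA VB EB \<Longrightarrow> g \<in> Oemb VA EA VB EB \<Longrightarrow>
        \<chi> (restrict (\<lambda>x. \<sigma> (compose VA w f (a x))) (verts A)) =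
        \<chi> (restrict (\<lambda>x. \<sigma> (compose VA w g (a x))) (verts A)) \<longleftrightarrow> (\<forall>x\<in>Q. f x = g x)"
      \<comment> \<open>The colouring is pulled back to maps between sets of natural numbers, by
        going into \<open>A\<close> through \<open>a\<close> and out of \<open>C\<close> through
        \<sigma>.\<close>
      using can[of "\<lambda>m. \<chi> (restrict (\<lambda>x. \<sigma> (m (a x))) (verts A))"] by blast
    define W where "W = a' ` Q"
    have WA: "W \<subseteq> verts A" using Q a'V by (auto simp: W_def)
    define v where "v = compose (verts B) (restrict \<sigma> C) (compose (verts B) (restrict w VB) b)"
    have v: "v \<in> embeddings I B D"
      unfolding v_def
      using compose_in_embeddings[OF compose_in_embeddings[OF VB(2) oemb_embeddings[OF w]] emb_D(1)] by simp
    have vx: "v y = \<sigma> (w (b y))" if "y \<in> verts B" for y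
      using that bV emb_in[OF oemb_emb[OF w]] by (simp add: v_def compose_eq)
    define tr where "tr f = compose VA (compose (verts A) b f) a'" for f
    have tr: "tr f \<in> Oemb VA EA VB EB" if f: "f \<in> embeddings I A B" for f
    proof (rule embeddings_Oemb)
      show "tr f \<in> embeddings I (hyp VA EA) (hyp VB EB)"
        using compose_in_embeddings[OF VA(3) compose_in_embeddings[OF f VB(2)]] by (simp add: tr_def)
      show "EA i = {}" "EB i = {}" if "i \<notin> I" for i
        using that VA(1) VB(1) by (auto simp: finite_ordered_hypergraph_def)
    qed
    have trx: "tr f y = b (f (a' y))" if "y \<in> VA" for f y
      using that a'V by (simp add: tr_def compose_eq)
    have f_in: "f x \<in> verts B" if "f \<in> embeddings I A B" "x \<in> verts A" for f x
      using that by (auto simp: embeddings_def)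
    have col: "restrict (\<lambda>x. \<sigma> (compose VA w (tr f) (a x))) (verts A) = compose (verts A) v f"
      if f: "f \<in> embeddings I A B" for f
      using aV trx vx f_in[OF f] VA(4) by (auto simp: compose_def fun_eq_iff)
    have "\<chi> (compose (verts A) v f) = \<chi> (compose (verts A) v g) \<longleftrightarrow>
        compose W f (restrict id W) = compose W g (restrict id W)"
      if fg: "f \<in> embeddings I A B" "g \<in> embeddings I A B" for f g
    proof -
      have "\<chi> (compose (verts A) v f) = \<chi> (compose (verts A) v g) \<longleftrightarrow> (\<forall>y\<in>Q. tr f y = tr g y)"
        using wQ[OF tr[OF fg(1)] tr[OF fg(2)]] col[OF fg(1)] col[OF fg(2)] by simp
      also have "\<dots> \<longleftrightarrow> (\<forall>y\<in>Q. f (a' y) = g (a' y))"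
      proof (intro ball_cong refl)
        fix y assume "y \<in> Q"
        then have y: "y \<in> VA" "f (a' y) \<in> verts B" "g (a' y) \<in> verts B"
          using Q a'V f_in fg by auto
        have "tr f y = b (f (a' y))" "tr g y = b (g (a' y))" using trx[OF y(1)] by auto
        then show "tr f y = tr g y \<longleftrightarrow> f (a' y) = g (a' y)"
          using VB(4)[OF y(2)] VB(4)[OF y(3)] by metis
      qed
      also have "\<dots> \<longleftrightarrow> (\<forall>x\<in>W. f x = g x)" by (simp add: W_def)
      also have "\<dots> \<longleftrightarrow> compose W f (restrict id W) = compose W g (restrict id W)"
        by (auto simp: compose_def fun_eq_iff)
      finally show ?thesis .
    qed
    then show "\<exists>w\<in>Hom (Forb (Hgr I r) F) B D. \<exists>Q\<in>Obj (Forb (Hgr I r) F). \<exists>q\<in>Hom (Forb (Hgr I r) F) Q A.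
        \<forall>f\<in>Hom (Forb (Hgr I r) F) A B. \<forall>g\<in>Hom (Forb (Hgr I r) F) A B.
          \<chi> (Comp (Forb (Hgr I r) F) A B D w f) = \<chi> (Comp (Forb (Hgr I r) F) A B D w g) \<longleftrightarrow>
          Comp (Forb (Hgr I r) F) Q A B f q = Comp (Forb (Hgr I r) F) Q A B g q"
      using v induced_obj[OF A WA]
      by (intro bexI[of _ v] bexI[of _ "induced A W"] bexI[of _ "restrict id W"])
        (auto simp: Forb_def Hgr_def induced_def)
  qed
  then show ?thesis using D by blast
qed

end

theorem theorem6p2:
  fixes I :: "'i set" and r :: "'i \<Rightarrow> nat" and F :: "('v, 'i) hypergraph set"
  assumes "infinite (UNIV :: 'v set)"
    and "\<forall>i\<in>I. 0 < r i"
    and "finite F"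
    and "F \<subseteq> Obj (Hgr I r)"
    and "\<forall>X\<in>F. irreducible_hypergraph I X"
  shows "canonical_ramsey_property (Forb (Hgr I r) F)"
proof -
  interpret hypergraph_forb I r F
    by unfold_locales (use assms in auto)
  show ?thesis
    unfolding canonical_ramsey_property_def using canonical_arrow[OF assms(1)] by blast
qed

end
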